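(* Let $(X,d)$ be a complete metric space, let $k\ge 1$ be an integer, and let $T\in\mathscr I_k(X)$ be an integral metric $k$-current. Then there exists an at most countable family $\{T_i\}_{i\in I}\subseteq\mathscr I_k(X)\setminus\{0\}$ of indecomposable integral $k$-currents such that $$T=\sum_{i\in I}T_i,\qquad \mathsf N(T)=\sum_{i\in I}\mathsf N(T_i).$$
   Context: Standing assumption: the cardinality of every set is an Ulam number (consistent with ZFC); this guarantees that every finite Borel measure on a complete metric space has separable support and is concentrated on a $\sigma$-compact set. Metric currents (Ambrosio--Kirchheim). $\mathrm{LIP}(X)$ is the space of real-valued Lipschitz functions on $X$, $\mathrm{LIP}_b(X)$ the bounded ones, $\mathrm{Lip}(f)$ the Lipschitz constant; $\mathcal D^k(X)=\mathrm{LIP}_b(X)\times \mathrm{LIP}(X)^k$. A metric $k$-current is a multilinear functional $T:\mathcal D^k(X)\to\mathbb R$ such that: (i) $T(f,\pi_1,\dots,\pi_k)=\lim_n T(f,\pi_1^n,\dots,\pi_k^n)$ whenever $\pi_i^n\to\pi_i$ pointwise with $\sup_n \mathrm{Lip}(\pi_i^n)<\infty$ for every $i$; (ii) $T(f,\pi_1,\dots,\pi_k)=0$ whenever some $\pi_i$ is constant on a neighbourhood of $\{f\ne0\}$; (iii) there is a finite Borel measure $\mu$ on $X$ with $|T(f,\pi_1,\dots,\pi_k)|\le\prod_i\mathrm{Lip}(\pi_i)\int|f|\,d\mu$ for all $(f,\pi_1,\dots,\pi_k)\in\mathcal D^k(X)$. The minimal such $\mu$ is the mass measure $\|T\|$;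 $\mathsf M(T)=\|T\|(X)$. $\mathscr M_k(X)$ is the space of metric $k$-currents. Every $T\in\mathscr M_k(X)$ extends uniquely to $L^1(X,\|T\|)\times\mathrm{LIP}(X)^k$ with the same inequality, and for $E\subseteq X$ Borel, $T\llcorner E(f,\pi_1,\dots,\pi_k)=T(\mathbf 1_Ef,\pi_1,\dots,\pi_k)$. Boundary (for $k\ge1$): $\partial T(f,\pi_1,\dots,\pi_{k-1})=T(1,f,\pi_1,\dots,\pi_{k-1})$. $T$ is normal if $\partial T\in\mathscr M_{k-1}(X)$; then $\mathsf N(T)=\mathsf M(T)+\mathsf M(\partial T)$. Pushforward under a Lipschitz map $\varphi:X\to Y$: $\varphi_\#T(f,\pi_1,\dots,\pi_k)=T(f\circ\varphi,\pi_1\circ\varphi,\dots,\pi_k\circ\varphi)$. $T\in\mathscr M_k(X)$ is rectifiable if $\|T\|$ is concentrated on a countably $\mathcal H^k$-rectifiable set and vanishes on $\mathcal H^k$-negligible Borel sets. A rectifiable $T$ is integer-rectifiable if for every Lipschitz $\varphi:X\to\mathbb R^k$ and every open $\Omega\subseteq X$ there is $\theta\in L^1(\mathbb R^k,\mathbb Z)$ with $\varphi_\#(T\llcorner\Omega)(f,\pi_1,\dots,\pi_k)=\int\theta f\det(\partial\pi_i/\partial x_j)_{i,j}\,d\mathcal L^k$ for all $(f,\pi_1,\dots,\pi_k)\in\mathcal D^k(\mathbb R^k)$. $T$ is integral if it is integer-rectifiable and normal; $\mathscr I_k(X)$ is the set of integral $k$-currents. $T\in\mathscr I_k(X)$ is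 decomposable if there are non-zero $R,S\in\mathscr I_k(X)$ with $T=R+S$ and $\mathsf N(T)=\mathsf N(R)+\mathsf N(S)$; otherwise it is indecomposable. Weak convergence $T_n\rightharpoonup T$ means $T_n(f,\pi_1,\dots,\pi_k)\to T(f,\pi_1,\dots,\pi_k)$ for every $(f,\pi_1,\dots,\pi_k)\in\mathcal D^k(X)$. A series of currents denotes the weak limit of its partial sums; if $\sum_i\mathsf M(T_i)<\infty$ the sum does not depend on the ordering of the index set. *)

theory Defs
  imports "HOL-Analysis.Analysis"
begin

section \<open>Ulam numbers\<close>

text \<open>The cardinality of \<open>A\<close> is an Ulam number: every finite measure defined on all subsets
  of \<open>A\<close> that vanishes on points is zero.\<close>

definition ulam :: "'a set \<Rightarrow> bool" where
  "ulam A \<longleftrightarrow> (\<forall>M :: 'a measure. space M = A \<and> sets M = Pow A \<and> finite_measure M \<and>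
      (\<forall>x\<in>A. emeasure M {x} = 0) \<longrightarrow> emeasure M A = 0)"


section \<open>Lipschitz functions\<close>

definition LIP :: "('a::metric_space \<Rightarrow> 'b::metric_space) set" where
  "LIP = {f. \<exists>L. L-lipschitz_on UNIV f}"

definition Lip :: "('a::metric_space \<Rightarrow> 'b::metric_space) \<Rightarrow> real" where
  "Lip f = Inf {L. L-lipschitz_on UNIV f}"

definition LIPb :: "('a::metric_space \<Rightarrow> real) set" where
  "LIPb = {f \<in> LIP. bounded (range f)}"

definition LIPs :: "nat \<Rightarrow> ('a::metric_space \<Rightarrow> real) list set" where
  "LIPs k = {\<pi>. length \<pi> = k \<and> set \<pi> \<subseteq> LIP}"

definition Dk :: "nat \<Rightarrow> (('a::metric_space \<Rightarrow> real) \<times> ('a \<Rightarrow> real) list) set" where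
  "Dk k = LIPb \<times> LIPs k"


section \<open>Metric currents\<close>

text \<open>A functional on \<open>Dk k\<close> is represented by a total function that is \<open>0\<close> outside \<open>Dk k\<close>,
  so that equality of currents is equality in HOL.\<close>

type_synonym 'a functional = "('a \<Rightarrow> real) \<Rightarrow> ('a \<Rightarrow> real) list \<Rightarrow> real"

definition multilinear_on :: "('a::metric_space \<Rightarrow> real) set \<Rightarrow> nat \<Rightarrow> 'a functional \<Rightarrow> bool" where
  "multilinear_on V k T \<longleftrightarrow>
     (\<forall>f\<in>V. \<forall>g\<in>V. \<forall>\<pi>\<in>LIPs k. \<forall>a b.
        T (\<lambda>x. a * f x + b * g x) \<pi> = a * T f \<pi> + b * T g \<pi>) \<and>
     (\<forall>f\<in>V. \<forall>\<pi>\<in>LIPs k. \<forall>i<k. \<forall>p\<in>LIP. \<forall>q\<in>LIP. \<forall>a b.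
        T f (\<pi>[i := (\<lambda>x. a * p x + b * q x)]) = a * T f (\<pi>[i := p]) + b * T f (\<pi>[i := q]))"

definition mass_bound :: "nat \<Rightarrow> 'a::metric_space functional \<Rightarrow> 'a measure \<Rightarrow> bool" where
  "mass_bound k T \<mu> \<longleftrightarrow> sets \<mu> = sets borel \<and> finite_measure \<mu> \<and>
     (\<forall>(f, \<pi>) \<in> Dk k. \<bar>T f \<pi>\<bar> \<le> (\<Prod>p\<leftarrow>\<pi>. Lip p) * (LINT x|\<mu>. \<bar>f x\<bar>))"

definition currents :: "nat \<Rightarrow> 'a::metric_space functional set" where
  "currents k = {T.
     (\<forall>f \<pi>. (f, \<pi>) \<notin> Dk k \<longrightarrow> T f \<pi> = 0) \<and>
     multilinear_on LIPb k T \<and>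
     (\<forall>f \<pi> \<pi>n. (f, \<pi>) \<in> Dk k \<and> (\<forall>n. (f, \<pi>n n) \<in> Dk k) \<and>
        (\<forall>i<k. \<forall>x. (\<lambda>n. (\<pi>n n ! i) x) \<longlonglongrightarrow> (\<pi> ! i) x) \<and>
        (\<forall>i<k. bdd_above (range (\<lambda>n. Lip (\<pi>n n ! i)))) \<longrightarrow>
        (\<lambda>n. T f (\<pi>n n)) \<longlonglongrightarrow> T f \<pi>) \<and>
     (\<forall>f \<pi>. (f, \<pi>) \<in> Dk k \<and>
        (\<exists>i<k. \<exists>U c. open U \<and> {x. f x \<noteq> 0} \<subseteq> U \<and> (\<forall>x\<in>U. (\<pi> ! i) x = c)) \<longrightarrow>
        T f \<pi> = 0) \<and>
     (\<exists>\<mu>. mass_bound k T \<mu>)}"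

definition mass_measure :: "nat \<Rightarrow> 'a::metric_space functional \<Rightarrow> 'a measure" where
  "mass_measure k T = (THE \<mu>. mass_bound k T \<mu> \<and>
     (\<forall>\<nu>. mass_bound k T \<nu> \<longrightarrow> (\<forall>B\<in>sets borel. emeasure \<mu> B \<le> emeasure \<nu> B)))"

definition mass :: "nat \<Rightarrow> 'a::metric_space functional \<Rightarrow> real" where
  "mass k T = measure (mass_measure k T) UNIV"

text \<open>The unique extension of a \<open>k\<close>-current \<open>T\<close> from \<open>LIPb \<times> LIPs k\<close> to
  \<open>L\<^sup>1(\<parallel>T\<parallel>) \<times> LIPs k\<close>. Integrable functions are not identified up to null sets; the
  inequality makes the extension depend on the class only.\<close>

definition extension :: "nat \<Rightarrow> 'a::metric_space functional \<Rightarrow> 'a functional" where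
  "extension k T = (THE T'.
     (\<forall>f \<pi>. \<not> (integrable (mass_measure k T) f \<and> \<pi> \<in> LIPs k) \<longrightarrow> T' f \<pi> = 0) \<and>
     (\<forall>(f, \<pi>) \<in> Dk k. T' f \<pi> = T f \<pi>) \<and>
     multilinear_on {f. integrable (mass_measure k T) f} k T' \<and>
     (\<forall>f \<pi>. integrable (mass_measure k T) f \<and> \<pi> \<in> LIPs k \<longrightarrow>
        \<bar>T' f \<pi>\<bar> \<le> (\<Prod>p\<leftarrow>\<pi>. Lip p) * (LINT x|mass_measure k T. \<bar>f x\<bar>)))"

definition current_restrict :: "nat \<Rightarrow> 'a::metric_space functional \<Rightarrow> 'a set \<Rightarrow> 'a functional" where
  "current_restrict k T E = (\<lambda>f \<pi>.
     if (f, \<pi>) \<in> Dk k then extension k T (\<lambda>x. indicator E x * f x) \<pi> else 0)"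

definition boundary :: "nat \<Rightarrow> 'a::metric_space functional \<Rightarrow> 'a functional" where
  "boundary k T = (\<lambda>f \<pi>. if (f, \<pi>) \<in> Dk (k - 1) then T (\<lambda>_. 1) (f # \<pi>) else 0)"

definition normal_currents :: "nat \<Rightarrow> 'a::metric_space functional set" where
  "normal_currents k = {T \<in> currents k. boundary k T \<in> currents (k - 1)}"

definition normal_mass :: "nat \<Rightarrow> 'a::metric_space functional \<Rightarrow> real" where
  "normal_mass k T = mass k T + mass (k - 1) (boundary k T)"

definition pushforward ::
    "nat \<Rightarrow> ('a::metric_space \<Rightarrow> 'b::metric_space) \<Rightarrow> 'a functional \<Rightarrow> 'b functional" where
  "pushforward k \<phi> T = (\<lambda>f \<pi>.
     if (f, \<pi>) \<in> Dk k then T (f \<circ> \<phi>) (map (\<lambda>p. p \<circ> \<phi>) \<pi>) else 0)"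

definition weakly_converges ::
    "nat \<Rightarrow> ('i \<Rightarrow> 'a::metric_space functional) \<Rightarrow> 'a functional \<Rightarrow> 'i filter \<Rightarrow> bool" where
  "weakly_converges k S T F \<longleftrightarrow> (\<forall>(f, \<pi>) \<in> Dk k. ((\<lambda>n. S n f \<pi>) \<longlongrightarrow> T f \<pi>) F)"

text \<open>The series \<open>\<Sum>i\<in>I. Ts i\<close> as the weak limit of the net of finite partial sums, hence
  independent of any ordering of the index set.\<close>

definition current_has_sum ::
    "nat \<Rightarrow> ('i \<Rightarrow> 'a::metric_space functional) \<Rightarrow> 'a functional \<Rightarrow> 'i set \<Rightarrow> bool" where
  "current_has_sum k Ts T I \<longleftrightarrow>
     weakly_converges k (\<lambda>J f \<pi>. \<Sum>i\<in>J. Ts i f \<pi>) T (finite_subsets_at_top I)"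


section \<open>Rectifiability\<close>

text \<open>Hausdorff outer measure, normalised by the volume of the unit ball. The library's
  \<open>diameter\<close> is only meaningful on bounded sets; empty covering sets contribute \<open>0\<close> also
  for \<open>k = 0\<close>.\<close>

definition hausdorff_delta :: "nat \<Rightarrow> real \<Rightarrow> 'a::metric_space set \<Rightarrow> ennreal" where
  "hausdorff_delta k \<delta> A =
     (INF C \<in> {C :: nat \<Rightarrow> 'a set. A \<subseteq> (\<Union>i. C i) \<and> (\<forall>i. bounded (C i) \<and> diameter (C i) \<le> \<delta>)}.
        \<Sum>i. if C i = {} then 0 else ennreal (unit_ball_vol (real k) * (diameter (C i) / 2) ^ k))"

definition hausdorff_measure :: "nat \<Rightarrow> 'a::metric_space set \<Rightarrow> ennreal" where
  "hausdorff_measure k A = (SUP \<delta> \<in> {0<..}. hausdorff_delta k \<delta> A)"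

text \<open>From here on the dimension is \<open>k = CARD('n)\<close>, and \<open>real ^ 'n\<close> is the Euclidean
  \<open>k\<close>-space.\<close>

definition countably_rectifiable :: "'n::finite itself \<Rightarrow> 'a::metric_space set \<Rightarrow> bool" where
  "countably_rectifiable _ S \<longleftrightarrow>
     (\<exists>(A :: nat \<Rightarrow> (real ^ 'n) set) (g :: nat \<Rightarrow> real ^ 'n \<Rightarrow> 'a).
        (\<forall>i. \<exists>L. L-lipschitz_on (A i) (g i)) \<and>
        hausdorff_measure CARD('n) (S - (\<Union>i. g i ` A i)) = 0)"

definition rectifiable_currents :: "'n::finite itself \<Rightarrow> 'a::metric_space functional set" where
  "rectifiable_currents n = {T \<in> currents CARD('n).
     (\<exists>S. countably_rectifiable n S \<and> (AE x in mass_measure CARD('n) T. x \<in> S)) \<and>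
     (\<forall>B\<in>sets borel. hausdorff_measure CARD('n) B = 0 \<longrightarrow>
        emeasure (mass_measure CARD('n) T) B = 0)}"

text \<open>\<open>det (\<partial>\<pi>\<^sub>i/\<partial>x\<^sub>j)\<close>. The list \<open>\<pi>\<close> is indexed by \<open>{..<k}\<close> and the
  coordinates by \<open>'n\<close>; \<open>to_nat_on UNIV\<close> is a bijection from \<open>'n\<close> onto \<open>{..<k}\<close>, used for rows
  and columns alike.\<close>

definition partial_deriv :: "'n::finite \<Rightarrow> (real ^ 'n \<Rightarrow> real) \<Rightarrow> real ^ 'n \<Rightarrow> real" where
  "partial_deriv j p x = deriv (\<lambda>t. p (x + t *\<^sub>R axis j 1)) 0"

definition jacobian_det :: "(real ^ 'n::finite \<Rightarrow> real) list \<Rightarrow> real ^ 'n \<Rightarrow> real" where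
  "jacobian_det \<pi> x =
     det (\<chi> i j. partial_deriv j (\<pi> ! to_nat_on (UNIV :: 'n set) i) x :: real ^ 'n ^ 'n)"

definition integer_rectifiable_currents ::
    "'n::finite itself \<Rightarrow> 'a::metric_space functional set" where
  "integer_rectifiable_currents n = {T \<in> rectifiable_currents n.
     \<forall>\<phi> :: 'a \<Rightarrow> real ^ 'n. \<forall>\<Omega>. \<phi> \<in> LIP \<and> open \<Omega> \<longrightarrow>
       (\<exists>\<theta> :: real ^ 'n \<Rightarrow> int. integrable lebesgue (\<lambda>x. real_of_int (\<theta> x)) \<and>
          (\<forall>(f, \<pi>) \<in> Dk CARD('n).
             pushforward CARD('n) \<phi> (current_restrict CARD('n) T \<Omega>) f \<pi> =
             (LINT x|lebesgue. real_of_int (\<theta> x) * f x * jacobian_det \<pi> x)))}"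

definition integral_currents :: "'n::finite itself \<Rightarrow> 'a::metric_space functional set" where
  "integral_currents n = integer_rectifiable_currents n \<inter> normal_currents CARD('n)"


section \<open>Decomposability\<close>

definition zero_current :: "'a functional" where
  "zero_current = (\<lambda>_ _. 0)"

definition decomposable :: "'n::finite itself \<Rightarrow> 'a::metric_space functional \<Rightarrow> bool" where
  "decomposable n T \<longleftrightarrow>
     (\<exists>R \<in> integral_currents n - {zero_current}. \<exists>S \<in> integral_currents n - {zero_current}.
        T = (\<lambda>f \<pi>. R f \<pi> + S f \<pi>) \<and>
        normal_mass CARD('n) T = normal_mass CARD('n) R + normal_mass CARD('n) S)"

end

theory Submission
  imports Defs "HOL-Library.Function_Algebras"
begin

text \<open>Write \<open>R \<le> T\<close> when \<open>N(T) = N(R) + N(T - R)\<close>. Integral currents form a group that is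
  complete for the norm \<open>N\<close>, so a greedy choice of pieces of nearly maximal norm exhausts \<open>T\<close> by
  pieces from any given class, up to a remainder \<open>R \<le> T\<close> having no nonzero piece in the class. For the
  class of indecomposable currents the remainder vanishes as soon as every nonzero \<open>T\<close> has a nonzero
  indecomposable piece. To see the latter, exhaust \<open>T\<close> by pieces of norm at most \<open>\<epsilon>\<close>. A nonzero
  remainder has no nonzero piece of norm at most \<open>\<epsilon>\<close>, so a piece of it with nearly minimal norm is
  indecomposable. If the remainder is zero for every \<open>\<epsilon>\<close>, then \<open>T\<close> is dust, which is
  excluded by the estimate \<open>\<bar>S(f, \<pi>)\<bar> \<le> r C(f, \<pi>) N(S)\<close> for all \<open>S\<close> of norm small compared to \<open>r\<^sup>k\<close>.

  For the estimate, \<open>S(f, \<pi>)\<close> is the integral over \<open>s\<close> of \<open>S\<close> restricted to \<open>{f > s}\<close> evaluated at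
  \<open>(1, \<pi>)\<close>, that is, of \<open>\<integral>\<theta>\<^sub>s\<close> for the integer density \<open>\<theta>\<^sub>s\<close> of the push-forward under \<open>\<pi>\<close>. As \<open>\<theta>\<^sub>s\<close> is
  integer valued, the measure of its support is at most its small \<open>L\<^sup>1\<close> norm, so averaging over
  translations bounds that norm by \<open>r\<close> times the variation of \<open>\<theta>\<^sub>s\<close>, which the mass of \<open>\<partial>S\<close>
  and of the slice of \<open>S\<close> at \<open>f = s\<close> control.\<close>




text \<open>The obstacle is that pieces may split forever: their norms have no positive lower bound
  a priori, and no compactness argument provides a minimal piece. Exhausting by small pieces creates
  such a bound e on the remainder; a summand of norm more than e and another of norm at least the
  infimum cannot fit into a piece whose norm is within e of the infimum. Dust is refuted by a single
  pair with T(f, \<pi>) \<noteq> 0: summed over the pieces, the estimate gives \<bar>T(f,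
  \<pi>)\<bar> \<le> r C N(T), where C depends only on f and \<pi>, so r can be fixed first and e
  afterwards. Slices are never built as currents. Ramps approximate the superlevel set, a product
  rule deduced from locality and the mass bound produces the boundary term, and the mass of S in
  thin strips around a level stands in for the mass of the slice. Its integral over all levels is at
  most three times the mass of S. Before that, the definite descriptions need witnesses, namely a
  least mass measure and an L1 extension, and integral currents must be closed under series of
  summable norm, which is the completeness used by the exhaustion.\<close>

subsection \<open>Lipschitz functions\<close>

lemma LIP_realI:
  fixes f :: "'a::metric_space \<Rightarrow> real"
  assumes "\<And>x y. \<bar>f x - f y\<bar> \<le> L * dist x y"
  shows "f \<in> LIP"
proof -
  have "\<bar>f x - f y\<bar> \<le> max L 0 * dist x y" for x y
    using assms[of x y] mult_right_mono[of L "max L 0" "dist x y"] by simp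
  then have "(max L 0)-lipschitz_on UNIV f"
    by (auto simp: lipschitz_on_def dist_real_def)
  then show ?thesis unfolding LIP_def by blast
qed

text \<open>Every difference quotient is a lower bound of the set of admissible constants, hence
  lies below its infimum. So the infimum is attained, and \<open>Lip f\<close> itself serves as the
  constant in all later estimates.\<close>

lemma lipschitz_on_Lip:
  assumes "f \<in> LIP"
  shows "(Lip f)-lipschitz_on UNIV f"
proof -
  let ?S = "{L. L-lipschitz_on UNIV f}"
  have ne: "?S \<noteq> {}" using assms by (auto simp: LIP_def)
  have bdd: "bdd_below ?S" by (rule bdd_belowI[of _ 0]) (auto simp: lipschitz_on_def)
  have "0 \<le> Lip f" unfolding Lip_def by (rule cInf_greatest[OF ne]) (auto simp: lipschitz_on_def)
  moreover have "dist (f x) (f y) \<le> Lip f * dist x y" for x y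
  proof (cases "x = y")
    case False
    then have "dist (f x) (f y) / dist x y \<le> Lip f"
      unfolding Lip_def by (intro cInf_greatest[OF ne]) (auto simp: lipschitz_on_def divide_simps)
    then show ?thesis using False by (simp add: divide_simps)
  qed simp
  ultimately show ?thesis by (auto simp: lipschitz_on_def)
qed

lemma Lip_nonneg: "f \<in> LIP \<Longrightarrow> 0 \<le> Lip f"
  using lipschitz_on_Lip lipschitz_on_nonneg by blast

lemma Lip_le: "L-lipschitz_on UNIV f \<Longrightarrow> Lip f \<le> L"
  unfolding Lip_def by (rule cInf_lower) (auto intro!: bdd_belowI[of _ 0] simp: lipschitz_on_def)

lemma Lip_le_real:
  fixes f :: "'a::metric_space \<Rightarrow> real"
  assumes "\<And>x y. \<bar>f x - f y\<bar> \<le> L * dist x y" "0 \<le> L"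
  shows "Lip f \<le> L"
  by (rule Lip_le) (use assms in \<open>auto simp: lipschitz_on_def dist_real_def\<close>)

lemma Lip_bound: "f \<in> LIP \<Longrightarrow> dist (f x) (f y) \<le> Lip f * dist x y"
  using lipschitz_on_Lip by (auto simp: lipschitz_on_def)

lemma Lip_bound_real:
  fixes f :: "'a::metric_space \<Rightarrow> real"
  shows "f \<in> LIP \<Longrightarrow> \<bar>f x - f y\<bar> \<le> Lip f * dist x y"
  using Lip_bound[of f x y] by (simp add: dist_real_def)

lemma LIP_continuous_on: "f \<in> LIP \<Longrightarrow> continuous_on A f"
  using lipschitz_on_continuous_on[OF lipschitz_on_Lip] continuous_on_subset by blast

lemma LIP_const: "(\<lambda>_. c) \<in> LIP"
  unfolding LIP_def using lipschitz_on_constant by blast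

lemma LIP_comp: "f \<in> LIP \<Longrightarrow> g \<in> LIP \<Longrightarrow> (\<lambda>x. f (g x)) \<in> LIP"
  using lipschitz_on_compose2[of _ UNIV g _ f] lipschitz_on_subset
  unfolding LIP_def by blast

lemma LIP_lincomb:
  fixes f g :: "'a::metric_space \<Rightarrow> real"
  assumes "f \<in> LIP" "g \<in> LIP"
  shows "(\<lambda>x. a * f x + b * g x) \<in> LIP"
proof (rule LIP_realI)
  fix x y
  have "\<bar>(a * f x + b * g x) - (a * f y + b * g y)\<bar> = \<bar>a * (f x - f y) + b * (g x - g y)\<bar>"
    by (simp add: algebra_simps)
  also have "\<dots> \<le> \<bar>a\<bar> * \<bar>f x - f y\<bar> + \<bar>b\<bar> * \<bar>g x - g y\<bar>"
    by (metis abs_triangle_ineq abs_mult)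
  also have "\<dots> \<le> \<bar>a\<bar> * (Lip f * dist x y) + \<bar>b\<bar> * (Lip g * dist x y)"
    by (intro add_mono mult_left_mono Lip_bound_real assms) auto
  finally show "\<bar>(a * f x + b * g x) - (a * f y + b * g y)\<bar> \<le> (\<bar>a\<bar> * Lip f + \<bar>b\<bar> * Lip g) * dist x y"
    by (simp add: algebra_simps)
qed

lemma LIP_max:
  fixes f g :: "'a::metric_space \<Rightarrow> real"
  assumes "f \<in> LIP" "g \<in> LIP"
  shows "(\<lambda>x. max (f x) (g x)) \<in> LIP"
proof (rule LIP_realI)
  fix x y
  have "\<bar>max (f x) (g x) - max (f y) (g y)\<bar> \<le> \<bar>f x - f y\<bar> + \<bar>g x - g y\<bar>" by linarith
  also have "\<dots> \<le> Lip f * dist x y + Lip g * dist x y" by (intro add_mono Lip_bound_real assms)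
  finally show "\<bar>max (f x) (g x) - max (f y) (g y)\<bar> \<le> (Lip f + Lip g) * dist x y"
    by (simp add: algebra_simps)
qed

lemma LIP_uminus: "f \<in> LIP \<Longrightarrow> (\<lambda>x. - f x :: real) \<in> LIP"
  using LIP_lincomb[of f f "-1" 0] by simp

lemma LIP_add: "f \<in> LIP \<Longrightarrow> g \<in> LIP \<Longrightarrow> (\<lambda>x. f x + g x :: real) \<in> LIP"
  using LIP_lincomb[of f g 1 1] by simp

lemma LIP_diff: "f \<in> LIP \<Longrightarrow> g \<in> LIP \<Longrightarrow> (\<lambda>x. f x - g x :: real) \<in> LIP"
  using LIP_lincomb[of f g 1 "-1"] by simp

lemma LIP_cmult: "f \<in> LIP \<Longrightarrow> (\<lambda>x. c * f x :: real) \<in> LIP"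
  using LIP_lincomb[of f f c 0] by simp

lemma LIP_min:
  fixes f g :: "'a::metric_space \<Rightarrow> real"
  assumes "f \<in> LIP" "g \<in> LIP"
  shows "(\<lambda>x. min (f x) (g x)) \<in> LIP"
proof -
  have "(\<lambda>x. min (f x) (g x)) = (\<lambda>x. - max (- f x) (- g x))" by (auto simp: max_def min_def)
  then show ?thesis by (simp add: LIP_uminus LIP_max assms)
qed

lemma LIP_abs:
  fixes f :: "'a::metric_space \<Rightarrow> real"
  assumes "f \<in> LIP"
  shows "(\<lambda>x. \<bar>f x\<bar>) \<in> LIP"
proof -
  have "(\<lambda>x. \<bar>f x\<bar>) = (\<lambda>x. max (f x) (- f x))" by (auto simp: max_def)
  then show ?thesis by (simp add: LIP_uminus LIP_max assms)
qed

lemma LIPbI: "f \<in> LIP \<Longrightarrow> (\<And>x. \<bar>f x\<bar> \<le> B) \<Longrightarrow> f \<in> LIPb"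
  unfolding LIPb_def by (auto simp: bounded_iff)

lemma LIPb_LIP: "f \<in> LIPb \<Longrightarrow> f \<in> LIP" by (simp add: LIPb_def)

lemma LIPb_bound:
  assumes "f \<in> LIPb"
  obtains B where "0 < B" "\<And>x. \<bar>f x\<bar> \<le> B"
proof -
  from assms obtain B where "\<forall>x. \<bar>f x\<bar> \<le> B" by (auto simp: LIPb_def bounded_iff)
  then have "\<bar>f x\<bar> \<le> max B 1" for x by (simp add: le_max_iff_disj)
  then show ?thesis using that[of "max B 1"] by simp
qed

lemma LIPb_const: "(\<lambda>_. c) \<in> LIPb"
  by (rule LIPbI[of _ "\<bar>c\<bar>"]) (auto simp: LIP_const)

lemma LIPb_lincomb:
  assumes "f \<in> LIPb" "g \<in> LIPb"
  shows "(\<lambda>x. a * f x + b * g x) \<in> LIPb"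
proof -
  obtain B C where B: "\<And>x. \<bar>f x\<bar> \<le> B" and C: "\<And>x. \<bar>g x\<bar> \<le> C" by (metis LIPb_bound assms)
  have "\<bar>a * f x + b * g x\<bar> \<le> \<bar>a\<bar> * B + \<bar>b\<bar> * C" for x
  proof -
    have "\<bar>a * f x + b * g x\<bar> \<le> \<bar>a\<bar> * \<bar>f x\<bar> + \<bar>b\<bar> * \<bar>g x\<bar>" by (metis abs_triangle_ineq abs_mult)
    also have "\<dots> \<le> \<bar>a\<bar> * B + \<bar>b\<bar> * C" by (intro add_mono mult_left_mono B C) auto
    finally show ?thesis .
  qed
  then show ?thesis using assms by (intro LIPbI LIP_lincomb) (auto simp: LIPb_def)
qed

lemma LIPb_add: "f \<in> LIPb \<Longrightarrow> g \<in> LIPb \<Longrightarrow> (\<lambda>x. f x + g x) \<in> LIPb"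
  using LIPb_lincomb[of f g 1 1] by simp

lemma LIPb_diff: "f \<in> LIPb \<Longrightarrow> g \<in> LIPb \<Longrightarrow> (\<lambda>x. f x - g x) \<in> LIPb"
  using LIPb_lincomb[of f g 1 "-1"] by simp

lemma LIPb_sum: "(\<And>i. i \<in> A \<Longrightarrow> f i \<in> LIPb) \<Longrightarrow> (\<lambda>x. \<Sum>i\<in>A. f i x) \<in> LIPb"
  by (induction A rule: infinite_finite_induct) (auto intro: LIPb_const LIPb_add)

lemma LIPb_mult:
  fixes f g :: "'a::metric_space \<Rightarrow> real"
  assumes "f \<in> LIPb" "g \<in> LIPb"
  shows "(\<lambda>x. f x * g x) \<in> LIPb"
proof -
  obtain B C where B: "0 < B" "\<And>x. \<bar>f x\<bar> \<le> B" and C: "0 < C" "\<And>x. \<bar>g x\<bar> \<le> C"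
    by (metis LIPb_bound assms)
  have f: "f \<in> LIP" and g: "g \<in> LIP" using assms by (auto simp: LIPb_def)
  show ?thesis
  proof (rule LIPbI[of _ "B * C"], rule LIP_realI)
    show "\<bar>f x * g x\<bar> \<le> B * C" for x
      using B C by (simp add: abs_mult mult_mono)
    fix x y
    have "\<bar>f x * g x - f y * g y\<bar> = \<bar>f x * (g x - g y) + g y * (f x - f y)\<bar>" by (simp add: algebra_simps)
    also have "\<dots> \<le> \<bar>f x\<bar> * \<bar>g x - g y\<bar> + \<bar>g y\<bar> * \<bar>f x - f y\<bar>" by (metis abs_triangle_ineq abs_mult)
    also have "\<dots> \<le> B * (Lip g * dist x y) + C * (Lip f * dist x y)"
      by (intro add_mono mult_mono B C Lip_bound_real f g) (use B C in auto)
    finally show "\<bar>f x * g x - f y * g y\<bar> \<le> (B * Lip g + C * Lip f) * dist x y"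
      by (simp add: algebra_simps)
  qed
qed

lemma LIPb_comp: "f \<in> LIPb \<Longrightarrow> g \<in> LIP \<Longrightarrow> (\<lambda>x. f (g x)) \<in> LIPb"
  unfolding LIPb_def by (auto intro: LIP_comp simp: bounded_iff)

lemma LIPs_nth: "\<pi> \<in> LIPs k \<Longrightarrow> i < k \<Longrightarrow> \<pi> ! i \<in> LIP"
  by (auto simp: LIPs_def)

lemma LIPs_update: "\<pi> \<in> LIPs k \<Longrightarrow> p \<in> LIP \<Longrightarrow> \<pi>[i := p] \<in> LIPs k"
  using set_update_subset_insert[of \<pi> i p] by (auto simp: LIPs_def)

lemma LIPs_Cons: "p # \<pi> \<in> LIPs (Suc k) \<longleftrightarrow> p \<in> LIP \<and> \<pi> \<in> LIPs k"
  by (auto simp: LIPs_def)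

lemma prod_Lip_nonneg: "\<pi> \<in> LIPs k \<Longrightarrow> 0 \<le> (\<Prod>p\<leftarrow>\<pi>. Lip p)"
  by (rule prod_list_nonneg) (auto simp: LIPs_def intro!: Lip_nonneg)


subsection \<open>Finite Borel measures\<close>

abbreviation finite_borel :: "'a::metric_space measure \<Rightarrow> bool" where
  "finite_borel \<mu> \<equiv> sets \<mu> = sets borel \<and> finite_measure \<mu>"

lemma finite_borel_space: "sets \<mu> = sets borel \<Longrightarrow> space \<mu> = UNIV"
  by (metis sets_eq_imp_space_eq space_borel)

lemma LIP_measurable:
  fixes f :: "'a::metric_space \<Rightarrow> real"
  shows "f \<in> LIP \<Longrightarrow> sets \<mu> = sets borel \<Longrightarrow> f \<in> borel_measurable \<mu>"
  using borel_measurable_continuous_onI[OF LIP_continuous_on] measurable_cong_sets by blast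

lemma bounded_integrable:
  assumes "finite_borel \<mu>" "f \<in> borel_measurable borel" "\<And>x. \<bar>f x\<bar> \<le> (B::real)"
  shows "integrable \<mu> f"
proof -
  interpret finite_measure \<mu> using assms by simp
  have "f \<in> borel_measurable \<mu>" using assms(1,2) measurable_cong_sets by blast
  then show ?thesis by (intro integrable_const_bound[of _ B]) (auto simp: assms)
qed

lemma LIPb_integrable: "f \<in> LIPb \<Longrightarrow> finite_borel \<mu> \<Longrightarrow> integrable \<mu> f"
  by (metis LIPb_bound LIPb_LIP LIP_measurable bounded_integrable)

lemma abs_integral_le_bound:
  assumes "f \<in> borel_measurable borel" "finite_borel \<mu>" "\<And>x. \<bar>f x\<bar> \<le> (B::real)"
  shows "(LINT x|\<mu>. \<bar>f x\<bar>) \<le> B * measure \<mu> UNIV"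
proof -
  interpret finite_measure \<mu> using assms by simp
  have "(LINT x|\<mu>. \<bar>f x\<bar>) \<le> (LINT x|\<mu>. B)"
    using bounded_integrable[OF assms(2,1,3)] by (intro integral_mono) (auto simp: assms)
  then show ?thesis using finite_borel_space[of \<mu>] assms(2) by (simp add: mult.commute)
qed

section \<open>Density of bounded Lipschitz functions in L1 of a finite Borel measure\<close>

lemma closed_indicator_approx:
  assumes "finite_borel \<mu>" "closed C"
  shows "\<exists>g. (\<forall>n. g n \<in> LIPb) \<and> (\<lambda>n. LINT x|\<mu>. \<bar>g n x - indicator C x\<bar>) \<longlonglongrightarrow> 0"
proof (cases "C = {}")
  case True
  then show ?thesis by (intro exI[of _ "\<lambda>n x. 0"]) (auto simp: LIPb_const)
next
  case ne: False
  interpret finite_measure \<mu> using assms by simp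
  \<comment> \<open>Cut-offs of slope \<open>n\<close> around \<open>C\<close>, equal to 1 on
    \<open>C\<close> and eventually 0 at every point off the closed set. The empty set is treated
    apart because \<open>infdist\<close> to it is 0 everywhere, which would make every
    \<open>g n\<close> the constant 1.\<close>
  define g where "g n x = max 0 (1 - real n * infdist x C)" for n :: nat and x
  have infL: "(\<lambda>x. infdist x C) \<in> LIP"
    by (rule LIP_realI[of _ 1]) (simp add: infdist_triangle_abs)
  have gL: "g n \<in> LIPb" for n
  proof (rule LIPbI[of _ 1])
    show "g n \<in> LIP" unfolding g_def
      by (intro LIP_max LIP_const LIP_diff LIP_cmult infL)
    show "\<bar>g n x\<bar> \<le> 1" for x by (auto simp: g_def infdist_nonneg)
  qed
  have lim: "(\<lambda>n. \<bar>g n x - indicator C x\<bar>) \<longlonglongrightarrow> 0" for x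
  proof (cases "x \<in> C")
    case True then show ?thesis by (simp add: g_def)
  next
    case False
    then have pos: "infdist x C > 0"
      using ne assms(2) by (metis in_closed_iff_infdist_zero infdist_nonneg order_less_le)
    then obtain N where N: "real N * infdist x C > 1" using reals_Archimedean3 by blast
    have "eventually (\<lambda>n. \<bar>g n x - indicator C x\<bar> = 0) sequentially"
      unfolding eventually_sequentially
    proof (intro exI allI impI)
      fix n assume "N \<le> n"
      then have "real N * infdist x C \<le> real n * infdist x C" using pos by simp
      then show "\<bar>g n x - indicator C x\<bar> = 0" using N False by (simp add: g_def)
    qed
    then show ?thesis by (simp add: tendsto_eventually)
  qed
  have "(\<lambda>n. LINT x|\<mu>. \<bar>g n x - indicator C x\<bar>) \<longlonglongrightarrow> (LINT x|\<mu>. 0)"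
  proof (rule integral_dominated_convergence[where w = "\<lambda>_. 2"])
    show "(\<lambda>x. \<bar>g i x - indicator C x\<bar>) \<in> borel_measurable \<mu>" for i
    proof -
      have [measurable]: "g i \<in> borel_measurable \<mu>" "C \<in> sets \<mu>"
        using LIP_measurable[OF LIPb_LIP[OF gL]] assms by auto
      show ?thesis by measurable
    qed
    show "AE x in \<mu>. norm \<bar>g i x - indicator C x\<bar> \<le> 2" for i
    proof (rule AE_I2)
      fix x
      have "0 \<le> real i * infdist x C" by (simp add: infdist_nonneg)
      then show "norm \<bar>g i x - indicator C x\<bar> \<le> 2" by (auto simp: g_def indicator_def)
    qed
  qed (use lim in auto)
  then show ?thesis using gL by auto
qed

definition L1_approx :: "'a::metric_space measure \<Rightarrow> ('a \<Rightarrow> real) \<Rightarrow> bool" where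
  "L1_approx \<mu> f \<longleftrightarrow> (\<forall>e>0. \<exists>g\<in>LIPb. (LINT x|\<mu>. \<bar>g x - f x\<bar>) < e)"

lemma L1_approx_lincomb:
  assumes "finite_borel \<mu>" "integrable \<mu> f" "integrable \<mu> g" "L1_approx \<mu> f" "L1_approx \<mu> g"
  shows "L1_approx \<mu> (\<lambda>x. a * f x + b * g x)"
  unfolding L1_approx_def
proof (intro allI impI)
  fix e :: real assume e: "e > 0"
  define d where "d = e / (\<bar>a\<bar> + \<bar>b\<bar> + 1)"
  have d: "d > 0" using e by (simp add: d_def)
  obtain p q where p: "p \<in> LIPb" "(LINT x|\<mu>. \<bar>p x - f x\<bar>) < d"
    and q: "q \<in> LIPb" "(LINT x|\<mu>. \<bar>q x - g x\<bar>) < d"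
    using assms(4,5) d unfolding L1_approx_def by meson
  have [simp]: "integrable \<mu> p" "integrable \<mu> q" using p q assms LIPb_integrable by auto
  note [simp] = assms(2,3)
  have "(LINT x|\<mu>. \<bar>(a * p x + b * q x) - (a * f x + b * g x)\<bar>)
      \<le> (LINT x|\<mu>. \<bar>a\<bar> * \<bar>p x - f x\<bar> + \<bar>b\<bar> * \<bar>q x - g x\<bar>)"
  proof (rule integral_mono)
    show "\<bar>(a * p x + b * q x) - (a * f x + b * g x)\<bar> \<le> \<bar>a\<bar> * \<bar>p x - f x\<bar> + \<bar>b\<bar> * \<bar>q x - g x\<bar>" for x
    proof -
      have "\<bar>(a * p x + b * q x) - (a * f x + b * g x)\<bar> = \<bar>a * (p x - f x) + b * (q x - g x)\<bar>"
        by (simp add: algebra_simps)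
      also have "\<dots> \<le> \<bar>a\<bar> * \<bar>p x - f x\<bar> + \<bar>b\<bar> * \<bar>q x - g x\<bar>" by (metis abs_triangle_ineq abs_mult)
      finally show ?thesis .
    qed
  qed auto
  also have "\<dots> = \<bar>a\<bar> * (LINT x|\<mu>. \<bar>p x - f x\<bar>) + \<bar>b\<bar> * (LINT x|\<mu>. \<bar>q x - g x\<bar>)" by simp
  also have "\<dots> \<le> \<bar>a\<bar> * d + \<bar>b\<bar> * d" using p q by (intro add_mono mult_left_mono) auto
  also have "\<dots> < e" 
  proof -
    have "\<bar>a\<bar> + \<bar>b\<bar> + 1 > 0" by linarith
    then have "(\<bar>a\<bar> + \<bar>b\<bar> + 1) * d = e" by (simp add: d_def)
    then show ?thesis using d by (simp add: algebra_simps)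
  qed
  finally show "\<exists>h\<in>LIPb. (LINT x|\<mu>. \<bar>h x - (a * f x + b * g x)\<bar>) < e"
    using LIPb_lincomb[OF p(1) q(1)] by (intro bexI)
qed

lemma L1_approx_lim:
  assumes "finite_borel \<mu>" "\<And>n. integrable \<mu> (s n)" "integrable \<mu> f"
    "\<And>n. L1_approx \<mu> (s n)" "(\<lambda>n. LINT x|\<mu>. \<bar>s n x - f x\<bar>) \<longlonglongrightarrow> 0"
  shows "L1_approx \<mu> f"
  unfolding L1_approx_def
proof (intro allI impI)
  fix e :: real assume e: "e > 0"
  then have "eventually (\<lambda>n. (LINT x|\<mu>. \<bar>s n x - f x\<bar>) < e/2) sequentially"
    using assms(5) by (intro order_tendstoD) auto
  then obtain n where n: "(LINT x|\<mu>. \<bar>s n x - f x\<bar>) < e/2"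
    by (meson eventually_sequentially order_refl)
  obtain g where g: "g \<in> LIPb" "(LINT x|\<mu>. \<bar>g x - s n x\<bar>) < e/2"
    using assms(4)[of n] e unfolding L1_approx_def by (meson half_gt_zero)
  have [simp]: "integrable \<mu> g" using g assms LIPb_integrable by auto
  note [simp] = assms(2,3)
  have "(LINT x|\<mu>. \<bar>g x - f x\<bar>) \<le> (LINT x|\<mu>. \<bar>g x - s n x\<bar> + \<bar>s n x - f x\<bar>)"
    by (rule integral_mono) auto
  also have "\<dots> = (LINT x|\<mu>. \<bar>g x - s n x\<bar>) + (LINT x|\<mu>. \<bar>s n x - f x\<bar>)" by simp
  finally show "\<exists>h\<in>LIPb. (LINT x|\<mu>. \<bar>h x - f x\<bar>) < e" using g n by (intro bexI[of _ g]) auto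
qed

lemma L1_approx_LIPb: "f \<in> LIPb \<Longrightarrow> L1_approx \<mu> f"
  by (auto simp: L1_approx_def intro!: bexI[of _ f])

text \<open>Closed sets are stable under intersection and generate the Borel sets, and sets with
  approximable indicator are closed under complements and countable disjoint unions, so Dynkin's
  theorem applies.\<close>

lemma L1_approx_indicator:
  fixes \<mu> :: "'a::metric_space measure"
  assumes \<mu>: "finite_borel \<mu>" and "B \<in> sets borel"
  shows "L1_approx \<mu> (indicator B)"
proof -
  interpret finite_measure \<mu> using \<mu> by simp
  have [simp]: "sets \<mu> = sets borel" using \<mu> by simp
  have int [simp]: "integrable \<mu> (indicator B :: 'a \<Rightarrow> real)" if "B \<in> sets borel" for B
    using that by (simp add: emeasure_eq_measure)
  have 1: "sets (borel :: 'a measure) = sigma_sets UNIV (Collect closed)"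
    by (simp add: borel_eq_closed)
  have 2: "Int_stable (Collect closed :: 'a set set)" "Collect closed \<subseteq> Pow (UNIV :: 'a set)"
    by (auto simp: Int_stable_def)
  have "B \<in> sigma_sets UNIV (Collect closed)" using assms 1 by simp
  with 2 show ?thesis
  proof (induction B rule: sigma_sets_induct_disjoint)
    case (basic A)
    then obtain g where g: "\<And>n. g n \<in> LIPb" "(\<lambda>n. LINT x|\<mu>. \<bar>g n x - indicator A x\<bar>) \<longlonglongrightarrow> 0"
      using closed_indicator_approx[OF \<mu>] by blast
    show ?case
      by (rule L1_approx_lim[OF \<mu> _ _ _ g(2)])
        (use basic g L1_approx_LIPb LIPb_integrable[OF _ \<mu>] in auto)
  next
    case empty then show ?case by (rule L1_approx_LIPb) (simp add: LIPb_const)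
  next
    case (compl A)
    then have A: "A \<in> sets borel" using 1 by simp
    have "L1_approx \<mu> (\<lambda>x. 1 * 1 + (-1) * indicator A x)"
      by (rule L1_approx_lincomb[OF \<mu>]) (use A compl in \<open>auto intro: L1_approx_LIPb LIPb_const\<close>)
    moreover have "(indicator (UNIV - A) :: 'a \<Rightarrow> real) = (\<lambda>x. 1 * 1 + (-1) * indicator A x)"
      by (auto simp: indicator_def)
    ultimately show ?case by simp
  next
    case (union A)
    have A: "A i \<in> sets borel" for i using union 1 by auto
    define S where "S n x = (\<Sum>i<n. indicator (A i) x :: real)" for n x
    have S: "S n x = indicator (\<Union>i<n. A i) x" for n x
      unfolding S_def using union(1)
      by (subst indicator_UN_disjoint) (auto simp: disjoint_family_on_def)
    have iS: "integrable \<mu> (S n)" for n unfolding S_def using A by auto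
    have aS: "L1_approx \<mu> (S n)" for n
    proof (induction n)
      case 0 then show ?case by (simp add: S_def L1_approx_LIPb LIPb_const)
    next
      case (Suc n)
      have "L1_approx \<mu> (\<lambda>x. 1 * S n x + 1 * indicator (A n) x)"
        by (rule L1_approx_lincomb[OF \<mu>]) (use A union iS Suc in auto)
      then show ?case by (simp add: S_def)
    qed
    have "(\<lambda>n. LINT x|\<mu>. \<bar>S n x - indicator (\<Union> (range A)) x\<bar>) \<longlonglongrightarrow> (LINT x|\<mu>. 0)"
    proof (rule integral_dominated_convergence[where w = "\<lambda>_. 1"])
      show "(\<lambda>x. \<bar>S n x - indicator (\<Union> (range A)) x\<bar>) \<in> borel_measurable \<mu>" for n
      proof -
        have [measurable]: "S n \<in> borel_measurable \<mu>" "\<Union> (range A) \<in> sets \<mu>"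
          using A borel_measurable_integrable[OF iS] by auto
        show ?thesis by measurable
      qed
      show "AE x in \<mu>. norm \<bar>S n x - indicator (\<Union> (range A)) x\<bar> \<le> 1" for n
        by (auto simp: S indicator_def)
      have "(\<lambda>n. \<bar>S n x - indicator (\<Union> (range A)) x\<bar>) \<longlonglongrightarrow> 0" for x
      proof (cases "x \<in> \<Union> (range A)")
        case True
        then obtain m where "x \<in> A m" by auto
        then have "eventually (\<lambda>n. \<bar>S n x - indicator (\<Union> (range A)) x\<bar> = 0) sequentially"
          unfolding eventually_sequentially S
          by (intro exI[of _ "Suc m"]) (auto simp: indicator_def)
        then show ?thesis by (simp add: tendsto_eventually)
      next
        case False then show ?thesis by (auto simp: S indicator_def)
      qed
      then show "AE x in \<mu>. (\<lambda>n. \<bar>S n x - indicator (\<Union> (range A)) x\<bar>) \<longlonglongrightarrow> 0" by simp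
    qed (use A in auto)
    then show ?case
      using A by (intro L1_approx_lim[OF \<mu> iS _ aS]) auto
  qed
qed

lemma L1_approx_integrable:
  fixes \<mu> :: "'a::metric_space measure"
  assumes \<mu>: "finite_borel \<mu>" and "integrable \<mu> f"
  shows "L1_approx \<mu> f"
  using assms(2)
proof (induction f rule: integrable_induct)
  case (base A c)
  then show ?case
    using L1_approx_lincomb[OF \<mu>, of "indicator A" "indicator A" c 0] L1_approx_indicator[OF \<mu>, of A] \<mu>
    by (simp add: mult.commute)
next
  case (add f g)
  then show ?case using L1_approx_lincomb[OF \<mu>, of f g 1 1] by simp
next
  case (lim f s)
  \<comment> \<open>The factor 3 in the majorant arises because \<open>integrable_induct\<close>
    supplies simple functions of modulus at most twice that of \<open>f\<close>.\<close>
  have "(\<lambda>n. LINT x|\<mu>. \<bar>s n x - f x\<bar>) \<longlonglongrightarrow> (LINT x|\<mu>. 0)"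
  proof (rule integral_dominated_convergence[where w = "\<lambda>x. 3 * \<bar>f x\<bar>"])
    show "AE x in \<mu>. norm \<bar>s i x - f x\<bar> \<le> 3 * \<bar>f x\<bar>" for i
    proof (rule AE_I2)
      fix x assume "x \<in> space \<mu>"
      then have "\<bar>s i x\<bar> \<le> 2 * \<bar>f x\<bar>" using lim(3)[of x i] by simp
      then show "norm \<bar>s i x - f x\<bar> \<le> 3 * \<bar>f x\<bar>" by simp
    qed
    show "AE x in \<mu>. (\<lambda>i. \<bar>s i x - f x\<bar>) \<longlonglongrightarrow> 0"
      using lim(2) by (intro AE_I2 tendsto_rabs_zero) (simp add: LIM_zero)
  qed (use lim in auto)
  then have "(\<lambda>n. LINT x|\<mu>. \<bar>s n x - f x\<bar>) \<longlonglongrightarrow> 0" by simp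
  then show ?case by (rule L1_approx_lim[OF \<mu> lim(1) lim(4) lim(5)])
qed

lemma LIPb_dense_L1:
  assumes "finite_borel \<mu>" "integrable \<mu> f"
  obtains g where "\<And>n. g n \<in> LIPb" "(\<lambda>n. LINT x|\<mu>. \<bar>g n x - f x\<bar>) \<longlonglongrightarrow> 0"
proof -
  have "\<exists>g\<in>LIPb. (LINT x|\<mu>. \<bar>g x - f x\<bar>) < 1 / real (Suc n)" for n
    using L1_approx_integrable[OF assms] unfolding L1_approx_def by simp
  then obtain g where g: "\<And>n. g n \<in> LIPb" "\<And>n. (LINT x|\<mu>. \<bar>g n x - f x\<bar>) < 1 / real (Suc n)"
    by metis
  have "(\<lambda>n. LINT x|\<mu>. \<bar>g n x - f x\<bar>) \<longlonglongrightarrow> 0"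
    by (rule tendsto_sandwich[of "\<lambda>_. 0" _ _ "\<lambda>n. 1 / real (Suc n)"])
      (use g LIMSEQ_Suc[OF lim_1_over_n] in \<open>auto intro!: always_eventually less_imp_le\<close>)
  then show ?thesis using that g by blast
qed


subsection \<open>Series of measures\<close>

text \<open>Serves as a majorant: for a series of currents the sum of the mass measures is an
  admissible bound, although the mass measure of the limit may be smaller.\<close>

definition series_measure :: "(nat \<Rightarrow> 'a::topological_space measure) \<Rightarrow> 'a measure" where
  "series_measure M = measure_of UNIV (sets borel) (\<lambda>B. \<Sum>n. emeasure (M n) B)"

lemma sets_series_measure: "sets (series_measure M) = sets (borel :: 'a::topological_space measure)"
  unfolding series_measure_def using sets.sigma_sets_eq[of "borel :: 'a measure"]
  by (simp add: sets_measure_of_conv)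

lemma suminf_commute_ennreal: "(\<Sum>i. \<Sum>n. f n i) = (\<Sum>n. \<Sum>i. f n i)"
  for f :: "nat \<Rightarrow> nat \<Rightarrow> ennreal"
  using nn_integral_suminf[of f "count_space UNIV"] by (simp add: nn_integral_count_space_nat)

lemma emeasure_series_measure:
  fixes M :: "nat \<Rightarrow> 'a::topological_space measure"
  assumes "\<And>n. sets (M n) = sets borel" "B \<in> sets borel"
  shows "emeasure (series_measure M) B = (\<Sum>n. emeasure (M n) B)"
  unfolding series_measure_def
proof (rule emeasure_measure_of_sigma[OF _ _ _ assms(2)])
  show "sigma_algebra UNIV (sets (borel :: 'a measure))"
    using sets.sigma_algebra_axioms[of "borel :: 'a measure"] by simp
  show "positive (sets borel) (\<lambda>B. \<Sum>n. emeasure (M n) B)" by (simp add: positive_def)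
  show "countably_additive (sets borel) (\<lambda>B. \<Sum>n. emeasure (M n) B)"
  proof (rule countably_additiveI)
    fix A :: "nat \<Rightarrow> 'a set"
    assume A: "range A \<subseteq> sets borel" "disjoint_family A"
    have "(\<Sum>i. emeasure (M n) (A i)) = emeasure (M n) (\<Union> (range A))" for n
      using A assms(1) by (intro suminf_emeasure) auto
    then show "(\<Sum>i. \<Sum>n. emeasure (M n) (A i)) = (\<Sum>n. emeasure (M n) (\<Union> (range A)))"
      by (simp add: suminf_commute_ennreal[of "\<lambda>n i. emeasure (M n) (A i)"])
  qed
qed

lemma nn_integral_series_measure:
  fixes M :: "nat \<Rightarrow> 'a::topological_space measure"
  assumes M: "\<And>n. sets (M n) = sets borel" and "f \<in> borel_measurable borel"
  shows "(\<integral>\<^sup>+x. f x \<partial>series_measure M) = (\<Sum>n. \<integral>\<^sup>+x. f x \<partial>M n)"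
proof -
  have sp: "space (M n) = UNIV" for n using sets_eq_imp_space_eq[OF M] by simp
  have msr: "g \<in> borel_measurable (M n)" "g \<in> borel_measurable (series_measure M)"
    if "g \<in> borel_measurable borel" for g :: "'a \<Rightarrow> ennreal" and n
    using that measurable_cong_sets[OF M refl] measurable_cong_sets[OF sets_series_measure refl] by blast+
  show ?thesis using assms(2)
  proof (induction f rule: borel_measurable_induct)
    case (cong f g) then have "f = g" by auto with cong show ?case by simp
  next
    case (set A) then show ?case using M by (simp add: sets_series_measure emeasure_series_measure)
  next
    case (mult u c) then show ?case by (simp add: nn_integral_cmult msr)
  next
    case (add u v)
    then show ?case by (simp add: nn_integral_add msr suminf_add)
  next
    case (seq U)
    have "integral\<^sup>N N (SUP i. U i) = (SUP i. integral\<^sup>N N (U i))"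
      if "\<And>i. U i \<in> borel_measurable N" for N
      unfolding SUP_apply by (rule nn_integral_monotone_convergence_SUP) (use seq that in auto)
    then have *: "integral\<^sup>N N (Sup (range U)) = (SUP i. integral\<^sup>N N (U i))"
      if "\<And>i. U i \<in> borel_measurable N" for N using that by blast
    have "(\<Sum>n. integral\<^sup>N (M n) (Sup (range U))) = (\<Sum>n. SUP i. integral\<^sup>N (M n) (U i))"
      using *[of "M _"] msr(1)[OF seq(1)] by simp
    also have "\<dots> = (SUP i. \<Sum>n. integral\<^sup>N (M n) (U i))"
      using \<open>incseq U\<close> by (intro ennreal_suminf_SUP_eq) (auto simp: incseq_def le_fun_def intro!: nn_integral_mono)
    also have "\<dots> = integral\<^sup>N (series_measure M) (Sup (range U))"
      using *[of "series_measure M"] msr(2)[OF seq(1)] seq by simp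
    finally show ?case unfolding \<open>f = Sup (range U)\<close> by (rule sym)
  qed
qed

lemma finite_borelI:
  assumes "sets \<mu> = sets borel" "emeasure \<mu> UNIV \<noteq> \<infinity>"
  shows "finite_borel \<mu>"
  using assms finite_borel_space[OF assms(1)] by (auto intro!: finite_measureI)

lemma finite_series_measure:
  fixes M :: "nat \<Rightarrow> 'a::metric_space measure"
  assumes M: "\<And>n. finite_borel (M n)" and s: "summable (\<lambda>n. measure (M n) UNIV)"
  shows "finite_borel (series_measure M)"
    and "measure (series_measure M) UNIV = (\<Sum>n. measure (M n) UNIV)"
proof -
  have "emeasure (M n) UNIV = ennreal (measure (M n) UNIV)" for n
    using M[of n] finite_measure.emeasure_eq_measure by blast
  then have e: "emeasure (series_measure M) UNIV = ennreal (\<Sum>n. measure (M n) UNIV)"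
    using M s by (simp add: emeasure_series_measure suminf_ennreal_eq summable_sums)
  have "space (series_measure M) = UNIV" by (rule finite_borel_space[OF sets_series_measure])
  with e show "finite_borel (series_measure M)"
    by (auto intro!: finite_measureI simp: sets_series_measure)
  show "measure (series_measure M) UNIV = (\<Sum>n. measure (M n) UNIV)"
    using suminf_nonneg[OF s] e unfolding measure_def[of "series_measure M"] by simp
qed

section \<open>Integrals of bounded functions against comparable measures\<close>

lemma LINT_bounded_eq_nn:
  assumes "finite_borel \<mu>" "f \<in> borel_measurable borel" "\<And>x. 0 \<le> f x" "\<And>x. f x \<le> (B::real)"
  shows "ennreal (LINT x|\<mu>. f x) = (\<integral>\<^sup>+x. f x \<partial>\<mu>)"
  using bounded_integrable[OF assms(1,2), of B] assms by (subst nn_integral_eq_integral) auto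

lemma nn_integral_le_of_measure_le:
  fixes \<mu> \<nu> :: "'a measure"
  assumes s: "sets \<mu> = sets \<nu>" and le: "\<And>B. B \<in> sets \<mu> \<Longrightarrow> emeasure \<mu> B \<le> emeasure \<nu> B"
    and "f \<in> borel_measurable \<mu>"
  shows "(\<integral>\<^sup>+x. f x \<partial>\<mu>) \<le> (\<integral>\<^sup>+x. f x \<partial>\<nu>)"
  using assms(3)
proof (induction f rule: borel_measurable_induct)
  case (cong f g)
  then show ?case using sets_eq_imp_space_eq[OF s] nn_integral_cong[of \<mu> f g] nn_integral_cong[of \<nu> f g]
    by auto
next
  case (set A) then show ?case using le s by simp
next
  case (mult u c)
  then have "u \<in> borel_measurable \<nu>" using measurable_cong_sets[OF s refl] by blast
  with mult show ?case by (simp add: nn_integral_cmult mult_left_mono)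
next
  case (add u v)
  then have "u \<in> borel_measurable \<nu>" "v \<in> borel_measurable \<nu>"
    using measurable_cong_sets[OF s refl] by blast+
  with add show ?case by (simp add: nn_integral_add add_mono)
next
  case (seq U)
  have "integral\<^sup>N N (SUP i. U i) = (SUP i. integral\<^sup>N N (U i))"
    if "\<And>i. U i \<in> borel_measurable N" for N
    unfolding SUP_apply by (rule nn_integral_monotone_convergence_SUP) (use seq that in auto)
  moreover have "U i \<in> borel_measurable \<nu>" for i
    using seq(1)[of i] measurable_cong_sets[OF s refl] by blast
  ultimately have "integral\<^sup>N \<mu> (SUP i. U i) \<le> integral\<^sup>N \<nu> (SUP i. U i)"
    using seq by (auto intro!: SUP_mono')
  then show ?case unfolding \<open>f = Sup (range U)\<close> .
qed

lemma LINT_mono_measure: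
  assumes "finite_borel \<mu>" "finite_borel \<nu>" "\<And>B. B \<in> sets borel \<Longrightarrow> emeasure \<mu> B \<le> emeasure \<nu> B"
    "f \<in> borel_measurable borel" "\<And>x. 0 \<le> f x" "\<And>x. f x \<le> (F::real)"
  shows "(LINT x|\<mu>. f x) \<le> (LINT x|\<nu>. f x)"
proof -
  have "ennreal (LINT x|\<mu>. f x) \<le> ennreal (LINT x|\<nu>. f x)"
    unfolding LINT_bounded_eq_nn[OF assms(1,4-6)] LINT_bounded_eq_nn[OF assms(2,4-6)]
    by (rule nn_integral_le_of_measure_le) (use assms measurable_cong_sets in auto)
  moreover have "0 \<le> (LINT x|\<nu>. f x)" using assms by simp
  ultimately show ?thesis by (simp add: ennreal_le_iff)
qed

text \<open>Monotonicity applied to the nonnegative function \<open>F - f\<close>. Thus convergence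
  of the total masses alone controls all integrals of bounded functions, which is how a mass bound
  passes to a decreasing limit of measures.\<close>

lemma LINT_diff_measure:
  assumes "finite_borel \<mu>" "finite_borel \<nu>" "\<And>B. B \<in> sets borel \<Longrightarrow> emeasure \<mu> B \<le> emeasure \<nu> B"
    "f \<in> borel_measurable borel" "\<And>x. 0 \<le> f x" "\<And>x. f x \<le> (F::real)"
  shows "(LINT x|\<nu>. f x) \<le> (LINT x|\<mu>. f x) + F * (measure \<nu> UNIV - measure \<mu> UNIV)"
proof -
  interpret m: finite_measure \<mu> using assms by simp
  interpret n: finite_measure \<nu> using assms by simp
  have "\<bar>f x\<bar> \<le> F" for x using assms by simp
  then have [simp]: "integrable \<mu> f" "integrable \<nu> f"
    using bounded_integrable[OF _ assms(4)] assms(1,2) by blast+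
  have "(LINT x|\<mu>. F - f x) \<le> (LINT x|\<nu>. F - f x)"
    by (rule LINT_mono_measure[where F = F]) (use assms in auto)
  then show ?thesis using finite_borel_space[of \<mu>] finite_borel_space[of \<nu>] assms(1,2)
    by (simp add: algebra_simps)
qed


subsection \<open>Extension and mass measure\<close>

lemma currents_multilinear: "T \<in> currents k \<Longrightarrow> multilinear_on LIPb k T"
  by (simp add: currents_def)

lemma currents_lincomb:
  "T \<in> currents k \<Longrightarrow> f \<in> LIPb \<Longrightarrow> g \<in> LIPb \<Longrightarrow> \<pi> \<in> LIPs k \<Longrightarrow>
    T (\<lambda>x. a * f x + b * g x) \<pi> = a * T f \<pi> + b * T g \<pi>"
  using currents_multilinear unfolding multilinear_on_def by blast

lemma currents_lincomb_slot:
  "T \<in> currents k \<Longrightarrow> f \<in> LIPb \<Longrightarrow> \<pi> \<in> LIPs k \<Longrightarrow> i < k \<Longrightarrow> p \<in> LIP \<Longrightarrow> q \<in> LIP \<Longrightarrow>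
    T f (\<pi>[i := (\<lambda>x. a * p x + b * q x)]) = a * T f (\<pi>[i := p]) + b * T f (\<pi>[i := q])"
  using currents_multilinear unfolding multilinear_on_def by blast

lemma currents_add:
  "T \<in> currents k \<Longrightarrow> f \<in> LIPb \<Longrightarrow> g \<in> LIPb \<Longrightarrow> \<pi> \<in> LIPs k \<Longrightarrow>
    T (\<lambda>x. f x + g x) \<pi> = T f \<pi> + T g \<pi>"
  using currents_lincomb[of T k f g \<pi> 1 1] by simp

lemma currents_diff:
  "T \<in> currents k \<Longrightarrow> f \<in> LIPb \<Longrightarrow> g \<in> LIPb \<Longrightarrow> \<pi> \<in> LIPs k \<Longrightarrow>
    T (\<lambda>x. f x - g x) \<pi> = T f \<pi> - T g \<pi>"
  using currents_lincomb[of T k f g \<pi> 1 "-1"] by simp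

lemma currents_cmult:
  "T \<in> currents k \<Longrightarrow> f \<in> LIPb \<Longrightarrow> \<pi> \<in> LIPs k \<Longrightarrow> T (\<lambda>x. c * f x) \<pi> = c * T f \<pi>"
  using currents_lincomb[of T k f f \<pi> c 0] by simp

lemma currents_outside: "T \<in> currents k \<Longrightarrow> (f, \<pi>) \<notin> Dk k \<Longrightarrow> T f \<pi> = 0"
  by (simp add: currents_def)

lemma mass_boundD:
  "mass_bound k T \<mu> \<Longrightarrow> f \<in> LIPb \<Longrightarrow> \<pi> \<in> LIPs k \<Longrightarrow>
    \<bar>T f \<pi>\<bar> \<le> (\<Prod>p\<leftarrow>\<pi>. Lip p) * (LINT x|\<mu>. \<bar>f x\<bar>)"
  unfolding mass_bound_def Dk_def by auto

lemma mass_bound_finite_borel: "mass_bound k T \<mu> \<Longrightarrow> finite_borel \<mu>"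
  by (simp add: mass_bound_def)

definition L1_lim :: "'a::metric_space measure \<Rightarrow> (nat \<Rightarrow> 'a \<Rightarrow> real) \<Rightarrow> ('a \<Rightarrow> real) \<Rightarrow> bool" where
  "L1_lim \<mu> g f \<longleftrightarrow> (\<forall>n. g n \<in> LIPb) \<and> (\<lambda>n. LINT x|\<mu>. \<bar>g n x - f x\<bar>) \<longlonglongrightarrow> 0"

lemma L1_lim_exists: "finite_borel \<mu> \<Longrightarrow> integrable \<mu> f \<Longrightarrow> \<exists>g. L1_lim \<mu> g f"
  unfolding L1_lim_def by (rule LIPb_dense_L1[of \<mu> f]) auto

lemma L1_lim_const: "f \<in> LIPb \<Longrightarrow> L1_lim \<mu> (\<lambda>_. f) f"
  by (simp add: L1_lim_def)

lemma L1_lim_lincomb: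
  assumes "finite_borel \<mu>" "integrable \<mu> f" "integrable \<mu> h" "L1_lim \<mu> u f" "L1_lim \<mu> v h"
  shows "L1_lim \<mu> (\<lambda>n x. a * u n x + b * v n x) (\<lambda>x. a * f x + b * h x)"
  unfolding L1_lim_def
proof
  have uv: "u n \<in> LIPb" "v n \<in> LIPb" for n using assms by (auto simp: L1_lim_def)
  then show "\<forall>n. (\<lambda>x. a * u n x + b * v n x) \<in> LIPb" by (simp add: LIPb_lincomb)
  have [simp]: "integrable \<mu> (u n)" "integrable \<mu> (v n)" for n
    using uv LIPb_integrable[OF _ assms(1)] by auto
  note [simp] = assms(2,3)
  have le: "(LINT x|\<mu>. \<bar>(a * u n x + b * v n x) - (a * f x + b * h x)\<bar>)
      \<le> \<bar>a\<bar> * (LINT x|\<mu>. \<bar>u n x - f x\<bar>) + \<bar>b\<bar> * (LINT x|\<mu>. \<bar>v n x - h x\<bar>)" for n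
  proof -
    have "(LINT x|\<mu>. \<bar>(a * u n x + b * v n x) - (a * f x + b * h x)\<bar>)
      \<le> (LINT x|\<mu>. \<bar>a\<bar> * \<bar>u n x - f x\<bar> + \<bar>b\<bar> * \<bar>v n x - h x\<bar>)"
    proof (rule integral_mono)
      fix x
      have "\<bar>(a * u n x + b * v n x) - (a * f x + b * h x)\<bar> = \<bar>a * (u n x - f x) + b * (v n x - h x)\<bar>"
        by (simp add: algebra_simps)
      also have "\<dots> \<le> \<bar>a\<bar> * \<bar>u n x - f x\<bar> + \<bar>b\<bar> * \<bar>v n x - h x\<bar>" by (metis abs_triangle_ineq abs_mult)
      finally show "\<bar>(a * u n x + b * v n x) - (a * f x + b * h x)\<bar>
        \<le> \<bar>a\<bar> * \<bar>u n x - f x\<bar> + \<bar>b\<bar> * \<bar>v n x - h x\<bar>" .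
    qed auto
    then show ?thesis by simp
  qed
  have "(\<lambda>n. \<bar>a\<bar> * (LINT x|\<mu>. \<bar>u n x - f x\<bar>) + \<bar>b\<bar> * (LINT x|\<mu>. \<bar>v n x - h x\<bar>))
      \<longlonglongrightarrow> \<bar>a\<bar> * 0 + \<bar>b\<bar> * 0"
    using assms unfolding L1_lim_def by (intro tendsto_intros) auto
  then have "(\<lambda>n. \<bar>a\<bar> * (LINT x|\<mu>. \<bar>u n x - f x\<bar>) + \<bar>b\<bar> * (LINT x|\<mu>. \<bar>v n x - h x\<bar>)) \<longlonglongrightarrow> 0"
    by simp
  then show "(\<lambda>n. LINT x|\<mu>. \<bar>(a * u n x + b * v n x) - (a * f x + b * h x)\<bar>) \<longlonglongrightarrow> 0"
    by (rule tendsto_sandwich[OF _ _ tendsto_const, rotated 2]) (auto intro!: always_eventually le)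
qed

text \<open>Allows one approximating sequence, chosen for a dominating measure such as a sum or a
  series, to be used for all the smaller measures at once.\<close>

lemma L1_lim_mono_measure:
  assumes "finite_borel \<mu>" "finite_borel \<nu>" "\<And>B. B \<in> sets borel \<Longrightarrow> emeasure \<mu> B \<le> emeasure \<nu> B"
    "f \<in> borel_measurable borel" "\<And>x. \<bar>f x\<bar> \<le> F" "L1_lim \<nu> g f"
  shows "L1_lim \<mu> g f"
  unfolding L1_lim_def
proof
  have g: "g n \<in> LIPb" for n using assms(6) by (simp add: L1_lim_def)
  then show "\<forall>n. g n \<in> LIPb" by simp
  have "(LINT x|\<mu>. \<bar>g n x - f x\<bar>) \<le> (LINT x|\<nu>. \<bar>g n x - f x\<bar>)" for n
  proof -
    obtain G where G: "\<And>x. \<bar>g n x\<bar> \<le> G" using LIPb_bound[OF g] by metis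
    have "g n \<in> borel_measurable borel" using LIP_measurable[OF LIPb_LIP[OF g]] by simp
    then have "(\<lambda>x. \<bar>g n x - f x\<bar>) \<in> borel_measurable borel" using assms(4) by simp
    moreover have "\<bar>g n x - f x\<bar> \<le> G + F" for x using G[of x] assms(5)[of x] by linarith
    ultimately show ?thesis by (intro LINT_mono_measure[where F = "G + F"] assms(1-3)) auto
  qed
  note le = this
  have "(\<lambda>n. LINT x|\<nu>. \<bar>g n x - f x\<bar>) \<longlonglongrightarrow> 0" using assms(6) by (simp add: L1_lim_def)
  then show "(\<lambda>n. LINT x|\<mu>. \<bar>g n x - f x\<bar>) \<longlonglongrightarrow> 0"
    by (rule tendsto_sandwich[OF _ _ tendsto_const, rotated 2]) (auto intro!: always_eventually le)
qed

text \<open>Two approximating sequences of the same function have the same limit, so the limit below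
  does not depend on the choice.\<close>

definition L1_extension :: "'a::metric_space measure \<Rightarrow> 'a functional \<Rightarrow> 'a functional" where
  "L1_extension \<mu> T f \<pi> = lim (\<lambda>n. T ((SOME g. L1_lim \<mu> g f) n) \<pi>)"

section \<open>Extending a current from bounded Lipschitz to integrable functions\<close>

context
  fixes k :: nat and T :: "'a::metric_space functional" and \<mu> :: "'a measure"
  assumes T: "T \<in> currents k" and \<mu>: "mass_bound k T \<mu>"
begin

lemma mass_bound_diff:
  assumes "f \<in> LIPb" "g \<in> LIPb" "integrable \<mu> h" "\<pi> \<in> LIPs k"
  shows "\<bar>T f \<pi> - T g \<pi>\<bar> \<le> (\<Prod>p\<leftarrow>\<pi>. Lip p) * ((LINT x|\<mu>. \<bar>f x - h x\<bar>) + (LINT x|\<mu>. \<bar>g x - h x\<bar>))"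
proof -
  have [simp]: "integrable \<mu> f" "integrable \<mu> g" using assms LIPb_integrable[OF _ mass_bound_finite_borel[OF \<mu>]] by auto
  note [simp] = assms(3)
  have "\<bar>T f \<pi> - T g \<pi>\<bar> = \<bar>T (\<lambda>x. f x - g x) \<pi>\<bar>" using currents_diff[OF T] assms by simp
  also have "\<dots> \<le> (\<Prod>p\<leftarrow>\<pi>. Lip p) * (LINT x|\<mu>. \<bar>f x - g x\<bar>)"
    by (rule mass_boundD[OF \<mu>]) (use assms LIPb_diff in auto)
  also have "(LINT x|\<mu>. \<bar>f x - g x\<bar>) \<le> (LINT x|\<mu>. \<bar>f x - h x\<bar> + \<bar>g x - h x\<bar>)"
    by (rule integral_mono) auto
  finally show ?thesis using prod_Lip_nonneg[OF assms(4)] by (simp add: mult_left_mono)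
qed

text \<open>The values along the chosen sequence are Cauchy by \<open>mass_bound_diff\<close>; along
  any other approximating sequence they differ from these by a null sequence, for the same
  reason.\<close>

lemma L1_extension_tendsto:
  assumes f: "integrable \<mu> f" and \<pi>: "\<pi> \<in> LIPs k" and g: "L1_lim \<mu> g f"
  shows "(\<lambda>n. T (g n) \<pi>) \<longlonglongrightarrow> L1_extension \<mu> T f \<pi>"
proof -
  let ?P = "\<Prod>p\<leftarrow>\<pi>. Lip p"
  have P: "0 \<le> ?P" by (rule prod_Lip_nonneg[OF \<pi>])
  define h where "h = (SOME g. L1_lim \<mu> g f)"
  have h: "L1_lim \<mu> h f" unfolding h_def by (rule someI_ex[OF L1_lim_exists[OF mass_bound_finite_borel[OF \<mu>] f]])
  have Cau: "Cauchy (\<lambda>n. T (h n) \<pi>)"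
  proof (rule metric_CauchyI)
    fix e :: real assume e: "e > 0"
    \<comment> \<open>The product \<open>?P\<close> of Lipschitz constants may be 0, hence the added
      1; the half leaves room for the errors of two members of the sequence.\<close>
    define d where "d = e / (?P + 1) / 2"
    have d: "d > 0" using e P by (auto simp: d_def)
    have "d + d = e / (?P + 1)" unfolding d_def by (rule field_sum_of_halves)
    then have "(?P + 1) * (d + d) = e" using P by simp
    with d have d2: "?P * (d + d) < e" by (simp add: algebra_simps)
    have "eventually (\<lambda>n. (LINT x|\<mu>. \<bar>h n x - f x\<bar>) < d) sequentially"
      using h d unfolding L1_lim_def by (intro order_tendstoD) auto
    then obtain N where N: "\<And>n. n \<ge> N \<Longrightarrow> (LINT x|\<mu>. \<bar>h n x - f x\<bar>) < d"
      by (auto simp: eventually_sequentially)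
    have "dist (T (h m) \<pi>) (T (h n) \<pi>) < e" if "m \<ge> N" "n \<ge> N" for m n
    proof -
      have "\<bar>T (h m) \<pi> - T (h n) \<pi>\<bar> \<le> ?P * ((LINT x|\<mu>. \<bar>h m x - f x\<bar>) + (LINT x|\<mu>. \<bar>h n x - f x\<bar>))"
        by (rule mass_bound_diff) (use h f \<pi> in \<open>auto simp: L1_lim_def\<close>)
      also have "\<dots> \<le> ?P * (d + d)" using N[OF that(1)] N[OF that(2)] P by (intro mult_left_mono) auto
      finally show ?thesis using d2 by (simp add: dist_real_def)
    qed
    then show "\<exists>M. \<forall>m\<ge>M. \<forall>n\<ge>M. dist (T (h m) \<pi>) (T (h n) \<pi>) < e" by blast
  qed
  then have lim: "(\<lambda>n. T (h n) \<pi>) \<longlonglongrightarrow> L1_extension \<mu> T f \<pi>"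
    unfolding L1_extension_def h_def[symmetric] by (simp add: Cauchy_convergent convergent_LIMSEQ_iff[symmetric])
  have "(\<lambda>n. ?P * ((LINT x|\<mu>. \<bar>g n x - f x\<bar>) + (LINT x|\<mu>. \<bar>h n x - f x\<bar>))) \<longlonglongrightarrow> ?P * (0 + 0)"
    using g h unfolding L1_lim_def by (intro tendsto_intros) auto
  then have z: "(\<lambda>n. ?P * ((LINT x|\<mu>. \<bar>g n x - f x\<bar>) + (LINT x|\<mu>. \<bar>h n x - f x\<bar>))) \<longlonglongrightarrow> 0" by simp
  have "(\<lambda>n. T (g n) \<pi> - T (h n) \<pi>) \<longlonglongrightarrow> 0"
    by (rule Lim_null_comparison[OF _ z], rule always_eventually, unfold real_norm_def, intro allI mass_bound_diff)
      (use g h f \<pi> in \<open>auto simp: L1_lim_def\<close>)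
  from tendsto_add[OF this lim] show ?thesis by simp
qed

lemma L1_extension_eqI: "integrable \<mu> f \<Longrightarrow> \<pi> \<in> LIPs k \<Longrightarrow> L1_lim \<mu> g f \<Longrightarrow> (\<lambda>n. T (g n) \<pi>) \<longlonglongrightarrow> l \<Longrightarrow> L1_extension \<mu> T f \<pi> = l"
  using L1_extension_tendsto LIMSEQ_unique by blast

lemma L1_extension_LIPb: "f \<in> LIPb \<Longrightarrow> \<pi> \<in> LIPs k \<Longrightarrow> L1_extension \<mu> T f \<pi> = T f \<pi>"
  by (rule L1_extension_eqI[OF LIPb_integrable[OF _ mass_bound_finite_borel[OF \<mu>]] _ L1_lim_const]) auto

lemma L1_extension_lincomb:
  assumes "integrable \<mu> f" "integrable \<mu> g" "\<pi> \<in> LIPs k"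
  shows "L1_extension \<mu> T (\<lambda>x. a * f x + b * g x) \<pi> = a * L1_extension \<mu> T f \<pi> + b * L1_extension \<mu> T g \<pi>"
proof -
  obtain u v where u: "L1_lim \<mu> u f" and v: "L1_lim \<mu> v g" using L1_lim_exists[OF mass_bound_finite_borel[OF \<mu>]] assms by blast
  have "(\<lambda>n. a * T (u n) \<pi> + b * T (v n) \<pi>) \<longlonglongrightarrow> a * L1_extension \<mu> T f \<pi> + b * L1_extension \<mu> T g \<pi>"
    by (intro tendsto_intros L1_extension_tendsto u v assms)
  moreover have "T (\<lambda>x. a * u n x + b * v n x) \<pi> = a * T (u n) \<pi> + b * T (v n) \<pi>" for n
    using u v assms currents_lincomb[OF T] by (auto simp: L1_lim_def)
  ultimately show ?thesis
    using assms by (intro L1_extension_eqI[OF _ _ L1_lim_lincomb[OF mass_bound_finite_borel[OF \<mu>] _ _ u v]]) auto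
qed

lemma L1_extension_bound:
  assumes "integrable \<mu> f" "\<pi> \<in> LIPs k"
  shows "\<bar>L1_extension \<mu> T f \<pi>\<bar> \<le> (\<Prod>p\<leftarrow>\<pi>. Lip p) * (LINT x|\<mu>. \<bar>f x\<bar>)"
proof -
  let ?P = "\<Prod>p\<leftarrow>\<pi>. Lip p"
  obtain u where u: "L1_lim \<mu> u f" using L1_lim_exists[OF mass_bound_finite_borel[OF \<mu>]] assms by blast
  have [simp]: "u n \<in> LIPb" "integrable \<mu> (u n)" for n
    using u LIPb_integrable[OF _ mass_bound_finite_borel[OF \<mu>]] by (auto simp: L1_lim_def)
  note [simp] = assms(1)
  have "\<bar>T (u n) \<pi>\<bar> \<le> ?P * ((LINT x|\<mu>. \<bar>u n x - f x\<bar>) + (LINT x|\<mu>. \<bar>f x\<bar>))" for n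
  proof -
    have "\<bar>T (u n) \<pi>\<bar> \<le> ?P * (LINT x|\<mu>. \<bar>u n x\<bar>)" by (rule mass_boundD[OF \<mu> _ assms(2)]) simp
    also have "(LINT x|\<mu>. \<bar>u n x\<bar>) \<le> (LINT x|\<mu>. \<bar>u n x - f x\<bar> + \<bar>f x\<bar>)" by (rule integral_mono) auto
    finally show ?thesis using prod_Lip_nonneg[OF assms(2)] by (simp add: mult_left_mono)
  qed
  moreover have "(\<lambda>n. \<bar>T (u n) \<pi>\<bar>) \<longlonglongrightarrow> \<bar>L1_extension \<mu> T f \<pi>\<bar>"
    by (intro tendsto_intros L1_extension_tendsto u assms)
  moreover have "(\<lambda>n. ?P * ((LINT x|\<mu>. \<bar>u n x - f x\<bar>) + (LINT x|\<mu>. \<bar>f x\<bar>)))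
      \<longlonglongrightarrow> ?P * (0 + (LINT x|\<mu>. \<bar>f x\<bar>))"
    using u unfolding L1_lim_def by (intro tendsto_intros) auto
  ultimately show ?thesis by (intro LIMSEQ_le) auto
qed

lemma L1_extension_lincomb_slot:
  assumes f: "integrable \<mu> f" "\<pi> \<in> LIPs k" "i < k" "p \<in> LIP" "q \<in> LIP"
  shows "L1_extension \<mu> T f (\<pi>[i := (\<lambda>x. a * p x + b * q x)]) = a * L1_extension \<mu> T f (\<pi>[i := p]) + b * L1_extension \<mu> T f (\<pi>[i := q])"
proof -
  obtain u where u: "L1_lim \<mu> u f" using L1_lim_exists[OF mass_bound_finite_borel[OF \<mu>]] assms by blast
  have "(\<lambda>n. a * T (u n) (\<pi>[i := p]) + b * T (u n) (\<pi>[i := q])) \<longlonglongrightarrow>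
     a * L1_extension \<mu> T f (\<pi>[i := p]) + b * L1_extension \<mu> T f (\<pi>[i := q])"
    by (intro tendsto_intros L1_extension_tendsto u LIPs_update f)
  moreover have "T (u n) (\<pi>[i := (\<lambda>x. a * p x + b * q x)])
      = a * T (u n) (\<pi>[i := p]) + b * T (u n) (\<pi>[i := q])" for n
    using u f currents_lincomb_slot[OF T] by (auto simp: L1_lim_def)
  ultimately show ?thesis
    by (intro L1_extension_eqI[OF f(1) _ u] LIPs_update LIP_lincomb f) auto
qed

end

section \<open>Existence of a least mass measure\<close>

definition add_measure :: "'a::topological_space measure \<Rightarrow> 'a measure \<Rightarrow> 'a measure" where
  "add_measure \<mu> \<nu> = series_measure (\<lambda>n. if n = 0 then \<mu> else if n = 1 then \<nu> else null_measure borel)"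

lemma suminf_two: "(\<Sum>n. if n = 0 then a else if n = Suc 0 then b else 0) = a + (b::ennreal)"
  by (subst suminf_finite[of "{0, 1}"]) auto

text \<open>Encoding the sum as a series with two nonzero terms lets additivity and the formula for
  integrals be inherited from \<open>series_measure\<close>.\<close>

lemma add_measure:
  fixes \<mu> \<nu> :: "'a::metric_space measure"
  assumes "finite_borel \<mu>" "finite_borel \<nu>"
  shows "finite_borel (add_measure \<mu> \<nu>)"
    and "B \<in> sets borel \<Longrightarrow> emeasure (add_measure \<mu> \<nu>) B = emeasure \<mu> B + emeasure \<nu> B"
    and "f \<in> borel_measurable borel \<Longrightarrow>
      (\<integral>\<^sup>+x. f x \<partial>add_measure \<mu> \<nu>) = (\<integral>\<^sup>+x. f x \<partial>\<mu>) + (\<integral>\<^sup>+x. f x \<partial>\<nu>)"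
proof -
  let ?M = "\<lambda>n::nat. if n = 0 then \<mu> else if n = 1 then \<nu> else null_measure borel"
  have s: "sets (?M n) = sets borel" for n using assms by auto
  have *: "emeasure (add_measure \<mu> \<nu>) B = emeasure \<mu> B + emeasure \<nu> B" if "B \<in> sets borel" for B
  proof -
    have "emeasure (?M n) B = (if n = 0 then emeasure \<mu> B else if n = Suc 0 then emeasure \<nu> B else 0)" for n
      by auto
    then show ?thesis using that s unfolding add_measure_def
      by (subst emeasure_series_measure) (auto simp: suminf_two)
  qed
  show "B \<in> sets borel \<Longrightarrow> emeasure (add_measure \<mu> \<nu>) B = emeasure \<mu> B + emeasure \<nu> B" by (rule *)
  have "emeasure (add_measure \<mu> \<nu>) UNIV \<noteq> \<infinity>"
    using assms finite_measure.emeasure_finite by (subst *) (auto simp: top_unique)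
  then show "finite_borel (add_measure \<mu> \<nu>)"
    by (rule finite_borelI[rotated]) (simp add: add_measure_def sets_series_measure)
  show "f \<in> borel_measurable borel \<Longrightarrow>
      (\<integral>\<^sup>+x. f x \<partial>add_measure \<mu> \<nu>) = (\<integral>\<^sup>+x. f x \<partial>\<mu>) + (\<integral>\<^sup>+x. f x \<partial>\<nu>)"
  proof -
    assume f: "f \<in> borel_measurable borel"
    have "(\<integral>\<^sup>+x. f x \<partial>?M n) = (if n = 0 then (\<integral>\<^sup>+x. f x \<partial>\<mu>) else if n = Suc 0 then (\<integral>\<^sup>+x. f x \<partial>\<nu>) else 0)" for n
      by auto
    then show ?thesis using f s unfolding add_measure_def
      by (subst nn_integral_series_measure) (auto simp: suminf_two)
  qed
qed

text \<open>Cut \<open>f\<close> along \<open>Y\<close> and estimate the part on \<open>Y\<close> by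
  \<open>\<mu>\<close> and the rest by \<open>\<nu>\<close>. The cut functions are no longer
  Lipschitz, so \<open>T\<close> acts on them through its extensions; those built from
  \<open>\<mu>\<close> and from \<open>\<nu>\<close> agree, since a single sequence approximating in
  \<open>\<mu> + \<nu>\<close> computes both.\<close>

lemma mass_bound_glue:
  fixes T :: "'a::metric_space functional"
  assumes T: "T \<in> currents k" and \<mu>: "mass_bound k T \<mu>" and \<nu>: "mass_bound k T \<nu>" and Y: "Y \<in> sets borel"
  obtains \<kappa> where "mass_bound k T \<kappa>"
    "\<And>B. B \<in> sets borel \<Longrightarrow> emeasure \<kappa> B = emeasure \<mu> (B \<inter> Y) + emeasure \<nu> (B - Y)"
proof -
  have fm: "finite_borel \<mu>" and fn: "finite_borel \<nu>" using \<mu> \<nu> mass_bound_finite_borel by auto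
  define \<mu>' where "\<mu>' = density \<mu> (indicator Y)"
  define \<nu>' where "\<nu>' = density \<nu> (indicator (- Y))"
  have Ym: "Y \<in> sets \<mu>" "- Y \<in> sets \<nu>" using Y fm fn by auto
  have e\<mu>: "emeasure \<mu>' B = emeasure \<mu> (B \<inter> Y)" if "B \<in> sets borel" for B
    using that Ym fm unfolding \<mu>'_def
    by (subst emeasure_density) (auto simp: indicator_inter_arith[symmetric] Int_commute)
  have e\<nu>: "emeasure \<nu>' B = emeasure \<nu> (B - Y)" if "B \<in> sets borel" for B
    using that Ym fn unfolding \<nu>'_def
    by (subst emeasure_density) (auto simp: indicator_inter_arith[symmetric] Int_commute Diff_eq)
  have fm': "finite_borel \<mu>'" "finite_borel \<nu>'"
    using fm fn e\<mu>[of UNIV] e\<nu>[of UNIV] finite_measure.emeasure_finite[of \<mu>] finite_measure.emeasure_finite[of \<nu>]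
    by (intro finite_borelI; simp add: \<mu>'_def \<nu>'_def)+
  define \<kappa> where "\<kappa> = add_measure \<mu>' \<nu>'"
  define \<rho> where "\<rho> = add_measure \<mu> \<nu>"
  have fl: "finite_borel \<rho>" and fk: "finite_borel \<kappa>" unfolding \<rho>_def \<kappa>_def using add_measure fm fn fm' by auto
  have ke: "emeasure \<kappa> B = emeasure \<mu> (B \<inter> Y) + emeasure \<nu> (B - Y)" if "B \<in> sets borel" for B
    using add_measure(2)[OF fm' that] e\<mu> e\<nu> that by (simp add: \<kappa>_def)
  have "\<bar>T f \<pi>\<bar> \<le> (\<Prod>p\<leftarrow>\<pi>. Lip p) * (LINT x|\<kappa>. \<bar>f x\<bar>)" if f: "f \<in> LIPb" and \<pi>: "\<pi> \<in> LIPs k" for f \<pi>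
  proof -
    let ?P = "\<Prod>p\<leftarrow>\<pi>. Lip p"
    obtain F where F: "0 < F" "\<And>x. \<bar>f x\<bar> \<le> F" using LIPb_bound[OF f] by blast
    have fB: "f \<in> borel_measurable borel" using LIP_measurable[OF LIPb_LIP[OF f]] by simp
    define a where "a x = indicator Y x * f x" for x
    define b where "b x = indicator (- Y) x * f x" for x
    have aB: "a \<in> borel_measurable borel" "b \<in> borel_measurable borel"
      using fB Y unfolding a_def b_def by auto
    have aF: "\<bar>a x\<bar> \<le> F" "\<bar>b x\<bar> \<le> F" for x using F by (auto simp: a_def b_def indicator_def less_imp_le)
    have "integrable \<rho> a" using bounded_integrable[OF fl aB(1) aF(1)] .
    then obtain g where g: "L1_lim \<rho> g a" using L1_lim_exists[OF fl] by blast
    have ia: "integrable \<mu> a" and ib: "integrable \<nu> b" and ia': "integrable \<nu> a" and if': "integrable \<nu> f"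
      using bounded_integrable[OF fm aB(1) aF(1)] bounded_integrable[OF fn aB(2) aF(2)]
        bounded_integrable[OF fn aB(1) aF(1)] bounded_integrable[OF fn fB F(2)] by auto
    have g\<mu>: "L1_lim \<mu> g a"
      by (rule L1_lim_mono_measure[OF fm fl _ aB(1) aF(1) g]) (simp add: \<rho>_def add_measure[OF fm fn])
    have g\<nu>: "L1_lim \<nu> g a"
      by (rule L1_lim_mono_measure[OF fn fl _ aB(1) aF(1) g]) (simp add: \<rho>_def add_measure[OF fm fn])
    have "(\<lambda>n. T (g n) \<pi>) \<longlonglongrightarrow> L1_extension \<mu> T a \<pi>" by (rule L1_extension_tendsto[OF T \<mu> ia \<pi> g\<mu>])
    moreover have "(\<lambda>n. T (g n) \<pi>) \<longlonglongrightarrow> L1_extension \<nu> T a \<pi>" by (rule L1_extension_tendsto[OF T \<nu> ia' \<pi> g\<nu>])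
    ultimately have eq: "L1_extension \<nu> T a \<pi> = L1_extension \<mu> T a \<pi>" using LIMSEQ_unique by blast
    have "f = (\<lambda>x. 1 * a x + 1 * b x)" by (auto simp: a_def b_def indicator_def)
    then have "T f \<pi> = L1_extension \<nu> T (\<lambda>x. 1 * a x + 1 * b x) \<pi>" using L1_extension_LIPb[OF T \<nu> f \<pi>] by simp
    also have "\<dots> = L1_extension \<mu> T a \<pi> + L1_extension \<nu> T b \<pi>" using L1_extension_lincomb[OF T \<nu> ia' ib \<pi>, of 1 1] eq by simp
    finally have "\<bar>T f \<pi>\<bar> \<le> ?P * ((LINT x|\<mu>. \<bar>a x\<bar>) + (LINT x|\<nu>. \<bar>b x\<bar>))"
      using L1_extension_bound[OF T \<mu> ia \<pi>] L1_extension_bound[OF T \<nu> ib \<pi>] by (simp add: distrib_left)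
    moreover have "(LINT x|\<mu>. \<bar>a x\<bar>) + (LINT x|\<nu>. \<bar>b x\<bar>) = (LINT x|\<kappa>. \<bar>f x\<bar>)"
    proof -
      have "ennreal ((LINT x|\<mu>. \<bar>a x\<bar>) + (LINT x|\<nu>. \<bar>b x\<bar>)) = (\<integral>\<^sup>+x. \<bar>a x\<bar> \<partial>\<mu>) + (\<integral>\<^sup>+x. \<bar>b x\<bar> \<partial>\<nu>)"
        using LINT_bounded_eq_nn[OF fm, of "\<lambda>x. \<bar>a x\<bar>" F] LINT_bounded_eq_nn[OF fn, of "\<lambda>x. \<bar>b x\<bar>" F] aB aF
        by (subst ennreal_plus) auto
      also have "(\<integral>\<^sup>+x. \<bar>a x\<bar> \<partial>\<mu>) = (\<integral>\<^sup>+x. \<bar>f x\<bar> \<partial>\<mu>')"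
        unfolding \<mu>'_def using fB fm Ym measurable_cong_sets[of \<mu> borel borel borel]
        by (subst nn_integral_density) (auto simp: a_def intro!: nn_integral_cong split: split_indicator)
      also have "(\<integral>\<^sup>+x. \<bar>b x\<bar> \<partial>\<nu>) = (\<integral>\<^sup>+x. \<bar>f x\<bar> \<partial>\<nu>')"
        unfolding \<nu>'_def using fB fn Ym measurable_cong_sets[of \<nu> borel borel borel]
        by (subst nn_integral_density) (auto simp: b_def intro!: nn_integral_cong split: split_indicator)
      also have "(\<integral>\<^sup>+x. \<bar>f x\<bar> \<partial>\<mu>') + (\<integral>\<^sup>+x. \<bar>f x\<bar> \<partial>\<nu>') = (\<integral>\<^sup>+x. \<bar>f x\<bar> \<partial>\<kappa>)"
        unfolding \<kappa>_def by (rule add_measure(3)[OF fm', symmetric]) (use fB in simp)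
      also have "\<dots> = ennreal (LINT x|\<kappa>. \<bar>f x\<bar>)"
        by (rule LINT_bounded_eq_nn[OF fk, of _ F, symmetric]) (use fB F in auto)
      finally show ?thesis by (simp add: ennreal_inj del: ennreal_plus)
    qed
    ultimately show ?thesis by simp
  qed
  then have "mass_bound k T \<kappa>" using fk by (auto simp: mass_bound_def Dk_def)
  then show ?thesis using that ke by blast
qed

text \<open>Glue along a Hahn set: \<open>\<mu>\<close> is the smaller measure inside
  \<open>Y\<close> and \<open>\<nu>\<close> outside, so the glued measure is the lattice infimum.
  Admissible measures are therefore directed downwards.\<close>

lemma mass_bound_inf:
  assumes T: "T \<in> currents k" and \<mu>: "mass_bound k T \<mu>" and \<nu>: "mass_bound k T \<nu>"
  obtains \<kappa> where "mass_bound k T \<kappa>"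
    "\<And>B. B \<in> sets borel \<Longrightarrow> emeasure \<kappa> B \<le> emeasure \<mu> B"
    "\<And>B. B \<in> sets borel \<Longrightarrow> emeasure \<kappa> B \<le> emeasure \<nu> B"
proof -
  have fm: "finite_borel \<mu>" and fn: "finite_borel \<nu>" using \<mu> \<nu> mass_bound_finite_borel by auto
  obtain Y where Y: "Y \<in> sets borel" "\<And>X. X \<in> sets borel \<Longrightarrow> X \<subseteq> Y \<Longrightarrow> emeasure \<mu> X \<le> emeasure \<nu> X"
    "\<And>X. X \<in> sets borel \<Longrightarrow> X \<inter> Y = {} \<Longrightarrow> emeasure \<nu> X \<le> emeasure \<mu> X"
    using finite_unsigned_Hahn_decomposition[of \<nu> \<mu>] fm fn by auto
  obtain \<kappa> where k: "mass_bound k T \<kappa>"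
    "\<And>B. B \<in> sets borel \<Longrightarrow> emeasure \<kappa> B = emeasure \<mu> (B \<inter> Y) + emeasure \<nu> (B - Y)"
    using mass_bound_glue[OF T \<mu> \<nu> Y(1)] by metis
  have split: "emeasure \<rho> B = emeasure \<rho> (B \<inter> Y) + emeasure \<rho> (B - Y)"
    if "B \<in> sets borel" "finite_borel \<rho>" for B and \<rho> :: "'a measure"
    using that Y(1) by (subst plus_emeasure) (auto simp: Int_Diff_Un intro!: arg_cong[of _ _ "emeasure \<rho>"])
  have "emeasure \<kappa> B \<le> emeasure \<mu> B" "emeasure \<kappa> B \<le> emeasure \<nu> B" if "B \<in> sets borel" for B
    using k(2)[OF that] split[OF that fm] split[OF that fn] Y(2)[of "B \<inter> Y"] Y(3)[of "B - Y"] Y(1) that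
    by (auto intro!: add_mono)
  then show ?thesis using that k(1) by blast
qed

lemma le_epsilon_mult:
  fixes x y c :: real
  assumes "\<And>e. e > 0 \<Longrightarrow> x \<le> y + c * e" "0 \<le> c"
  shows "x \<le> y"
proof (rule field_le_epsilon)
  fix e :: real assume e: "e > 0"
  \<comment> \<open>The denominator is \<open>c + 1\<close> because \<open>c\<close> may be
    0.\<close>
  have "x \<le> y + c * (e / (c + 1))" by (rule assms(1)) (use assms(2) e in simp)
  also have "c * (e / (c + 1)) \<le> e" using assms(2) e by (simp add: divide_le_eq mult.commute)
  finally show "x \<le> y + e" by simp
qed

text \<open>The setwise infimum is countably additive by monotone convergence from above for the
  counting measure, where finiteness of \<open>\<kappa> 0\<close> provides the finite starting
  integral. The bound on \<open>T\<close> survives because the total masses converge to that of the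
  limit and \<open>LINT_diff_measure\<close> turns this into convergence of the integrals.\<close>

lemma mass_bound_decseq_limit:
  fixes T :: "'a::metric_space functional"
  assumes k: "\<And>n. mass_bound k T (\<kappa> n)"
    and dec: "\<And>n B. B \<in> sets borel \<Longrightarrow> emeasure (\<kappa> (Suc n)) B \<le> emeasure (\<kappa> n) B"
  obtains \<nu> where "mass_bound k T \<nu>" "\<And>n B. B \<in> sets borel \<Longrightarrow> emeasure \<nu> B \<le> emeasure (\<kappa> n) B"
proof -
  have fk: "finite_borel (\<kappa> n)" for n using k mass_bound_finite_borel by blast
  have decB: "decseq (\<lambda>n. emeasure (\<kappa> n) B)" if "B \<in> sets borel" for B
    using dec[OF that] by (rule decseq_SucI)
  define \<nu> where "\<nu> = measure_of UNIV (sets (borel :: 'a measure)) (\<lambda>B. INF n. emeasure (\<kappa> n) B)"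
  have s: "sets \<nu> = sets borel"
    unfolding \<nu>_def using sets.sigma_sets_eq[of "borel :: 'a measure"] by (simp add: sets_measure_of_conv)
  have e: "emeasure \<nu> B = (INF n. emeasure (\<kappa> n) B)" if "B \<in> sets borel" for B
    unfolding \<nu>_def
  proof (rule emeasure_measure_of_sigma[OF _ _ _ that])
    show "sigma_algebra UNIV (sets (borel :: 'a measure))"
      using sets.sigma_algebra_axioms[of "borel :: 'a measure"] by simp
    show "positive (sets borel) (\<lambda>B. INF n. emeasure (\<kappa> n) B)" by (simp add: positive_def)
    show "countably_additive (sets borel) (\<lambda>B. INF n. emeasure (\<kappa> n) B)"
    proof (rule countably_additiveI)
      fix A :: "nat \<Rightarrow> 'a set"
      assume A: "range A \<subseteq> sets borel" "disjoint_family A"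
      have sum: "(\<Sum>i. emeasure (\<kappa> n) (A i)) = emeasure (\<kappa> n) (\<Union> (range A))" for n
        using A fk by (intro suminf_emeasure) auto
      have fin: "(\<Sum>i. emeasure (\<kappa> 0) (A i)) < \<infinity>"
        unfolding sum using fk[of 0] finite_measure.emeasure_finite[of "\<kappa> 0"] by (simp add: less_top)
      have d: "decseq (\<lambda>n i. emeasure (\<kappa> n) (A i))"
      proof (intro decseq_SucI le_funI)
        show "emeasure (\<kappa> (Suc n)) (A i) \<le> emeasure (\<kappa> n) (A i)" for n i
          by (rule dec) (use A in auto)
      qed
      have "(\<Sum>i. INF n. emeasure (\<kappa> n) (A i))
          = (\<integral>\<^sup>+i. (INF n. emeasure (\<kappa> n) (A i)) \<partial>count_space UNIV)"
        by (simp add: nn_integral_count_space_nat)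
      also have "\<dots> = (INF n. \<integral>\<^sup>+i. emeasure (\<kappa> n) (A i) \<partial>count_space UNIV)"
        by (rule nn_integral_monotone_convergence_INF_decseq[OF d, of _ 0])
          (use fin in \<open>auto simp: nn_integral_count_space_nat\<close>)
      finally show "(\<Sum>i. INF n. emeasure (\<kappa> n) (A i)) = (INF n. emeasure (\<kappa> n) (\<Union> (range A)))"
        by (simp add: nn_integral_count_space_nat sum)
    qed
  qed
  have le: "emeasure \<nu> B \<le> emeasure (\<kappa> n) B" if "B \<in> sets borel" for n B
    unfolding e[OF that] by (rule INF_lower) simp
  have f\<nu>: "finite_borel \<nu>"
    using le[of UNIV 0] fk[of 0] finite_measure.emeasure_finite[of "\<kappa> 0" UNIV] s
    by (intro finite_borelI) (auto simp: top_unique)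
  have approx: "\<exists>n. measure (\<kappa> n) UNIV - measure \<nu> UNIV \<le> d" if "d > 0" for d :: real
  proof -
    have "emeasure \<nu> UNIV < emeasure \<nu> UNIV + ennreal d"
      using that f\<nu>
      by (simp add: finite_measure.emeasure_eq_measure ennreal_plus[symmetric] ennreal_less_iff del: ennreal_plus)
    then obtain n where "emeasure (\<kappa> n) UNIV < emeasure \<nu> UNIV + ennreal d"
      using e[of UNIV] by (auto simp: INF_less_iff)
    then have "ennreal (measure (\<kappa> n) UNIV) < ennreal (measure \<nu> UNIV + d)"
      using that fk[of n] f\<nu> by (simp add: finite_measure.emeasure_eq_measure)
    then have "measure (\<kappa> n) UNIV < measure \<nu> UNIV + d" by (simp add: ennreal_less_iff)
    then show ?thesis by (intro exI[of _ n]) simp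
  qed
  have "\<bar>T f \<pi>\<bar> \<le> (\<Prod>p\<leftarrow>\<pi>. Lip p) * (LINT x|\<nu>. \<bar>f x\<bar>)" if f: "f \<in> LIPb" and \<pi>: "\<pi> \<in> LIPs k" for f \<pi>
  proof -
    let ?P = "\<Prod>p\<leftarrow>\<pi>. Lip p"
    obtain F where F: "0 < F" "\<And>x. \<bar>f x\<bar> \<le> F" using LIPb_bound[OF f] by blast
    have P: "0 \<le> ?P" by (rule prod_Lip_nonneg[OF \<pi>])
    have fB: "(\<lambda>x. \<bar>f x\<bar>) \<in> borel_measurable borel"
      using LIP_measurable[OF LIPb_LIP[OF f], of borel] by simp
    show ?thesis
    proof (rule le_epsilon_mult[where c = "?P * F"])
      fix d :: real assume d: "d > 0"
      obtain n where n: "measure (\<kappa> n) UNIV - measure \<nu> UNIV \<le> d" using approx[OF d] by blast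
      have "\<bar>T f \<pi>\<bar> \<le> ?P * (LINT x|\<kappa> n. \<bar>f x\<bar>)" by (rule mass_boundD[OF k f \<pi>])
      also have "\<dots> \<le> ?P * ((LINT x|\<nu>. \<bar>f x\<bar>) + F * (measure (\<kappa> n) UNIV - measure \<nu> UNIV))"
        by (intro mult_left_mono P LINT_diff_measure f\<nu> fk le fB) (use F in auto)
      also have "\<dots> \<le> ?P * ((LINT x|\<nu>. \<bar>f x\<bar>) + F * d)"
        by (intro mult_left_mono add_left_mono P n) (use F in simp)
      finally show "\<bar>T f \<pi>\<bar> \<le> ?P * (LINT x|\<nu>. \<bar>f x\<bar>) + ?P * F * d" by (simp add: algebra_simps)
    qed (use P F in simp)
  qed
  then have "mass_bound k T \<nu>" using f\<nu> by (auto simp: mass_bound_def Dk_def)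
  then show ?thesis using that le by blast
qed

text \<open>The property whose unique witness is selected by the description in
  \<open>mass_measure\<close>.\<close>

definition minimal_mass_bound :: "nat \<Rightarrow> 'a::metric_space functional \<Rightarrow> 'a measure \<Rightarrow> bool" where
  "minimal_mass_bound k T \<mu> \<longleftrightarrow> mass_bound k T \<mu> \<and>
     (\<forall>\<nu>. mass_bound k T \<nu> \<longrightarrow> (\<forall>B\<in>sets borel. emeasure \<mu> B \<le> emeasure \<nu> B))"

text \<open>Let \<open>m\<close> be the infimum of the total masses. Infima of admissible measures
  yield a decreasing sequence with total masses tending to \<open>m\<close>, and its limit
  \<open>\<mu>\<close> has total mass exactly \<open>m\<close>. Any other admissible
  \<open>\<nu>\<close> has with \<open>\<mu>\<close> an admissible infimum, which lies below
  \<open>\<mu>\<close> but cannot have less total mass, hence equals \<open>\<mu>\<close>; so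
  \<open>\<mu>\<close> lies below \<open>\<nu>\<close>.\<close>

lemma minimal_mass_bound_exists:
  fixes T :: "'a::metric_space functional"
  assumes T: "T \<in> currents k"
  shows "\<exists>\<mu>. minimal_mass_bound k T \<mu>"
proof -
  define m where "m = Inf {measure \<mu> UNIV | \<mu>. mass_bound k T \<mu>}"
  have ne: "{measure \<mu> UNIV | \<mu>. mass_bound k T \<mu>} \<noteq> {}" using T by (auto simp: currents_def)
  have bdd: "bdd_below {measure \<mu> UNIV | \<mu>. mass_bound k T \<mu>}" by (rule bdd_belowI[of _ 0]) auto
  have m_le: "m \<le> measure \<mu> UNIV" if "mass_bound k T \<mu>" for \<mu>
    unfolding m_def by (rule cInf_lower[OF _ bdd]) (use that in blast)
  have near: "\<exists>\<mu>. mass_bound k T \<mu> \<and> measure \<mu> UNIV < m + 1 / real (Suc n)" for n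
    using cInf_lessD[OF ne, of "m + 1 / real (Suc n)"] by (auto simp: m_def)
  have mono: "measure \<mu> UNIV \<le> measure \<nu> UNIV"
    if "mass_bound k T \<mu>" "mass_bound k T \<nu>" "\<And>B. B \<in> sets borel \<Longrightarrow> emeasure \<mu> B \<le> emeasure \<nu> B" for \<mu> \<nu>
  proof -
    have "emeasure \<mu> UNIV \<le> emeasure \<nu> UNIV" using that(3) by simp
    moreover have "finite_measure \<mu>" "finite_measure \<nu>" using that mass_bound_finite_borel by auto
    ultimately show ?thesis by (simp add: finite_measure.emeasure_eq_measure)
  qed
  define Q where "Q n \<mu> \<longleftrightarrow> mass_bound k T \<mu> \<and> measure \<mu> UNIV < m + 1 / real (Suc n)" for n and \<mu> :: "'a measure"
  have "\<exists>\<kappa>. \<forall>n. Q n (\<kappa> n) \<and> (\<forall>B\<in>sets borel. emeasure (\<kappa> (Suc n)) B \<le> emeasure (\<kappa> n) B)"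
  proof (rule dependent_nat_choice)
    show "\<exists>\<mu>. Q 0 \<mu>" using near[of 0] by (simp add: Q_def)
    fix \<mu> n assume \<mu>: "Q n \<mu>"
    obtain \<nu> where \<nu>: "mass_bound k T \<nu>" "measure \<nu> UNIV < m + 1 / real (Suc (Suc n))" using near by blast
    obtain \<kappa> where \<kappa>: "mass_bound k T \<kappa>" "\<And>B. B \<in> sets borel \<Longrightarrow> emeasure \<kappa> B \<le> emeasure \<mu> B"
      "\<And>B. B \<in> sets borel \<Longrightarrow> emeasure \<kappa> B \<le> emeasure \<nu> B"
      using mass_bound_inf[OF T _ \<nu>(1), of \<mu>] \<mu> unfolding Q_def by metis
    have "measure \<kappa> UNIV \<le> measure \<nu> UNIV" by (rule mono[OF \<kappa>(1) \<nu>(1) \<kappa>(3)])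
    then show "\<exists>\<kappa>. Q (Suc n) \<kappa> \<and> (\<forall>B\<in>sets borel. emeasure \<kappa> B \<le> emeasure \<mu> B)"
      using \<kappa> \<nu>(2) by (intro exI[of _ \<kappa>]) (auto simp: Q_def)
  qed
  then obtain \<kappa> where \<kappa>: "\<And>n. Q n (\<kappa> n)"
    "\<And>n B. B \<in> sets borel \<Longrightarrow> emeasure (\<kappa> (Suc n)) B \<le> emeasure (\<kappa> n) B" by blast
  obtain \<mu> where \<mu>: "mass_bound k T \<mu>" "\<And>n B. B \<in> sets borel \<Longrightarrow> emeasure \<mu> B \<le> emeasure (\<kappa> n) B"
    using mass_bound_decseq_limit[of k T \<kappa>] \<kappa> unfolding Q_def by metis
  have "measure \<mu> UNIV \<le> m"
  proof (rule field_le_epsilon)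
    fix e :: real assume "e > 0"
    then obtain n where "1 / real (Suc n) < e" using nat_approx_posE by blast
    moreover have "measure \<mu> UNIV \<le> measure (\<kappa> n) UNIV"
      using mono \<mu> \<kappa>(1) unfolding Q_def by blast
    ultimately show "measure \<mu> UNIV \<le> m + e" using \<kappa>(1)[of n] unfolding Q_def by linarith
  qed
  then have tot: "measure \<mu> UNIV = m" using m_le[OF \<mu>(1)] by simp
  have "emeasure \<mu> B \<le> emeasure \<nu> B" if \<nu>: "mass_bound k T \<nu>" and B: "B \<in> sets borel" for \<nu> B
  proof -
    obtain \<rho> where \<rho>: "mass_bound k T \<rho>" "\<And>B. B \<in> sets borel \<Longrightarrow> emeasure \<rho> B \<le> emeasure \<mu> B"
      "\<And>B. B \<in> sets borel \<Longrightarrow> emeasure \<rho> B \<le> emeasure \<nu> B"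
      using mass_bound_inf[OF T \<mu>(1) \<nu>] by metis
    have f: "finite_borel \<mu>" "finite_borel \<rho>" using \<mu>(1) \<rho>(1) mass_bound_finite_borel by auto
    interpret m: finite_measure \<mu> using f by simp
    interpret r: finite_measure \<rho> using f by simp
    have sp: "space \<mu> = UNIV" "space \<rho> = UNIV" using f finite_borel_space by auto
    \<comment> \<open>Equality of the total masses upgrades \<open>\<rho> \<le> \<mu>\<close> to the
      reverse inequality on \<open>B\<close>: what \<open>\<rho>\<close> lost on \<open>B\<close> it
      would have to gain on the complement.\<close>
    have "measure \<rho> (UNIV - B) \<le> measure \<mu> (UNIV - B)"
      using \<rho>(2)[of "UNIV - B"] B by (simp add: m.emeasure_eq_measure r.emeasure_eq_measure)
    moreover have "measure \<mu> UNIV \<le> measure \<rho> UNIV" using m_le[OF \<rho>(1)] tot by simp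
    ultimately have "measure \<mu> B \<le> measure \<rho> B"
      using m.finite_measure_compl[of B] r.finite_measure_compl[of B] B f sp by simp
    then have "emeasure \<mu> B \<le> emeasure \<rho> B" by (simp add: m.emeasure_eq_measure r.emeasure_eq_measure)
    also have "\<dots> \<le> emeasure \<nu> B" by (rule \<rho>(3)[OF B])
    finally show ?thesis .
  qed
  then show ?thesis using \<mu>(1) unfolding minimal_mass_bound_def by blast
qed

lemma minimal_mass_bound_unique:
  assumes "minimal_mass_bound k T \<mu>" "minimal_mass_bound k T \<nu>"
  shows "\<mu> = \<nu>"
proof (rule measure_eqI)
  have *: "sets \<mu> = sets borel" "sets \<nu> = sets borel"
    using assms by (auto simp: minimal_mass_bound_def mass_bound_def)
  then show "sets \<mu> = sets \<nu>" by simp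
  show "emeasure \<mu> A = emeasure \<nu> A" if "A \<in> sets \<mu>" for A
    using assms that * unfolding minimal_mass_bound_def by (metis order_antisym)
qed

lemma minimal_mass_measure:
  assumes "T \<in> currents k"
  shows "minimal_mass_bound k T (mass_measure k T)"
proof -
  have "mass_measure k T = (THE \<mu>. minimal_mass_bound k T \<mu>)"
    unfolding mass_measure_def minimal_mass_bound_def ..
  then show ?thesis
    using theI'[of "minimal_mass_bound k T"] minimal_mass_bound_exists[OF assms] minimal_mass_bound_unique
    by (metis (no_types, lifting))
qed

lemma mass_bound_mass_measure: "T \<in> currents k \<Longrightarrow> mass_bound k T (mass_measure k T)"
  using minimal_mass_measure minimal_mass_bound_def by blast

lemma mass_measure_le:
  "T \<in> currents k \<Longrightarrow> mass_bound k T \<nu> \<Longrightarrow> B \<in> sets borel \<Longrightarrow> emeasure (mass_measure k T) B \<le> emeasure \<nu> B"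
  using minimal_mass_measure minimal_mass_bound_def by blast

lemma finite_borel_mass_measure: "T \<in> currents k \<Longrightarrow> finite_borel (mass_measure k T)"
  by (rule mass_bound_finite_borel[OF mass_bound_mass_measure])

lemma mass_nonneg: "0 \<le> mass k T" by (simp add: mass_def)

lemma mass_le:
  assumes "T \<in> currents k" "mass_bound k T \<nu>"
  shows "mass k T \<le> measure \<nu> UNIV"
proof -
  have "emeasure (mass_measure k T) UNIV \<le> emeasure \<nu> UNIV" using mass_measure_le[OF assms] by simp
  then show ?thesis using finite_borel_mass_measure[OF assms(1)] mass_bound_finite_borel[OF assms(2)]
    by (simp add: finite_measure.emeasure_eq_measure mass_def)
qed

lemma current_abs_le:
  assumes "T \<in> currents k" "f \<in> LIPb" "\<pi> \<in> LIPs k" "\<And>x. \<bar>f x\<bar> \<le> F"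
  shows "\<bar>T f \<pi>\<bar> \<le> (\<Prod>p\<leftarrow>\<pi>. Lip p) * (F * mass k T)"
proof -
  have "\<bar>T f \<pi>\<bar> \<le> (\<Prod>p\<leftarrow>\<pi>. Lip p) * (LINT x|mass_measure k T. \<bar>f x\<bar>)"
    by (rule mass_boundD[OF mass_bound_mass_measure]) (use assms in auto)
  also have "\<dots> \<le> (\<Prod>p\<leftarrow>\<pi>. Lip p) * (F * mass k T)"
    unfolding mass_def using assms finite_borel_mass_measure[OF assms(1)]
    by (intro mult_left_mono abs_integral_le_bound prod_Lip_nonneg LIP_measurable LIPb_LIP) auto
  finally show ?thesis .
qed

text \<open>Evaluates the definite description. Uniqueness holds because linearity and the bound
  force any competitor to differ from \<open>T (g n)\<close> by at most a multiple of the L1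
  distance of \<open>g n\<close> to \<open>f\<close>, which tends to 0.\<close>

lemma extension_eq:
  assumes T: "T \<in> currents k"
  shows "extension k T = (\<lambda>f \<pi>. if integrable (mass_measure k T) f \<and> \<pi> \<in> LIPs k
    then L1_extension (mass_measure k T) T f \<pi> else 0)" (is "_ = ?E")
  unfolding extension_def
proof (rule the_equality)
  let ?\<mu> = "mass_measure k T"
  note m = mass_bound_mass_measure[OF T]
  note fb = finite_borel_mass_measure[OF T]
  have "\<forall>f \<pi>. \<not> (integrable ?\<mu> f \<and> \<pi> \<in> LIPs k) \<longrightarrow> ?E f \<pi> = 0" by simp
  moreover have "\<forall>(f, \<pi>) \<in> Dk k. ?E f \<pi> = T f \<pi>"
    using LIPb_integrable[OF _ fb] L1_extension_LIPb[OF T m] by (auto simp: Dk_def)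
  moreover have "multilinear_on {f. integrable ?\<mu> f} k ?E"
    unfolding multilinear_on_def
    by (auto simp: L1_extension_lincomb[OF T m] L1_extension_lincomb_slot[OF T m] LIPs_update LIP_lincomb)
  moreover have "\<forall>f \<pi>. integrable ?\<mu> f \<and> \<pi> \<in> LIPs k \<longrightarrow>
      \<bar>?E f \<pi>\<bar> \<le> (\<Prod>p\<leftarrow>\<pi>. Lip p) * (LINT x|?\<mu>. \<bar>f x\<bar>)"
    using L1_extension_bound[OF T m] by auto
  ultimately show "(\<forall>f \<pi>. \<not> (integrable ?\<mu> f \<and> \<pi> \<in> LIPs k) \<longrightarrow> ?E f \<pi> = 0) \<and>
     (\<forall>(f, \<pi>) \<in> Dk k. ?E f \<pi> = T f \<pi>) \<and>
     multilinear_on {f. integrable ?\<mu> f} k ?E \<and>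
     (\<forall>f \<pi>. integrable ?\<mu> f \<and> \<pi> \<in> LIPs k \<longrightarrow>
        \<bar>?E f \<pi>\<bar> \<le> (\<Prod>p\<leftarrow>\<pi>. Lip p) * (LINT x|?\<mu>. \<bar>f x\<bar>))"
    by (intro conjI)
  fix T' :: "'a functional"
  assume T': "(\<forall>f \<pi>. \<not> (integrable ?\<mu> f \<and> \<pi> \<in> LIPs k) \<longrightarrow> T' f \<pi> = 0) \<and>
     (\<forall>(f, \<pi>) \<in> Dk k. T' f \<pi> = T f \<pi>) \<and>
     multilinear_on {f. integrable ?\<mu> f} k T' \<and>
     (\<forall>f \<pi>. integrable ?\<mu> f \<and> \<pi> \<in> LIPs k \<longrightarrow>
        \<bar>T' f \<pi>\<bar> \<le> (\<Prod>p\<leftarrow>\<pi>. Lip p) * (LINT x|?\<mu>. \<bar>f x\<bar>))"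
  show "T' = ?E"
  proof (intro ext)
    fix f \<pi>
    show "T' f \<pi> = ?E f \<pi>"
    proof (cases "integrable ?\<mu> f \<and> \<pi> \<in> LIPs k")
      case True
      then have f: "integrable ?\<mu> f" and \<pi>: "\<pi> \<in> LIPs k" by auto
      obtain g where g: "L1_lim ?\<mu> g f" using L1_lim_exists[OF fb f] by blast
      have gL: "g n \<in> LIPb" for n using g by (simp add: L1_lim_def)
      then have gi: "integrable ?\<mu> (g n)" for n using LIPb_integrable fb by blast
      have "\<bar>T (g n) \<pi> - T' f \<pi>\<bar> \<le> (\<Prod>p\<leftarrow>\<pi>. Lip p) * (LINT x|?\<mu>. \<bar>g n x - f x\<bar>)" for n
      proof -
        have lin: "\<forall>f\<in>{f. integrable ?\<mu> f}. \<forall>g\<in>{f. integrable ?\<mu> f}. \<forall>\<pi>\<in>LIPs k. \<forall>a b.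
            T' (\<lambda>x. a * f x + b * g x) \<pi> = a * T' f \<pi> + b * T' g \<pi>"
          using T' unfolding multilinear_on_def by blast
        have "T' (\<lambda>x. 1 * g n x + (-1) * f x) \<pi> = 1 * T' (g n) \<pi> + (-1) * T' f \<pi>"
          using lin f gi[of n] \<pi> by blast
        moreover have "T' (g n) \<pi> = T (g n) \<pi>" using T' gL \<pi> by (auto simp: Dk_def)
        moreover have "integrable ?\<mu> (\<lambda>x. g n x - f x)" using f gi by auto
        then have "\<bar>T' (\<lambda>x. g n x - f x) \<pi>\<bar> \<le> (\<Prod>p\<leftarrow>\<pi>. Lip p) * (LINT x|?\<mu>. \<bar>g n x - f x\<bar>)"
          using T' \<pi> by blast
        ultimately show ?thesis by simp
      qed
      note le = this
      have "(\<lambda>n. (\<Prod>p\<leftarrow>\<pi>. Lip p) * (LINT x|?\<mu>. \<bar>g n x - f x\<bar>)) \<longlonglongrightarrow> 0"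
        using g unfolding L1_lim_def by (intro tendsto_mult_right_zero) auto
      then have "(\<lambda>n. T (g n) \<pi> - T' f \<pi>) \<longlonglongrightarrow> 0"
        by (rule Lim_null_comparison[rotated]) (simp add: le)
      then have "(\<lambda>n. T (g n) \<pi>) \<longlonglongrightarrow> T' f \<pi>" by (rule LIM_zero_cancel)
      then have "L1_extension ?\<mu> T f \<pi> = T' f \<pi>" by (rule L1_extension_eqI[OF T m f \<pi> g])
      then show ?thesis using True by simp
    next
      case False then show ?thesis using T' by auto
    qed
  qed
qed

text \<open>Approximation may be tested in any admissible \<open>\<mu>\<close>, since it dominates
  the mass measure. For a series of currents the mass measure is not explicit, but the series of
  mass measures is admissible.\<close>

lemma extension_tendsto:
  assumes "T \<in> currents k" "mass_bound k T \<mu>" "f \<in> borel_measurable borel" "\<And>x. \<bar>f x\<bar> \<le> F"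
    "\<pi> \<in> LIPs k" "L1_lim \<mu> g f"
  shows "(\<lambda>n. T (g n) \<pi>) \<longlonglongrightarrow> extension k T f \<pi>"
proof -
  note fb = finite_borel_mass_measure[OF assms(1)]
  have i: "integrable (mass_measure k T) f" by (rule bounded_integrable[OF fb assms(3,4)])
  have "L1_lim (mass_measure k T) g f"
    by (rule L1_lim_mono_measure[OF fb mass_bound_finite_borel[OF assms(2)] _ assms(3,4,6)])
      (rule mass_measure_le[OF assms(1,2)])
  then show ?thesis unfolding extension_eq[OF assms(1)]
    using i assms(5) L1_extension_tendsto[OF assms(1) mass_bound_mass_measure[OF assms(1)] i assms(5)] by simp
qed

lemma extension_bound:
  assumes "T \<in> currents k" "mass_bound k T \<mu>" "f \<in> borel_measurable borel" "\<And>x. \<bar>f x\<bar> \<le> F"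
    "\<pi> \<in> LIPs k"
  shows "\<bar>extension k T f \<pi>\<bar> \<le> (\<Prod>p\<leftarrow>\<pi>. Lip p) * (LINT x|\<mu>. \<bar>f x\<bar>)"
proof -
  note fb = finite_borel_mass_measure[OF assms(1)]
  note m = mass_bound_mass_measure[OF assms(1)]
  have i: "integrable (mass_measure k T) f" by (rule bounded_integrable[OF fb assms(3,4)])
  have "\<bar>extension k T f \<pi>\<bar> \<le> (\<Prod>p\<leftarrow>\<pi>. Lip p) * (LINT x|mass_measure k T. \<bar>f x\<bar>)"
    unfolding extension_eq[OF assms(1)] using i assms(5) L1_extension_bound[OF assms(1) m i assms(5)] by simp
  also have "\<dots> \<le> (\<Prod>p\<leftarrow>\<pi>. Lip p) * (LINT x|\<mu>. \<bar>f x\<bar>)"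
    by (intro mult_left_mono LINT_mono_measure[where F = F] fb mass_bound_finite_borel[OF assms(2)]
        mass_measure_le[OF assms(1,2)] prod_Lip_nonneg[OF assms(5)]) (use assms in auto)
  finally show ?thesis .
qed

lemma extension_diff_bound:
  assumes "T \<in> currents k" "mass_bound k T \<mu>" "f \<in> borel_measurable borel" "\<And>x. \<bar>f x\<bar> \<le> F"
    "g \<in> LIPb" "\<pi> \<in> LIPs k"
  shows "\<bar>extension k T f \<pi> - T g \<pi>\<bar> \<le> (\<Prod>p\<leftarrow>\<pi>. Lip p) * (LINT x|\<mu>. \<bar>f x - g x\<bar>)"
proof -
  note fb = finite_borel_mass_measure[OF assms(1)]
  note m = mass_bound_mass_measure[OF assms(1)]
  obtain G where G: "\<And>x. \<bar>g x\<bar> \<le> G" using LIPb_bound[OF assms(5)] by metis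
  have gB: "g \<in> borel_measurable borel" using LIP_measurable[OF LIPb_LIP[OF assms(5)]] by simp
  have i: "integrable (mass_measure k T) f" by (rule bounded_integrable[OF fb assms(3,4)])
  have ig: "integrable (mass_measure k T) g" by (rule LIPb_integrable[OF assms(5) fb])
  have d: "\<bar>f x - g x\<bar> \<le> F + G" for x using G[of x] assms(4)[of x] by linarith
  have dB: "(\<lambda>x. f x - g x) \<in> borel_measurable borel" using assms(3) gB by simp
  have "extension k T (\<lambda>x. 1 * f x + (-1) * g x) \<pi> = 1 * extension k T f \<pi> + (-1) * T g \<pi>"
    unfolding extension_eq[OF assms(1)]
    using i ig assms(6) L1_extension_lincomb[OF assms(1) m i ig assms(6), of 1 "-1"] L1_extension_LIPb[OF assms(1) m assms(5,6)]
    by simp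
  then show ?thesis using extension_bound[OF assms(1,2) dB d assms(6)] by simp
qed


subsection \<open>Series of currents\<close>

definition series_current :: "(nat \<Rightarrow> 'a functional) \<Rightarrow> 'a functional" where
  "series_current S f \<pi> = (\<Sum>n. S n f \<pi>)"

lemma LINT_series_measure:
  fixes M :: "nat \<Rightarrow> 'a::metric_space measure"
  assumes M: "\<And>n. finite_borel (M n)" and s: "summable (\<lambda>n. measure (M n) UNIV)"
    and f: "f \<in> borel_measurable borel" "\<And>x. 0 \<le> f x" "\<And>x. f x \<le> (B::real)"
  shows "(\<lambda>n. LINT x|M n. f x) sums (LINT x|series_measure M. f x)"
proof -
  have "ennreal (LINT x|series_measure M. f x) = (\<integral>\<^sup>+x. f x \<partial>series_measure M)"
    by (rule LINT_bounded_eq_nn[OF finite_series_measure(1)[OF M s] f])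
  also have "\<dots> = (\<Sum>n. \<integral>\<^sup>+x. f x \<partial>M n)"
    by (rule nn_integral_series_measure) (use M f in auto)
  also have "\<dots> = (\<Sum>n. ennreal (LINT x|M n. f x))"
    using LINT_bounded_eq_nn[OF M f] by simp
  finally have "(\<lambda>n. ennreal (LINT x|M n. f x)) sums ennreal (LINT x|series_measure M. f x)"
    using summable_sums[OF summableI, of "\<lambda>n. ennreal (LINT x|M n. f x)"] by simp
  then show ?thesis using f(2) by (subst (asm) sums_ennreal) auto
qed

lemma prod_list_le_prod:
  assumes "\<pi> \<in> LIPs k" "\<And>i. i < k \<Longrightarrow> Lip (\<pi> ! i) \<le> B i"
  shows "(\<Prod>p\<leftarrow>\<pi>. Lip p) \<le> (\<Prod>i<k. B i)"
proof -
  have "(\<Prod>p\<leftarrow>\<pi>. Lip p) = (\<Prod>i<k. Lip (\<pi> ! i))"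
    using assms(1) by (subst prod.list_conv_set_nth) (auto simp: LIPs_def atLeast0LessThan)
  also have "\<dots> \<le> (\<Prod>i<k. B i)"
    by (rule prod_mono) (use assms LIPs_nth Lip_nonneg in blast)
  finally show ?thesis .
qed

context
  fixes k :: nat and S :: "nat \<Rightarrow> 'a::metric_space functional"
  assumes S: "\<And>n. S n \<in> currents k" and sm: "summable (\<lambda>n. mass k (S n))"
begin

lemma series_summable: "summable (\<lambda>n. \<bar>S n f \<pi>\<bar>)"
proof (cases "(f, \<pi>) \<in> Dk k")
  case True
  then have f: "f \<in> LIPb" and \<pi>: "\<pi> \<in> LIPs k" by (auto simp: Dk_def)
  obtain F where F: "\<And>x. \<bar>f x\<bar> \<le> F" using LIPb_bound[OF f] by metis
  show ?thesis
    by (rule summable_comparison_test'[of "\<lambda>n. (\<Prod>p\<leftarrow>\<pi>. Lip p) * (F * mass k (S n))"])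
      (use sm current_abs_le[OF S f \<pi> F] in \<open>auto intro!: summable_mult\<close>)
next
  case False
  then have "S n f \<pi> = 0" for n using currents_outside S by blast
  then show ?thesis by simp
qed

lemma series_sums: "(\<lambda>n. S n f \<pi>) sums series_current S f \<pi>"
  unfolding series_current_def by (rule summable_sums[OF summable_rabs_cancel[OF series_summable]])

lemma finite_borel_series:
  "finite_borel (series_measure (\<lambda>n. mass_measure k (S n)))"
  "measure (series_measure (\<lambda>n. mass_measure k (S n))) UNIV = (\<Sum>n. mass k (S n))"
  using finite_series_measure[of "\<lambda>n. mass_measure k (S n)"] finite_borel_mass_measure[OF S] sm
  unfolding mass_def by auto

lemma LINT_series_mass_measure:
  assumes "f \<in> borel_measurable borel" "\<And>x. 0 \<le> f x" "\<And>x. f x \<le> (B::real)"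
  shows "(\<lambda>n. LINT x|mass_measure k (S n). f x) sums (LINT x|series_measure (\<lambda>n. mass_measure k (S n)). f x)"
  by (rule LINT_series_measure) (use sm finite_borel_mass_measure[OF S] assms in \<open>auto simp: mass_def\<close>)

lemma mass_bound_series: "mass_bound k (series_current S) (series_measure (\<lambda>n. mass_measure k (S n)))"
  unfolding mass_bound_def
proof (intro conjI ballI)
  let ?M = "series_measure (\<lambda>n. mass_measure k (S n))"
  show "sets ?M = sets borel" "finite_measure ?M" using finite_borel_series(1) by auto
  fix z :: "('a \<Rightarrow> real) \<times> ('a \<Rightarrow> real) list" assume "z \<in> Dk k"
  then obtain f \<pi> where z: "z = (f, \<pi>)" and f: "f \<in> LIPb" and \<pi>: "\<pi> \<in> LIPs k" by (auto simp: Dk_def)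
  let ?P = "\<Prod>p\<leftarrow>\<pi>. Lip p"
  obtain F where F: "\<And>x. \<bar>f x\<bar> \<le> F" using LIPb_bound[OF f] by metis
  have sums: "(\<lambda>n. LINT x|mass_measure k (S n). \<bar>f x\<bar>) sums (LINT x|?M. \<bar>f x\<bar>)"
    using LIP_measurable[OF LIPb_LIP[OF f], of borel] F by (intro LINT_series_mass_measure) auto
  have "\<bar>series_current S f \<pi>\<bar> \<le> (\<Sum>n. \<bar>S n f \<pi>\<bar>)"
    unfolding series_current_def using series_summable by (rule summable_rabs)
  also have "\<dots> \<le> (\<Sum>n. ?P * (LINT x|mass_measure k (S n). \<bar>f x\<bar>))"
    by (intro suminf_le series_summable summable_mult sums_summable[OF sums]
        mass_boundD[OF mass_bound_mass_measure[OF S] f \<pi>])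
  also have "\<dots> = ?P * (LINT x|?M. \<bar>f x\<bar>)"
    using sums by (simp add: sums_iff suminf_mult)
  finally show "case z of (f, \<pi>) \<Rightarrow> \<bar>series_current S f \<pi>\<bar> \<le> (\<Prod>p\<leftarrow>\<pi>. Lip p) * (LINT x|?M. \<bar>f x\<bar>)"
    by (simp add: z)
qed

lemma series_in_currents: "series_current S \<in> currents k"
  unfolding currents_def mem_Collect_eq
proof (intro conjI)
  show "\<forall>f \<pi>. (f, \<pi>) \<notin> Dk k \<longrightarrow> series_current S f \<pi> = 0"
    unfolding series_current_def using currents_outside[OF S] by simp
  show "multilinear_on LIPb k (series_current S)"
    unfolding multilinear_on_def
  proof (intro conjI ballI allI impI)
    fix f g :: "'a \<Rightarrow> real" and \<pi> :: "('a \<Rightarrow> real) list" and a b :: real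
    assume f: "f \<in> LIPb" and g: "g \<in> LIPb" and \<pi>: "\<pi> \<in> LIPs k"
    have "(\<lambda>n. a * S n f \<pi> + b * S n g \<pi>) sums (a * series_current S f \<pi> + b * series_current S g \<pi>)"
      by (intro sums_add sums_mult series_sums)
    then have "(\<lambda>n. S n (\<lambda>x. a * f x + b * g x) \<pi>) sums (a * series_current S f \<pi> + b * series_current S g \<pi>)"
      using currents_lincomb[OF S f g \<pi>] by simp
    then show "series_current S (\<lambda>x. a * f x + b * g x) \<pi> = a * series_current S f \<pi> + b * series_current S g \<pi>"
      unfolding series_current_def[of S "\<lambda>x. a * f x + b * g x"] by (simp add: sums_iff)
  next
    fix f p q :: "'a \<Rightarrow> real" and \<pi> :: "('a \<Rightarrow> real) list" and a b :: real and i
    assume *: "f \<in> LIPb" "\<pi> \<in> LIPs k" "i < k" "p \<in> LIP" "q \<in> LIP"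
    have "(\<lambda>n. a * S n f (\<pi>[i := p]) + b * S n f (\<pi>[i := q])) sums
      (a * series_current S f (\<pi>[i := p]) + b * series_current S f (\<pi>[i := q]))"
      by (intro sums_add sums_mult series_sums)
    then have "(\<lambda>n. S n f (\<pi>[i := (\<lambda>x. a * p x + b * q x)])) sums
      (a * series_current S f (\<pi>[i := p]) + b * series_current S f (\<pi>[i := q]))"
      using currents_lincomb_slot[OF S *] by simp
    then show "series_current S f (\<pi>[i := (\<lambda>x. a * p x + b * q x)])
      = a * series_current S f (\<pi>[i := p]) + b * series_current S f (\<pi>[i := q])"
      unfolding series_current_def[of S f "\<pi>[i := (\<lambda>x. a * p x + b * q x)]"] by (simp add: sums_iff)
  qed
  show "\<forall>f \<pi>. (f, \<pi>) \<in> Dk k \<and>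
        (\<exists>i<k. \<exists>U c. open U \<and> {x. f x \<noteq> 0} \<subseteq> U \<and> (\<forall>x\<in>U. (\<pi> ! i) x = c)) \<longrightarrow>
        series_current S f \<pi> = 0"
  proof (intro allI impI)
    fix f :: "'a \<Rightarrow> real" and \<pi> assume *: "(f, \<pi>) \<in> Dk k \<and>
        (\<exists>i<k. \<exists>U c. open U \<and> {x. f x \<noteq> 0} \<subseteq> U \<and> (\<forall>x\<in>U. (\<pi> ! i) x = c))"
    have "S n f \<pi> = 0" for n using S[of n] * unfolding currents_def by blast
    then show "series_current S f \<pi> = 0" by (simp add: series_current_def)
  qed
  show "\<forall>f \<pi> \<pi>n. (f, \<pi>) \<in> Dk k \<and> (\<forall>n. (f, \<pi>n n) \<in> Dk k) \<and>
        (\<forall>i<k. \<forall>x. (\<lambda>n. (\<pi>n n ! i) x) \<longlonglongrightarrow> (\<pi> ! i) x) \<and>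
        (\<forall>i<k. bdd_above (range (\<lambda>n. Lip (\<pi>n n ! i)))) \<longrightarrow>
        (\<lambda>n. series_current S f (\<pi>n n)) \<longlonglongrightarrow> series_current S f \<pi>"
  proof (intro allI impI)
    fix f :: "'a \<Rightarrow> real" and \<pi> \<pi>n assume *: "(f, \<pi>) \<in> Dk k \<and> (\<forall>n. (f, \<pi>n n) \<in> Dk k) \<and>
        (\<forall>i<k. \<forall>x. (\<lambda>n. (\<pi>n n ! i) x) \<longlonglongrightarrow> (\<pi> ! i) x) \<and>
        (\<forall>i<k. bdd_above (range (\<lambda>n. Lip (\<pi>n n ! i))))"
    then have f: "f \<in> LIPb" and \<pi>n: "\<And>n. \<pi>n n \<in> LIPs k" by (auto simp: Dk_def)
    obtain F where F: "0 < F" "\<And>x. \<bar>f x\<bar> \<le> F" using LIPb_bound[OF f] by metis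
    define B where "B i = (SUP n. Lip (\<pi>n n ! i))" for i
    have B: "Lip (\<pi>n n ! i) \<le> B i" if "i < k" for n i
      unfolding B_def by (rule cSUP_upper) (use * that in auto)
    have lim: "(\<lambda>n. S m f (\<pi>n n)) \<longlonglongrightarrow> S m f \<pi>" for m
      using S[of m] * unfolding currents_def by blast
    have "norm (S m f (\<pi>n n)) \<le> (\<Prod>i<k. B i) * (F * mass k (S m))" for m n
    proof -
      have "\<bar>S m f (\<pi>n n)\<bar> \<le> (\<Prod>p\<leftarrow>\<pi>n n. Lip p) * (F * mass k (S m))"
        by (rule current_abs_le[OF S f \<pi>n F(2)])
      also have "\<dots> \<le> (\<Prod>i<k. B i) * (F * mass k (S m))"
        by (rule mult_right_mono[OF prod_list_le_prod[OF \<pi>n B] mult_nonneg_nonneg[OF less_imp_le[OF F(1)] mass_nonneg]])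
      finally show ?thesis by simp
    qed
    \<comment> \<open>The majorant in Tannery's theorem: summable in \<open>m\<close> and
      independent of \<open>n\<close>, because the Lipschitz constants along the sequence are
      bounded by \<open>B\<close>.\<close>
    then have ev: "eventually (\<lambda>(m, n). norm (S m f (\<pi>n n)) \<le> (\<Prod>i<k. B i) * (F * mass k (S m)))
        (sequentially \<times>\<^sub>F sequentially)"
      by (auto intro!: always_eventually)
    show "(\<lambda>n. series_current S f (\<pi>n n)) \<longlonglongrightarrow> series_current S f \<pi>"
      unfolding series_current_def
      using tannerys_theorem[OF lim ev] sm by (auto intro!: summable_mult)
  qed
  show "\<exists>\<mu>. mass_bound k (series_current S) \<mu>" using mass_bound_series by blast
qed

lemma mass_series_le: "mass k (series_current S) \<le> (\<Sum>n. mass k (S n))"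
  using mass_le[OF series_in_currents mass_bound_series] finite_borel_series(2) by simp

text \<open>Extension is a limit, so its interchange with the series needs a uniform approximation.
  A sequence approximating \<open>f\<close> in the series of mass measures does so in every term,
  and the errors of the terms add up to the error in the series measure.\<close>

lemma extension_series_sums:
  assumes f: "f \<in> borel_measurable borel" and F: "\<And>x. \<bar>f x\<bar> \<le> F" and \<pi>: "\<pi> \<in> LIPs k"
  shows "(\<lambda>n. extension k (S n) f \<pi>) sums extension k (series_current S) f \<pi>"
proof -
  let ?M = "series_measure (\<lambda>n. mass_measure k (S n))" and ?P = "\<Prod>p\<leftarrow>\<pi>. Lip p"
  let ?\<mu> = "\<lambda>n. mass_measure k (S n)"
  note P = prod_Lip_nonneg[OF \<pi>]
  note mb = mass_bound_mass_measure[OF S]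
  obtain g where g: "L1_lim ?M g f"
    using L1_lim_exists[OF finite_borel_series(1) bounded_integrable[OF finite_borel_series(1) f F]] by blast
  have gL: "g m \<in> LIPb" for m using g by (simp add: L1_lim_def)
  have sm1: "summable (\<lambda>n. \<bar>extension k (S n) f \<pi>\<bar>)"
  proof (rule summable_comparison_test')
    show "summable (\<lambda>n. ?P * (F * mass k (S n)))" by (intro summable_mult sm)
    fix n
    have "\<bar>extension k (S n) f \<pi>\<bar> \<le> ?P * (LINT x|?\<mu> n. \<bar>f x\<bar>)" by (rule extension_bound[OF S mb f F \<pi>])
    also have "\<dots> \<le> ?P * (F * mass k (S n))"
      unfolding mass_def by (intro mult_left_mono P abs_integral_le_bound f F finite_borel_mass_measure[OF S])
    finally show "norm \<bar>extension k (S n) f \<pi>\<bar> \<le> ?P * (F * mass k (S n))" by simp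
  qed
  then have sm2: "summable (\<lambda>n. extension k (S n) f \<pi>)" by (rule summable_rabs_cancel)
  have le: "\<bar>(\<Sum>n. extension k (S n) f \<pi>) - series_current S (g m) \<pi>\<bar> \<le> ?P * (LINT x|?M. \<bar>g m x - f x\<bar>)" for m
  proof -
    obtain G where G: "\<And>x. \<bar>g m x\<bar> \<le> G" using LIPb_bound[OF gL] by metis
    have B: "\<bar>g m x - f x\<bar> \<le> G + F" for x using G[of x] F[of x] by linarith
    have sums: "(\<lambda>n. LINT x|?\<mu> n. \<bar>g m x - f x\<bar>) sums (LINT x|?M. \<bar>g m x - f x\<bar>)"
      using LIP_measurable[OF LIPb_LIP[OF gL], of borel] f B
      by (intro LINT_series_mass_measure[where B = "G + F"]) auto
    have bd: "\<bar>extension k (S n) f \<pi> - S n (g m) \<pi>\<bar> \<le> ?P * (LINT x|?\<mu> n. \<bar>g m x - f x\<bar>)" for n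
      using extension_diff_bound[OF S mb f F gL \<pi>] by (simp add: abs_minus_commute[of "g m _"])
    have sm3: "summable (\<lambda>n. \<bar>extension k (S n) f \<pi> - S n (g m) \<pi>\<bar>)"
      by (rule summable_comparison_test'[OF summable_mult[OF sums_summable[OF sums], of ?P]]) (use bd in simp)
    have "(\<Sum>n. extension k (S n) f \<pi>) - series_current S (g m) \<pi> = (\<Sum>n. extension k (S n) f \<pi> - S n (g m) \<pi>)"
      unfolding series_current_def by (rule suminf_diff[OF sm2 sums_summable[OF series_sums]])
    also have "\<bar>\<dots>\<bar> \<le> (\<Sum>n. \<bar>extension k (S n) f \<pi> - S n (g m) \<pi>\<bar>)" by (rule summable_rabs[OF sm3])
    also have "\<dots> \<le> (\<Sum>n. ?P * (LINT x|?\<mu> n. \<bar>g m x - f x\<bar>))"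
      by (rule suminf_le[OF bd sm3 summable_mult[OF sums_summable[OF sums]]])
    also have "\<dots> = ?P * (LINT x|?M. \<bar>g m x - f x\<bar>)"
      using sums by (simp add: sums_iff suminf_mult)
    finally show ?thesis .
  qed
  have "(\<lambda>m. ?P * (LINT x|?M. \<bar>g m x - f x\<bar>)) \<longlonglongrightarrow> 0"
    using g unfolding L1_lim_def by (intro tendsto_mult_right_zero) auto
  then have "(\<lambda>m. (\<Sum>n. extension k (S n) f \<pi>) - series_current S (g m) \<pi>) \<longlonglongrightarrow> 0"
    by (rule Lim_null_comparison[rotated]) (simp add: le)
  moreover have "(\<lambda>m. (\<Sum>n. extension k (S n) f \<pi>) - series_current S (g m) \<pi>)
      \<longlonglongrightarrow> (\<Sum>n. extension k (S n) f \<pi>) - extension k (series_current S) f \<pi>"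
    by (intro tendsto_intros extension_tendsto[OF series_in_currents mass_bound_series f F \<pi> g])
  ultimately have "(\<Sum>n. extension k (S n) f \<pi>) - extension k (series_current S) f \<pi> = 0"
    using LIMSEQ_unique by blast
  then show ?thesis using summable_sums[OF sm2] by simp
qed

lemma current_restrict_series_sums:
  assumes "E \<in> sets borel" "(f, \<pi>) \<in> Dk k"
  shows "(\<lambda>n. current_restrict k (S n) E f \<pi>) sums current_restrict k (series_current S) E f \<pi>"
proof -
  have f: "f \<in> LIPb" using assms by (simp add: Dk_def)
  obtain F where F: "0 < F" "\<And>x. \<bar>f x\<bar> \<le> F" using LIPb_bound[OF f] by metis
  have "(\<lambda>n. extension k (S n) (\<lambda>x. indicator E x * f x) \<pi>) sums extension k (series_current S) (\<lambda>x. indicator E x * f x) \<pi>"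
    by (rule extension_series_sums[where F = F])
      (use assms F LIP_measurable[OF LIPb_LIP[OF f], of borel] in \<open>auto simp: Dk_def indicator_def less_imp_le\<close>)
  then show ?thesis using assms by (simp add: current_restrict_def)
qed

end

lemma boundary_series: "boundary k (series_current S) = series_current (\<lambda>n. boundary k (S n))"
  by (intro HOL.ext) (auto simp: boundary_def series_current_def)

section \<open>Negatives, zero and finite sums of currents\<close>

lemma mass_bound_uminus: "mass_bound k (- T) \<mu> \<longleftrightarrow> mass_bound k T \<mu>"
  by (simp add: mass_bound_def)

lemma mass_measure_uminus: "mass_measure k (- T) = mass_measure k T"
  by (simp add: mass_measure_def mass_bound_uminus)

lemma mass_uminus: "mass k (- T) = mass k T"
  by (simp add: mass_def mass_measure_uminus)

lemma boundary_uminus: "boundary k (- T) = - boundary k T"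
  by (intro HOL.ext) (auto simp: boundary_def)

lemma currents_uminus: "T \<in> currents k \<Longrightarrow> - T \<in> currents k"
  unfolding currents_def multilinear_on_def mass_bound_uminus mem_Collect_eq
  by (auto intro!: tendsto_minus)

lemma extension_uminus:
  assumes T: "T \<in> currents k"
  shows "extension k (- T) f \<pi> = - extension k T f \<pi>"
proof (cases "integrable (mass_measure k T) f \<and> \<pi> \<in> LIPs k")
  case True
  then have f: "integrable (mass_measure k T) f" and \<pi>: "\<pi> \<in> LIPs k" by auto
  note m = mass_bound_mass_measure[OF T]
  obtain g where g: "L1_lim (mass_measure k T) g f"
    using L1_lim_exists[OF finite_borel_mass_measure[OF T] f] by blast
  have "(\<lambda>n. (- T) (g n) \<pi>) \<longlonglongrightarrow> - L1_extension (mass_measure k T) T f \<pi>"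
    unfolding uminus_apply by (intro tendsto_minus L1_extension_tendsto[OF T m f \<pi> g])
  then have "L1_extension (mass_measure k T) (- T) f \<pi> = - L1_extension (mass_measure k T) T f \<pi>"
    by (intro L1_extension_eqI[OF currents_uminus[OF T] _ f \<pi> g]) (simp add: mass_bound_uminus m)
  then show ?thesis using True
    by (simp add: extension_eq[OF T] extension_eq[OF currents_uminus[OF T]] mass_measure_uminus)
next
  case False
  then show ?thesis
    by (auto simp: extension_eq[OF T] extension_eq[OF currents_uminus[OF T]] mass_measure_uminus)
qed

lemma current_restrict_uminus:
  "T \<in> currents k \<Longrightarrow> current_restrict k (- T) E f \<pi> = - current_restrict k T E f \<pi>"
  by (simp add: current_restrict_def extension_uminus)

lemma mass_bound_zero: "mass_bound k (0 :: 'a::metric_space functional) (null_measure borel)"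
  by (auto simp: mass_bound_def intro!: finite_measureI)

lemma zero_in_currents: "(0 :: 'a::metric_space functional) \<in> currents k"
  unfolding currents_def using mass_bound_zero[of k] by (auto simp: multilinear_on_def)

lemma mass_zero: "mass k (0 :: 'a::metric_space functional) = 0"
  by (rule antisym[OF _ mass_nonneg]) (use mass_le[OF zero_in_currents mass_bound_zero, of k] in simp)

lemma mass_eq_0_D:
  assumes T: "T \<in> currents k" and "mass k T = 0"
  shows "T = 0"
proof (intro HOL.ext)
  fix f \<pi>
  show "T f \<pi> = (0 :: 'a functional) f \<pi>"
  proof (cases "(f, \<pi>) \<in> Dk k")
    case True
    then have f: "f \<in> LIPb" and \<pi>: "\<pi> \<in> LIPs k" by (auto simp: Dk_def)
    obtain F where F: "\<And>x. \<bar>f x\<bar> \<le> F" using LIPb_bound[OF f] by metis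
    show ?thesis using current_abs_le[OF T f \<pi> F] assms(2) by simp
  next
    case False then show ?thesis using currents_outside[OF T] by simp
  qed
qed

lemma zero_current_eq: "zero_current = 0" by (intro HOL.ext) (simp add: zero_current_def)

text \<open>Reduces sums of two currents to series, so that closure and the triangle inequality are
  proved only once.\<close>

lemma add_as_series:
  "(R :: 'a functional) + S = series_current (\<lambda>n. if n = 0 then R else if n = 1 then S else 0)"
proof (intro HOL.ext)
  fix f :: "'a \<Rightarrow> real" and \<pi> :: "('a \<Rightarrow> real) list"
  have "(\<Sum>n. (if n = 0 then R else if n = 1 then S else 0) f \<pi>) = (\<Sum>n\<in>{0::nat, 1}. (if n = 0 then R else if n = 1 then S else 0) f \<pi>)"
    by (rule suminf_finite) auto
  then show "(R + S) f \<pi> = series_current (\<lambda>n. if n = 0 then R else if n = 1 then S else 0) f \<pi>"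
    by (simp add: series_current_def)
qed


subsection \<open>Rectifiability of series\<close>

lemma hausdorff_null_iff: "hausdorff_measure k A = 0 \<longleftrightarrow> (\<forall>\<delta>>0. hausdorff_delta k \<delta> A = 0)"
  by (auto simp: hausdorff_measure_def SUP_eq_iff bot_ennreal[symmetric] SUP_bot_conv)

text \<open>At a fixed scale \<open>\<delta>\<close>, cover \<open>A n\<close> with content below
  \<open>e * (1/2) ^ Suc n\<close> and merge the covers along \<open>prod_decode\<close>. Each
  covering set keeps its diameter bound, and the contents add up to at most
  \<open>e\<close>.\<close>

lemma hausdorff_null_subset_UN:
  fixes A :: "nat \<Rightarrow> 'a::metric_space set"
  assumes A: "\<And>n. hausdorff_measure k (A n) = 0" and B: "B \<subseteq> (\<Union>n. A n)"
  shows "hausdorff_measure k B = 0"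
  unfolding hausdorff_null_iff
proof (intro allI impI)
  fix \<delta> :: real assume \<delta>: "\<delta> > 0"
  define v where "v C = (if C = {} then 0 else ennreal (unit_ball_vol (real k) * (diameter C / 2) ^ k))" for C :: "'a set"
  define ok where "ok C \<longleftrightarrow> bounded C \<and> diameter C \<le> \<delta>" for C :: "'a set"
  have delta: "hausdorff_delta k \<delta> D = (INF C \<in> {C :: nat \<Rightarrow> 'a set. D \<subseteq> (\<Union>i. C i) \<and> (\<forall>i. ok (C i))}. \<Sum>i. v (C i))" for D
    unfolding hausdorff_delta_def v_def ok_def ..
  have "hausdorff_delta k \<delta> B \<le> ennreal e" if e: "e > 0" for e :: real
  proof -
    have "\<exists>C. A n \<subseteq> (\<Union>i. C i) \<and> (\<forall>i. ok (C i)) \<and> (\<Sum>i. v (C i)) < ennreal (e * (1/2) ^ Suc n)" for n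
    proof -
      have "hausdorff_delta k \<delta> (A n) < ennreal (e * (1/2) ^ Suc n)"
        using A[of n] \<delta> e by (simp add: hausdorff_null_iff)
      then show ?thesis unfolding delta by (auto simp: INF_less_iff)
    qed
    then obtain C where C: "\<And>n. A n \<subseteq> (\<Union>i. C n i)" "\<And>n i. ok (C n i)"
      "\<And>n. (\<Sum>i. v (C n i)) < ennreal (e * (1/2) ^ Suc n)" by metis
    define C' where "C' m = case_prod C (prod_decode m)" for m
    have "B \<subseteq> (\<Union>m. C' m)"
    proof
      fix x assume "x \<in> B"
      then obtain n i where "x \<in> C n i" using B C(1) by blast
      then have "x \<in> C' (prod_encode (n, i))" by (simp add: C'_def)
      then show "x \<in> (\<Union>m. C' m)" by blast
    qed
    moreover have "\<forall>m. ok (C' m)" using C(2) by (simp add: C'_def split: prod.split)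
    ultimately have "hausdorff_delta k \<delta> B \<le> (\<Sum>m. v (C' m))"
      unfolding delta by (intro INF_lower) simp
    also have "\<dots> = (\<Sum>m. (\<lambda>(n, i). v (C n i)) (prod_decode m))"
      by (simp add: C'_def case_prod_beta)
    also have "\<dots> = (\<Sum>n. \<Sum>i. v (C n i))" by (rule suminf_ennreal_2dimen) simp
    also have "\<dots> \<le> (\<Sum>n. ennreal (e * (1/2) ^ Suc n))"
      by (intro suminf_le) (use C(3) less_imp_le in auto)
    also have "\<dots> = ennreal e"
      using sums_mult[OF power_half_series, of e] e by (intro suminf_ennreal_eq) auto
    finally show ?thesis .
  qed
  then have *: "hausdorff_delta k \<delta> B \<le> 0 + ennreal e" if "e > 0" for e using that by simp
  have "hausdorff_delta k \<delta> B \<le> 0" by (rule ennreal_le_epsilon) (rule *)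
  then show "hausdorff_delta k \<delta> B = 0" by simp
qed

lemma countably_rectifiable_UN:
  fixes S :: "nat \<Rightarrow> 'a::metric_space set"
  assumes "\<And>n. countably_rectifiable TYPE('n::finite) (S n)"
  shows "countably_rectifiable TYPE('n) (\<Union>n. S n)"
proof -
  obtain A :: "nat \<Rightarrow> nat \<Rightarrow> (real ^ 'n) set" and g :: "nat \<Rightarrow> nat \<Rightarrow> real ^ 'n \<Rightarrow> 'a" where
    Ag: "\<And>n i. \<exists>L. L-lipschitz_on (A n i) (g n i)"
      "\<And>n. hausdorff_measure CARD('n) (S n - (\<Union>i. g n i ` A n i)) = 0"
    using assms unfolding countably_rectifiable_def by metis
  define A' where "A' m = case_prod A (prod_decode m)" for m
  define g' where "g' m = case_prod g (prod_decode m)" for m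
  have "\<exists>L. L-lipschitz_on (A' m) (g' m)" for m
    using Ag(1) by (simp add: A'_def g'_def split: prod.split)
  moreover have "(\<Union>n. S n) - (\<Union>m. g' m ` A' m) \<subseteq> (\<Union>n. S n - (\<Union>i. g n i ` A n i))"
  proof
    fix x assume x: "x \<in> (\<Union>n. S n) - (\<Union>m. g' m ` A' m)"
    then obtain n where n: "x \<in> S n" by blast
    have "x \<notin> g n i ` A n i" for i
    proof -
      have "x \<notin> g' (prod_encode (n, i)) ` A' (prod_encode (n, i))" using x by blast
      then show ?thesis by (simp add: A'_def g'_def)
    qed
    then show "x \<in> (\<Union>n. S n - (\<Union>i. g n i ` A n i))" using n by blast
  qed
  then have "hausdorff_measure CARD('n) ((\<Union>n. S n) - (\<Union>m. g' m ` A' m)) = 0"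
    by (rule hausdorff_null_subset_UN[OF Ag(2)])
  ultimately show ?thesis unfolding countably_rectifiable_def by blast
qed

lemma mass_measure_series_null:
  assumes S: "\<And>n. S n \<in> currents k" and sm: "summable (\<lambda>n. mass k (S n))"
    and B: "B \<in> sets borel" and z: "\<And>n. emeasure (mass_measure k (S n)) B = 0"
  shows "emeasure (mass_measure k (series_current S)) B = 0"
proof -
  have "emeasure (mass_measure k (series_current S)) B \<le> emeasure (series_measure (\<lambda>n. mass_measure k (S n))) B"
    by (rule mass_measure_le[OF series_in_currents[OF S sm] mass_bound_series[OF S sm] B])
  also have "\<dots> = 0"
    using finite_borel_mass_measure[OF S] by (subst emeasure_series_measure[OF _ B]) (auto simp: z)
  finally show ?thesis by simp
qed

text \<open>The mass measure of the limit is dominated by the series of the mass measures, so a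
  Borel set that is null for every term is null for the limit. Absolute continuity is immediate, and
  the union of the carriers of the terms carries the limit.\<close>

lemma rectifiable_series:
  fixes S :: "nat \<Rightarrow> 'a::metric_space functional"
  assumes S: "\<And>n. S n \<in> rectifiable_currents TYPE('n::finite)" and sm: "summable (\<lambda>n. mass CARD('n) (S n))"
  shows "series_current S \<in> rectifiable_currents TYPE('n)"
proof -
  have Sc: "S n \<in> currents CARD('n)" for n using S by (simp add: rectifiable_currents_def)
  obtain E where E: "\<And>n. countably_rectifiable TYPE('n) (E n)"
    "\<And>n. AE x in mass_measure CARD('n) (S n). x \<in> E n"
    using S unfolding rectifiable_currents_def mem_Collect_eq by metis
  \<comment> \<open>The carriers \<open>E n\<close> need not be Borel, so their complements are
    enclosed in Borel null sets. The intersection of these is null for every term and contains the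
    complement of the union of all \<open>E n\<close>.\<close>
  have "\<exists>N. N \<in> sets borel \<and> {x. x \<notin> E n} \<subseteq> N \<and> emeasure (mass_measure CARD('n) (S n)) N = 0" for n
    using E(2)[of n] finite_borel_mass_measure[OF Sc, of n] finite_borel_space[of "mass_measure CARD('n) (S n)"]
    by (elim AE_E) auto
  then obtain N where N: "\<And>n. N n \<in> sets borel" "\<And>n. {x. x \<notin> E n} \<subseteq> N n"
    "\<And>n. emeasure (mass_measure CARD('n) (S n)) (N n) = 0" by metis
  have NB: "(\<Inter>n. N n) \<in> sets borel" using N(1) by (intro sets.countable_INT) auto
  have "emeasure (mass_measure CARD('n) (S n)) (\<Inter>n. N n) = 0" for n
  proof -
    have "emeasure (mass_measure CARD('n) (S n)) (\<Inter>n. N n) \<le> emeasure (mass_measure CARD('n) (S n)) (N n)"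
      using N(1)[of n] finite_borel_mass_measure[OF Sc, of n] by (intro emeasure_mono) auto
    then show ?thesis using N(3)[of n] by simp
  qed
  then have "emeasure (mass_measure CARD('n) (series_current S)) (\<Inter>n. N n) = 0"
    by (rule mass_measure_series_null[OF Sc sm NB])
  then have "AE x in mass_measure CARD('n) (series_current S). x \<in> (\<Union>n. E n)"
    using N(2) NB finite_borel_mass_measure[OF series_in_currents[OF Sc sm]]
    by (intro AE_I[where N = "\<Inter>n. N n"]) auto
  moreover have "\<forall>B\<in>sets borel. hausdorff_measure CARD('n) B = 0 \<longrightarrow>
        emeasure (mass_measure CARD('n) (series_current S)) B = 0"
    using S mass_measure_series_null[OF Sc sm] unfolding rectifiable_currents_def by blast
  ultimately show ?thesis
    unfolding rectifiable_currents_def mem_Collect_eq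
    by (intro conjI exI[of _ "\<Union>n. E n"] series_in_currents[OF Sc sm] countably_rectifiable_UN[OF E(1)])
qed


subsection \<open>Jacobian determinants\<close>

text \<open>Where the derivative does not exist, \<open>deriv\<close> takes this fixed junk value.\<close>

definition deriv_junk :: real where "deriv_junk = (SOME D. False)"

text \<open>Without a derivative the choice in \<open>deriv\<close> is made from the empty
  predicate, hence is the same for all functions and points. Measurability and boundedness of
  \<open>partial_deriv\<close> can then be proved by cases at every point.\<close>

lemma deriv_not_exists: "(\<And>D. \<not> DERIV f x :> (D :: real)) \<Longrightarrow> deriv f x = deriv_junk"
  unfolding deriv_def deriv_junk_def by simp

section \<open>Differentiability at a point as a countable condition\<close>

context
  fixes h :: "real \<Rightarrow> real"
  assumes h: "continuous_on UNIV h"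
begin

definition quot :: "real \<Rightarrow> real" where "quot t = (h t - h 0) / t"

lemma isCont_quot: "t \<noteq> 0 \<Longrightarrow> isCont quot t"
proof -
  assume "t \<noteq> 0"
  moreover have "isCont h t" using h by (simp add: continuous_on_eq_continuous_at)
  ultimately show ?thesis unfolding quot_def[abs_def] by (intro continuous_intros)
qed

lemma DERIV_quot: "DERIV h 0 :> D \<longleftrightarrow> (quot \<longlongrightarrow> D) (at 0)"
  unfolding DERIV_def quot_def by simp

text \<open>The Cauchy criterion for the difference quotients, with rational increments and
  reciprocals of integers as tolerances. All quantifiers range over countable sets, so the criterion
  is measurable in a parameter.\<close>

definition quot_Cauchy :: bool where
  "quot_Cauchy \<longleftrightarrow> (\<forall>m::nat. \<exists>n::nat. \<forall>s t :: rat. s \<noteq> 0 \<longrightarrow> t \<noteq> 0 \<longrightarrow>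
     \<bar>of_rat s\<bar> < 1 / real (Suc n) \<longrightarrow> \<bar>of_rat t\<bar> < 1 / real (Suc n) \<longrightarrow>
     \<bar>quot (of_rat s) - quot (of_rat t)\<bar> \<le> 1 / real (Suc m))"

lemma quot_rat_approx:
  assumes "s \<noteq> 0" "\<bar>s\<bar> < d" "e > 0"
  obtains r :: rat where "r \<noteq> 0" "\<bar>of_rat r\<bar> < d" "\<bar>quot s - quot (of_rat r)\<bar> < e"
proof -
  obtain d' where d': "d' > 0" "\<And>x. \<bar>x - s\<bar> < d' \<Longrightarrow> \<bar>quot x - quot s\<bar> < e"
    using isCont_quot[OF assms(1)] assms(3) unfolding continuous_at_eps_delta dist_real_def by metis
  \<comment> \<open>The three bounds keep the rational within the continuity scale, away from 0, and
    inside the interval of radius \<open>d\<close>.\<close>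
  define c where "c = min d' (min \<bar>s\<bar> (d - \<bar>s\<bar>))"
  have c: "c > 0" using assms d' by (simp add: c_def)
  obtain r :: rat where r: "s < of_rat r" "of_rat r < s + c" using of_rat_dense[of s "s + c"] c by auto
  have "\<bar>of_rat r - s\<bar> < c" using r by simp
  then have "\<bar>of_rat r - s\<bar> < d'" "\<bar>of_rat r - s\<bar> < \<bar>s\<bar>" "\<bar>of_rat r - s\<bar> < d - \<bar>s\<bar>" by (auto simp: c_def)
  moreover from this have "(of_rat r :: real) \<noteq> 0" "\<bar>of_rat r :: real\<bar> < d" by linarith+
  ultimately show ?thesis using that[of r] d'(2)[of "of_rat r"] by (simp add: abs_minus_commute)
qed

text \<open>Continuity of \<open>quot\<close> off 0 transfers the criterion from rational to real
  increments. The sequence of reciprocals then has a limit by completeness, and the criterion makes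
  the whole quotient converge to it.\<close>

lemma quot_Cauchy_DERIV:
  assumes quot_Cauchy
  shows "DERIV h 0 :> lim (\<lambda>n. quot (1 / real (Suc n)))"
proof -
  have C: "\<exists>d>0. \<forall>s t. s \<noteq> 0 \<longrightarrow> t \<noteq> 0 \<longrightarrow> \<bar>s\<bar> < d \<longrightarrow> \<bar>t\<bar> < d \<longrightarrow> \<bar>quot s - quot t\<bar> < e" if e: "e > 0" for e
  proof -
    obtain m where m: "1 / real (Suc m) < e / 2" using nat_approx_posE[of "e / 2"] e by auto
    obtain n where n: "\<And>s t :: rat. s \<noteq> 0 \<Longrightarrow> t \<noteq> 0 \<Longrightarrow>
     \<bar>of_rat s\<bar> < 1 / real (Suc n) \<Longrightarrow> \<bar>of_rat t\<bar> < 1 / real (Suc n) \<Longrightarrow>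
     \<bar>quot (of_rat s) - quot (of_rat t)\<bar> \<le> 1 / real (Suc m)"
      using assms unfolding quot_Cauchy_def by meson
    have "\<bar>quot s - quot t\<bar> < e" if st: "s \<noteq> 0" "t \<noteq> 0" "\<bar>s\<bar> < 1 / real (Suc n)" "\<bar>t\<bar> < 1 / real (Suc n)" for s t
    proof -
      have e4: "e / 4 > 0" using e by simp
      obtain r :: rat where r: "r \<noteq> 0" "\<bar>of_rat r\<bar> < 1 / real (Suc n)" "\<bar>quot s - quot (of_rat r)\<bar> < e / 4"
        by (rule quot_rat_approx[OF st(1,3) e4])
      obtain q :: rat where q: "q \<noteq> 0" "\<bar>of_rat q\<bar> < 1 / real (Suc n)" "\<bar>quot t - quot (of_rat q)\<bar> < e / 4"
        by (rule quot_rat_approx[OF st(2,4) e4])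
      show ?thesis using n[OF r(1) q(1) r(2) q(2)] r(3) q(3) m by linarith
    qed
    then show ?thesis by (intro exI[of _ "1 / real (Suc n)"]) auto
  qed
  have small: "\<exists>N. \<forall>n\<ge>N. 1 / real (Suc n) < d" if "d > 0" for d
  proof -
    have "eventually (\<lambda>n. 1 / real (Suc n) < d) sequentially"
      using LIMSEQ_Suc[OF lim_1_over_n[where 'a = real]] that by (intro order_tendstoD) auto
    then show ?thesis by (simp add: eventually_sequentially)
  qed
  have "Cauchy (\<lambda>n. quot (1 / real (Suc n)))"
  proof (rule metric_CauchyI)
    fix e :: real assume "e > 0"
    then obtain d where d: "d > 0" "\<And>s t. s \<noteq> 0 \<Longrightarrow> t \<noteq> 0 \<Longrightarrow> \<bar>s\<bar> < d \<Longrightarrow> \<bar>t\<bar> < d \<Longrightarrow> \<bar>quot s - quot t\<bar> < e"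
      using C by meson
    obtain N where "\<And>n. n \<ge> N \<Longrightarrow> 1 / real (Suc n) < d" using small[OF d(1)] by blast
    then show "\<exists>M. \<forall>m\<ge>M. \<forall>n\<ge>M. dist (quot (1 / real (Suc m))) (quot (1 / real (Suc n))) < e"
      using d(2) by (intro exI[of _ N]) (simp add: dist_real_def)
  qed
  then have lim: "(\<lambda>n. quot (1 / real (Suc n))) \<longlonglongrightarrow> lim (\<lambda>n. quot (1 / real (Suc n)))" (is "_ \<longlonglongrightarrow> ?L")
    by (simp add: Cauchy_convergent convergent_LIMSEQ_iff[symmetric])
  have "(quot \<longlongrightarrow> ?L) (at 0)"
    unfolding LIM_eq
  proof (intro allI impI)
    fix e :: real assume e: "e > 0"
    then obtain d where d: "d > 0" "\<And>s t. s \<noteq> 0 \<Longrightarrow> t \<noteq> 0 \<Longrightarrow> \<bar>s\<bar> < d \<Longrightarrow> \<bar>t\<bar> < d \<Longrightarrow> \<bar>quot s - quot t\<bar> < e / 2"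
      using C[of "e / 2"] by (metis half_gt_zero)
    obtain N where N: "\<And>n. n \<ge> N \<Longrightarrow> 1 / real (Suc n) < d" using small[OF d(1)] by blast
    have "norm (quot x - ?L) < e" if x: "x \<noteq> 0 \<and> norm (x - 0) < d" for x
    proof -
      have "(\<lambda>n. \<bar>quot x - quot (1 / real (Suc n))\<bar>) \<longlonglongrightarrow> \<bar>quot x - ?L\<bar>"
        by (intro tendsto_intros lim)
      moreover have "\<exists>N. \<forall>n\<ge>N. \<bar>quot x - quot (1 / real (Suc n))\<bar> \<le> e / 2"
        using d(2)[of x] N x by (intro exI[of _ N]) (auto intro!: less_imp_le)
      ultimately have "\<bar>quot x - ?L\<bar> \<le> e / 2" by (rule LIMSEQ_le_const2)
      then show ?thesis using e by simp
    qed
    then show "\<exists>s>0. \<forall>x. x \<noteq> 0 \<and> norm (x - 0) < s \<longrightarrow> norm (quot x - ?L) < e" using d(1) by blast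
  qed
  then show ?thesis by (simp add: DERIV_quot)
qed

lemma DERIV_quot_Cauchy:
  assumes "DERIV h 0 :> D"
  shows quot_Cauchy
  unfolding quot_Cauchy_def
proof
  fix m :: nat
  have "1 / real (Suc m) / 2 > 0" by simp
  then obtain d where d: "d > 0" "\<And>x. x \<noteq> 0 \<Longrightarrow> \<bar>x\<bar> < d \<Longrightarrow> \<bar>quot x - D\<bar> < 1 / real (Suc m) / 2"
    using assms unfolding DERIV_quot LIM_eq by (metis diff_zero real_norm_def)
  obtain n where n: "1 / real (Suc n) < d" using nat_approx_posE[OF d(1)] by blast
  have "\<bar>quot (of_rat s) - quot (of_rat t)\<bar> \<le> 1 / real (Suc m)"
    if "s \<noteq> 0" "t \<noteq> 0" "\<bar>of_rat s\<bar> < 1 / real (Suc n)" "\<bar>of_rat t\<bar> < 1 / real (Suc n)" for s t :: rat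
  proof -
    have "\<bar>of_rat s\<bar> < d" "\<bar>of_rat t\<bar> < d" using that(3,4) n by linarith+
    then have "\<bar>quot (of_rat s) - D\<bar> < 1 / real (Suc m) / 2" "\<bar>quot (of_rat t) - D\<bar> < 1 / real (Suc m) / 2"
      using d(2) that(1,2) by auto
    moreover define c where "c = 1 / real (Suc m) / 2"
    ultimately have "\<bar>quot (of_rat s) - quot (of_rat t)\<bar> \<le> c + c" by linarith
    then show ?thesis unfolding c_def field_sum_of_halves .
  qed
  then show "\<exists>n. \<forall>s t :: rat. s \<noteq> 0 \<longrightarrow> t \<noteq> 0 \<longrightarrow>
     \<bar>of_rat s\<bar> < 1 / real (Suc n) \<longrightarrow> \<bar>of_rat t\<bar> < 1 / real (Suc n) \<longrightarrow>
     \<bar>quot (of_rat s) - quot (of_rat t)\<bar> \<le> 1 / real (Suc m)" by blast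
qed

text \<open>Expresses \<open>deriv\<close>, including its default value, by a countable condition
  and a sequential limit. In this form its measurability in a parameter is visible.\<close>

lemma deriv_eq_lim_quot:
  "deriv h 0 = (if quot_Cauchy then lim (\<lambda>n. quot (1 / real (Suc n))) else deriv_junk)"
proof (cases quot_Cauchy)
  case True
  then show ?thesis using DERIV_imp_deriv[OF quot_Cauchy_DERIV] by simp
next
  case False
  then have "deriv h 0 = deriv_junk" by (intro deriv_not_exists) (use DERIV_quot_Cauchy in blast)
  with False show ?thesis by simp
qed

end

lemma measurable_deriv_param:
  fixes h :: "'b \<Rightarrow> real \<Rightarrow> real"
  assumes c: "\<And>x. continuous_on UNIV (h x)" and [measurable]: "\<And>t. (\<lambda>x. h x t) \<in> borel_measurable M"
  shows "(\<lambda>x. deriv (h x) 0) \<in> borel_measurable M"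
proof -
  have [measurable]: "(\<lambda>x. quot (h x) t) \<in> borel_measurable M" for t
    unfolding quot_def[OF c] by measurable
  have [measurable]: "Measurable.pred M (\<lambda>x. quot_Cauchy (h x))"
    unfolding quot_Cauchy_def[OF c] by measurable
  show ?thesis unfolding deriv_eq_lim_quot[OF c] by measurable
qed

section \<open>Measurability, bounds and evaluation of Jacobian determinants\<close>

lemma partial_deriv_measurable:
  fixes p :: "real ^ 'n::finite \<Rightarrow> real"
  assumes "p \<in> LIP"
  shows "partial_deriv j p \<in> borel_measurable borel"
  unfolding partial_deriv_def
proof (rule measurable_deriv_param)
  have c: "continuous_on A p" for A using LIP_continuous_on[OF assms] .
  show "continuous_on UNIV (\<lambda>t. p (x + t *\<^sub>R axis j 1))" for x
    by (intro continuous_on_compose2[OF c[of UNIV]] continuous_intros) auto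
  show "(\<lambda>x. p (x + t *\<^sub>R axis j 1)) \<in> borel_measurable borel" for t
    by (intro borel_measurable_continuous_onI continuous_on_compose2[OF c[of UNIV]] continuous_intros) auto
qed

lemma partial_deriv_bounded:
  fixes p :: "real ^ 'n::finite \<Rightarrow> real"
  assumes "p \<in> LIP"
  shows "\<bar>partial_deriv j p x\<bar> \<le> max (Lip p) \<bar>deriv_junk\<bar>"
proof (cases "\<exists>D. DERIV (\<lambda>t. p (x + t *\<^sub>R axis j 1)) 0 :> D")
  case True
  then obtain D where D: "DERIV (\<lambda>t. p (x + t *\<^sub>R axis j 1)) 0 :> D" by blast
  then have "((\<lambda>t. \<bar>(p (x + t *\<^sub>R axis j 1) - p x) / t\<bar>) \<longlongrightarrow> \<bar>D\<bar>) (at 0)"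
    unfolding DERIV_def by (intro tendsto_rabs) simp
  moreover have "eventually (\<lambda>t. \<bar>(p (x + t *\<^sub>R axis j 1) - p x) / t\<bar> \<le> Lip p) (at 0)"
  proof (rule eventually_at[THEN iffD2], intro exI[of _ 1] conjI ballI impI)
    fix t :: real assume "t \<noteq> 0 \<and> dist t 0 < 1"
    then show "\<bar>(p (x + t *\<^sub>R axis j 1) - p x) / t\<bar> \<le> Lip p"
      using Lip_bound_real[OF assms, of "x + t *\<^sub>R axis j 1" x]
      by (simp add: dist_norm abs_divide divide_le_eq)
  qed simp
  ultimately have "\<bar>D\<bar> \<le> Lip p" by (intro tendsto_upperbound) auto
  then show ?thesis unfolding partial_deriv_def using DERIV_imp_deriv[OF D] by simp
next
  case False
  then have "partial_deriv j p x = deriv_junk" unfolding partial_deriv_def by (intro deriv_not_exists) auto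
  then show ?thesis by simp
qed

lemma jacobian_det_expand:
  "jacobian_det \<pi> x = (\<Sum>\<sigma> | \<sigma> permutes (UNIV :: 'n::finite set). of_int (sign \<sigma>) *
     (\<Prod>i\<in>UNIV. partial_deriv (\<sigma> i) (\<pi> ! to_nat_on (UNIV :: 'n set) i) x))"
  unfolding jacobian_det_def det_def by simp

lemma to_nat_on_less_CARD: "to_nat_on (UNIV :: 'n::finite set) i < CARD('n)"
  using to_nat_on_finite[of "UNIV :: 'n set"] by (auto simp: bij_betw_def)

lemma jacobian_det_measurable:
  assumes "\<pi> \<in> LIPs CARD('n)"
  shows "(jacobian_det \<pi> :: real ^ 'n::finite \<Rightarrow> real) \<in> borel_measurable borel"
proof -
  have "(\<lambda>x. partial_deriv j (\<pi> ! to_nat_on (UNIV :: 'n set) i) x) \<in> borel_measurable borel" for i j :: 'n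
    using partial_deriv_measurable[OF LIPs_nth[OF assms to_nat_on_less_CARD]] .
  then show ?thesis unfolding jacobian_det_expand
    by (intro borel_measurable_sum borel_measurable_times borel_measurable_const borel_measurable_prod)
qed

lemma jacobian_det_bounded:
  assumes "\<pi> \<in> LIPs CARD('n)"
  obtains B where "0 \<le> B" "\<And>x :: real ^ 'n::finite. \<bar>jacobian_det \<pi> x\<bar> \<le> B"
proof -
  define b where "b i = max (Lip (\<pi> ! to_nat_on (UNIV :: 'n set) i)) \<bar>deriv_junk\<bar>" for i
  have "\<bar>jacobian_det \<pi> x\<bar> \<le> (\<Sum>\<sigma> | \<sigma> permutes (UNIV :: 'n set). \<Prod>i\<in>UNIV. b i)" for x :: "real ^ 'n"
    unfolding jacobian_det_expand
  proof (rule order_trans[OF sum_abs], rule sum_mono)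
    fix \<sigma> :: "'n \<Rightarrow> 'n"
    have "\<bar>of_int (sign \<sigma>) :: real\<bar> = 1" by (simp add: sign_def)
    then have "\<bar>of_int (sign \<sigma>) * (\<Prod>i\<in>UNIV. partial_deriv (\<sigma> i) (\<pi> ! to_nat_on (UNIV :: 'n set) i) x)\<bar>
      = (\<Prod>i\<in>UNIV. \<bar>partial_deriv (\<sigma> i) (\<pi> ! to_nat_on (UNIV :: 'n set) i) x\<bar>)"
      by (simp add: abs_mult abs_prod)
    also have "\<dots> \<le> (\<Prod>i\<in>UNIV. b i)"
      unfolding b_def by (intro prod_mono conjI abs_ge_zero partial_deriv_bounded LIPs_nth[OF assms to_nat_on_less_CARD])
    finally show "\<bar>of_int (sign \<sigma>) * (\<Prod>i\<in>UNIV. partial_deriv (\<sigma> i) (\<pi> ! to_nat_on (UNIV :: 'n set) i) x)\<bar>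
      \<le> (\<Prod>i\<in>UNIV. b i)" .
  qed
  moreover from this[of 0] have "0 \<le> (\<Sum>\<sigma> | \<sigma> permutes (UNIV :: 'n set). \<Prod>i\<in>UNIV. b i)" by linarith
  ultimately show ?thesis using that by blast
qed

text \<open>Inverse to the enumeration of coordinates in \<open>jacobian_det\<close>.\<close>

definition coord_list :: "('n::finite \<Rightarrow> 'b) \<Rightarrow> 'b list" where
  "coord_list p = map (\<lambda>m. p (from_nat_into UNIV m)) [0..<CARD('n)]"

lemma length_coord_list: "length (coord_list (p :: 'n::finite \<Rightarrow> 'b)) = CARD('n)"
  by (simp add: coord_list_def)

lemma coord_list_nth: "coord_list p ! to_nat_on (UNIV :: 'n::finite set) i = p i"
  using to_nat_on_less_CARD[of i] by (simp add: coord_list_def)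

lemma map_coord_list: "map f (coord_list p) = coord_list (\<lambda>i. f (p i))"
  by (simp add: coord_list_def)

lemma coord_list_LIPs: "(\<And>i. p i \<in> LIP) \<Longrightarrow> coord_list (p :: 'n::finite \<Rightarrow> _) \<in> LIPs CARD('n)"
  by (auto simp: LIPs_def coord_list_def)

lemma coord_list_of_nth:
  assumes "\<pi> \<in> LIPs CARD('n::finite)"
  shows "coord_list (\<lambda>i :: 'n. \<pi> ! to_nat_on UNIV i) = \<pi>"
proof (rule nth_equalityI)
  show "length (coord_list (\<lambda>i :: 'n. \<pi> ! to_nat_on UNIV i)) = length \<pi>"
    using assms by (simp add: length_coord_list LIPs_def)
  fix m assume "m < length (coord_list (\<lambda>i :: 'n. \<pi> ! to_nat_on UNIV i))"
  then have m: "m < CARD('n)" by (simp add: length_coord_list)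
  then have "m \<in> to_nat_on (UNIV :: 'n set) ` UNIV"
    using to_nat_on_finite[of "UNIV :: 'n set"] by (auto simp: bij_betw_def)
  then show "coord_list (\<lambda>i :: 'n. \<pi> ! to_nat_on UNIV i) ! m = \<pi> ! m"
    using m by (simp add: coord_list_def)
qed

lemma prod_Lip_coord_list_le:
  fixes p :: "'n::finite \<Rightarrow> 'a::metric_space \<Rightarrow> real"
  assumes "\<And>i. p i \<in> LIP" "\<And>i. Lip (p i) \<le> L"
  shows "(\<Prod>q\<leftarrow>coord_list p. Lip q) \<le> L ^ CARD('n)"
proof -
  have "(\<Prod>q\<leftarrow>coord_list p. Lip q) \<le> (\<Prod>i<CARD('n). L)"
    by (rule prod_list_le_prod[OF coord_list_LIPs[of p, OF assms(1)]]) (use assms in \<open>simp add: coord_list_def\<close>)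
  then show ?thesis by simp
qed

lemma LIP_vec_nth: "(\<lambda>x :: real ^ 'n::finite. x $ i) \<in> LIP"
  by (rule LIP_realI[of _ 1]) (metis component_le_norm_cart dist_norm mult_1 vector_minus_component)

lemma Lip_vec_nth_comp:
  fixes \<phi> :: "'a::metric_space \<Rightarrow> real ^ 'n::finite"
  assumes "\<phi> \<in> LIP"
  shows "(\<lambda>x. \<phi> x $ i) \<in> LIP" "Lip (\<lambda>x. \<phi> x $ i) \<le> Lip \<phi>"
proof -
  show "(\<lambda>x. \<phi> x $ i) \<in> LIP" by (rule LIP_comp[OF LIP_vec_nth assms])
  have "\<bar>\<phi> x $ i - \<phi> y $ i\<bar> \<le> Lip \<phi> * dist x y" for x y
    using component_le_norm_cart[of "\<phi> x - \<phi> y" i] Lip_bound[OF assms, of x y] by (simp add: dist_norm)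
  then show "Lip (\<lambda>x. \<phi> x $ i) \<le> Lip \<phi>" by (rule Lip_le_real) (rule Lip_nonneg[OF assms])
qed

lemma partial_deriv_vec_nth: "partial_deriv j (\<lambda>x. x $ i) x = (if i = j then 1 else 0)"
  unfolding partial_deriv_def
  by (rule DERIV_imp_deriv) (auto simp: axis_def intro!: derivative_eq_intros)

text \<open>By Cramer's rule the identity matrix with row \<open>j\<close> replaced by the gradient
  of \<open>\<psi>\<close> has determinant equal to entry \<open>j\<close> of that gradient;
  permuting rows contributes the sign. The permutation is there to move \<open>\<psi>\<close> to the
  first slot, the one on which the boundary acts.\<close>

lemma jacobian_det_coord_list:
  fixes \<tau> :: "'n::finite \<Rightarrow> 'n"
  assumes "\<tau> permutes UNIV"
  shows "jacobian_det (coord_list (\<lambda>i. if \<tau> i = j then \<psi> else (\<lambda>x. x $ \<tau> i))) x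
    = of_int (sign \<tau>) * partial_deriv j \<psi> x"
proof -
  define v :: "real ^ 'n" where "v = (\<chi> l. partial_deriv l \<psi> x)"
  define A :: "real ^ 'n ^ 'n" where "A = (\<chi> i. if i = j then v else axis i 1)"
  have row: "row i (mat 1 :: real ^ 'n ^ 'n) = axis i 1" for i
    by (simp add: row_def mat_def axis_def vec_eq_iff)
  have "det A = v $ j"
    using cramer_lemma_transpose[of j v "mat 1"] unfolding row basis_expansion A_def by simp
  have "jacobian_det (coord_list (\<lambda>i. if \<tau> i = j then \<psi> else (\<lambda>x. x $ \<tau> i))) x = det (\<chi> i. A $ \<tau> i)"
    unfolding jacobian_det_def coord_list_nth
    by (rule arg_cong[where f = det]) (auto simp: vec_eq_iff A_def v_def partial_deriv_vec_nth axis_def)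
  also have "\<dots> = of_int (sign \<tau>) * det A" by (rule det_permute_rows[OF assms])
  finally show ?thesis using \<open>det A = v $ j\<close> by (simp add: v_def)
qed

lemma jacobian_det_coords: "jacobian_det (coord_list (\<lambda>i x. x $ i)) (x :: real ^ 'n::finite) = 1"
proof -
  \<comment> \<open>A coordinate function in the role of \<open>\<psi>\<close> leaves the coordinate
    list unchanged; below, \<open>undefined\<close> stands for an arbitrary index.\<close>
  have "(\<lambda>i :: 'n. if id i = j then \<lambda>x. x $ j else (\<lambda>x :: real ^ 'n. x $ id i)) = (\<lambda>i x. x $ i)" for j
    by (auto simp: fun_eq_iff)
  then show ?thesis
    using jacobian_det_coord_list[OF permutes_id, of undefined "\<lambda>x. x $ undefined" x]
    by (simp add: sign_id partial_deriv_vec_nth)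
qed


subsection \<open>Integer densities\<close>

text \<open>A reformulation of integer densities with a Borel real function and
  \<open>lborel\<close> in place of an integer function and the completed measure. In this form
  shifts, Fubini and duality apply directly.\<close>

definition int_density :: "(real ^ 'n::finite) functional \<Rightarrow> (real ^ 'n \<Rightarrow> real) \<Rightarrow> bool" where
  "int_density A u \<longleftrightarrow> u \<in> borel_measurable borel \<and> (\<forall>x. u x \<in> \<int>) \<and> integrable lborel u \<and>
     (\<forall>(f, \<pi>) \<in> Dk CARD('n). A f \<pi> = (LINT x|lborel. u x * f x * jacobian_det \<pi> x))"

lemma int_density_integrand_measurable:
  assumes "u \<in> borel_measurable borel" "(f, \<pi>) \<in> Dk CARD('n)"
  shows "(\<lambda>x :: real ^ 'n::finite. u x * f x * jacobian_det \<pi> x) \<in> borel_measurable borel"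
  using assms jacobian_det_measurable[of \<pi>] LIP_measurable[OF LIPb_LIP, of f borel]
  by (auto simp: Dk_def)

lemma int_densityD:
  "int_density A u \<Longrightarrow> (f, \<pi>) \<in> Dk CARD('n) \<Longrightarrow>
    A f \<pi> = (LINT x|lborel. u x * f x * jacobian_det \<pi> (x :: real ^ 'n::finite))"
  unfolding int_density_def by auto

text \<open>A Lebesgue measurable density agrees almost everywhere with a Borel function; taking its
  floor makes it integer valued everywhere without changing it where it agrees with
  \<open>\<theta>\<close>. Bounded Borel factors then give the same integrals for both
  measures.\<close>

lemma int_density_iff:
  fixes A :: "(real ^ 'n::finite) functional"
  shows "(\<exists>\<theta> :: real ^ 'n \<Rightarrow> int. integrable lebesgue (\<lambda>x. real_of_int (\<theta> x)) \<and>
          (\<forall>(f, \<pi>) \<in> Dk CARD('n). A f \<pi> = (LINT x|lebesgue. real_of_int (\<theta> x) * f x * jacobian_det \<pi> x)))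
      \<longleftrightarrow> (\<exists>u. int_density A u)" (is "?L \<longleftrightarrow> ?R")
proof
  assume ?L
  then obtain \<theta> :: "real ^ 'n \<Rightarrow> int" where \<theta>: "integrable lebesgue (\<lambda>x. real_of_int (\<theta> x))"
    "\<And>f \<pi>. (f, \<pi>) \<in> Dk CARD('n) \<Longrightarrow> A f \<pi> = (LINT x|lebesgue. real_of_int (\<theta> x) * f x * jacobian_det \<pi> x)"
    by blast
  obtain u0 where u0: "u0 \<in> borel_measurable lborel" "AE x in lborel. real_of_int (\<theta> x) = u0 x"
    using completion_ex_borel_measurable_real[OF borel_measurable_integrable[OF \<theta>(1)]] by blast
  define u where "u x = real_of_int \<lfloor>u0 x\<rfloor>" for x
  have uB: "u \<in> borel_measurable lborel" unfolding u_def using u0 by measurable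
  have ae: "AE x in lebesgue. real_of_int (\<theta> x) = u x"
  proof (rule AE_completion)
    show "AE x in lborel. real_of_int (\<theta> x) = u x"
      using u0(2) by eventually_elim (metis floor_of_int u_def)
  qed
  have "integrable lebesgue u"
    by (rule integrable_cong_AE_imp[OF \<theta>(1)]) (use uB ae in \<open>auto intro: measurable_completion\<close>)
  then have "integrable lborel u" using integrable_completion[OF uB] by simp
  moreover have "A f \<pi> = (LINT x|lborel. u x * f x * jacobian_det \<pi> x)" if "(f, \<pi>) \<in> Dk CARD('n)" for f \<pi>
  proof -
    have m: "(\<lambda>x. u x * f x * jacobian_det \<pi> x) \<in> borel_measurable lborel"
      using int_density_integrand_measurable[OF _ that, of u] uB by simp
    have m2: "(\<lambda>x. f x * jacobian_det \<pi> x) \<in> borel_measurable lebesgue"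
      using int_density_integrand_measurable[OF _ that, of "\<lambda>_. 1"] by (simp add: measurable_completion)
    have "A f \<pi> = (LINT x|lebesgue. real_of_int (\<theta> x) * f x * jacobian_det \<pi> x)" by (rule \<theta>(2)[OF that])
    also have "\<dots> = (LINT x|lebesgue. u x * f x * jacobian_det \<pi> x)"
    proof (rule integral_cong_AE)
      show "(\<lambda>x. real_of_int (\<theta> x) * f x * jacobian_det \<pi> x) \<in> borel_measurable lebesgue"
        using borel_measurable_times[OF borel_measurable_integrable[OF \<theta>(1)] m2] by (simp add: mult.assoc)
      show "(\<lambda>x. u x * f x * jacobian_det \<pi> x) \<in> borel_measurable lebesgue"
        using m by (rule measurable_completion)
      show "AE x in lebesgue. real_of_int (\<theta> x) * f x * jacobian_det \<pi> x = u x * f x * jacobian_det \<pi> x"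
        using ae by eventually_elim simp
    qed
    also have "\<dots> = (LINT x|lborel. u x * f x * jacobian_det \<pi> x)" by (rule integral_completion[OF m])
    finally show ?thesis .
  qed
  ultimately have "int_density A u" unfolding int_density_def using uB by (auto simp: u_def)
  then show ?R by blast
next
  assume ?R
  then obtain u where u: "u \<in> borel_measurable borel" "\<And>x. u x \<in> \<int>" "integrable lborel u"
     "\<And>f \<pi>. (f, \<pi>) \<in> Dk CARD('n) \<Longrightarrow> A f \<pi> = (LINT x|lborel. u x * f x * jacobian_det \<pi> x)"
    unfolding int_density_def by blast
  define \<theta> where "\<theta> x = \<lfloor>u x\<rfloor>" for x
  have \<theta>: "real_of_int (\<theta> x) = u x" for x using u(2)[of x] by (auto simp: \<theta>_def elim: Ints_cases)
  have "integrable lebesgue (\<lambda>x. real_of_int (\<theta> x))"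
    unfolding \<theta> using integrable_completion[of u lborel] u(1,3) by simp
  moreover have "A f \<pi> = (LINT x|lebesgue. real_of_int (\<theta> x) * f x * jacobian_det \<pi> x)"
    if "(f, \<pi>) \<in> Dk CARD('n)" for f \<pi>
    unfolding u(4)[OF that] \<theta>
    by (rule integral_completion[symmetric]) (use int_density_integrand_measurable[OF u(1) that] in simp)
  ultimately show ?L by blast
qed

lemma integer_rectifiable_iff:
  "T \<in> integer_rectifiable_currents TYPE('n::finite) \<longleftrightarrow> T \<in> rectifiable_currents TYPE('n) \<and>
     (\<forall>\<phi> :: 'a::metric_space \<Rightarrow> real ^ 'n. \<forall>\<Omega>. \<phi> \<in> LIP \<and> open \<Omega> \<longrightarrow>
       (\<exists>u. int_density (pushforward CARD('n) \<phi> (current_restrict CARD('n) T \<Omega>)) u))"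
  unfolding integer_rectifiable_currents_def int_density_iff[symmetric] by blast

text \<open>Bounded Lipschitz functions are dense in L1 of the measure with density
  \<open>\<bar>u\<bar>\<close>, so they approximate \<open>sgn (u x)\<close> there, and testing
  \<open>u\<close> against the approximations recovers its norm in the limit.\<close>

lemma L1_norm_dual_le:
  fixes u :: "'b::euclidean_space \<Rightarrow> real"
  assumes u: "integrable lborel u"
    and le: "\<And>f. f \<in> LIPb \<Longrightarrow> (\<And>x. \<bar>f x\<bar> \<le> 1) \<Longrightarrow> \<bar>LINT x|lborel. u x * f x\<bar> \<le> K"
  shows "(LINT x|lborel. \<bar>u x\<bar>) \<le> K"
proof -
  have uB [measurable]: "u \<in> borel_measurable borel" using borel_measurable_integrable[OF u] by simp
  define \<mu> where "\<mu> = density lborel (\<lambda>x. ennreal \<bar>u x\<bar>)"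
  have "emeasure \<mu> UNIV = (\<integral>\<^sup>+x. ennreal \<bar>u x\<bar> \<partial>lborel)"
    unfolding \<mu>_def by (subst emeasure_density) auto
  also have "\<dots> < \<infinity>" using u unfolding integrable_iff_bounded by simp
  finally have fb: "finite_borel \<mu>" by (intro finite_borelI) (auto simp: \<mu>_def)
  have "integrable \<mu> (\<lambda>x. sgn (u x))" by (rule bounded_integrable[OF fb, of _ 1]) (auto simp: sgn_if)
  then obtain g where g: "L1_lim \<mu> g (\<lambda>x. sgn (u x))" using L1_lim_exists[OF fb] by blast
  \<comment> \<open>Clipping to [-1, 1] makes the approximations admissible as test functions and
    moves them no further from \<open>sgn (u x)\<close>.\<close>
  define h where "h n x = max (-1) (min 1 (g n x))" for n x
  have gL: "g n \<in> LIPb" for n using g by (simp add: L1_lim_def)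
  have hL: "h n \<in> LIPb" for n
    unfolding h_def by (rule LIPbI[of _ 1]) (auto intro!: LIP_max LIP_min LIP_const LIPb_LIP[OF gL])
  have h1: "\<bar>h n x\<bar> \<le> 1" for n x by (auto simp: h_def)
  have hB [measurable]: "h n \<in> borel_measurable borel" for n using LIP_measurable[OF LIPb_LIP[OF hL]] by simp
  have gi: "integrable \<mu> (g n)" for n by (rule LIPb_integrable[OF gL fb])
  have hi: "integrable \<mu> (h n)" for n by (rule LIPb_integrable[OF hL fb])
  have uh: "integrable lborel (\<lambda>x. u x * h n x)" for n
    by (rule Bochner_Integration.integrable_bound[OF u])
      (auto simp: abs_mult intro!: mult_left_le h1)
  have le2: "(LINT x|lborel. \<bar>u x\<bar>) \<le> K + (LINT x|\<mu>. \<bar>g n x - sgn (u x)\<bar>)" for n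
  proof -
    have "(LINT x|lborel. \<bar>u x\<bar>) = (LINT x|lborel. u x * h n x) + (LINT x|lborel. \<bar>u x\<bar> - u x * h n x)"
      using u uh by simp
    also have "(LINT x|lborel. u x * h n x) \<le> K" using le[OF hL h1] by (simp add: abs_le_iff)
    also have "(LINT x|lborel. \<bar>u x\<bar> - u x * h n x) \<le> (LINT x|lborel. \<bar>u x\<bar> * \<bar>h n x - sgn (u x)\<bar>)"
    proof (rule integral_mono)
      have bd: "norm (\<bar>u x\<bar> * \<bar>h n x - sgn (u x)\<bar>) \<le> norm (2 * u x)" for x
      proof -
        have "\<bar>h n x - sgn (u x)\<bar> \<le> 2" using h1[of n x] by (auto simp: sgn_if)
        then show ?thesis using mult_left_mono[of "\<bar>h n x - sgn (u x)\<bar>" 2 "\<bar>u x\<bar>"] by (simp add: abs_mult)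
      qed
      show "integrable lborel (\<lambda>x. \<bar>u x\<bar> * \<bar>h n x - sgn (u x)\<bar>)"
        by (rule Bochner_Integration.integrable_bound[OF integrable_mult_right[OF u, of 2]])
          (measurable, intro AE_I2 bd)
      show "\<bar>u x\<bar> - u x * h n x \<le> \<bar>u x\<bar> * \<bar>h n x - sgn (u x)\<bar>" for x
        using h1[of n x] by (auto simp: sgn_if abs_if algebra_simps)
    qed (use u uh in auto)
    also have "(LINT x|lborel. \<bar>u x\<bar> * \<bar>h n x - sgn (u x)\<bar>) = (LINT x|\<mu>. \<bar>h n x - sgn (u x)\<bar>)"
      unfolding \<mu>_def by (subst integral_density) auto
    also have "\<dots> \<le> (LINT x|\<mu>. \<bar>g n x - sgn (u x)\<bar>)"
    proof (rule integral_mono)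
      show "\<bar>h n x - sgn (u x)\<bar> \<le> \<bar>g n x - sgn (u x)\<bar>" for x by (auto simp: h_def sgn_if)
    qed (use gi hi \<open>integrable \<mu> (\<lambda>x. sgn (u x))\<close> in auto)
    finally show ?thesis by simp
  qed
  have "(\<lambda>n. K + (LINT x|\<mu>. \<bar>g n x - sgn (u x)\<bar>)) \<longlonglongrightarrow> K + 0"
    using g unfolding L1_lim_def by (intro tendsto_intros) auto
  then have "(LINT x|lborel. \<bar>u x\<bar>) \<le> K + 0"
    by (rule LIMSEQ_le_const) (use le2 in blast)
  then show ?thesis by simp
qed

section \<open>Bounds for integer densities and their series\<close>

lemma current_restrict_abs_le:
  assumes "T \<in> currents k" "f \<in> LIPb" "\<pi> \<in> LIPs k" "E \<in> sets borel" "\<And>x. \<bar>f x\<bar> \<le> F"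
  shows "\<bar>current_restrict k T E f \<pi>\<bar> \<le> (\<Prod>p\<leftarrow>\<pi>. Lip p) * (F * mass k T)"
proof -
  let ?g = "\<lambda>x. indicator E x * f x"
  have gB: "?g \<in> borel_measurable borel"
    using assms(4) LIP_measurable[OF LIPb_LIP[OF assms(2)], of borel] by simp
  have "0 \<le> F" using order_trans[OF abs_ge_zero assms(5)] .
  then have gF: "\<bar>?g x\<bar> \<le> F" for x using assms(5)[of x] by (auto simp: indicator_def)
  have "\<bar>extension k T ?g \<pi>\<bar> \<le> (\<Prod>p\<leftarrow>\<pi>. Lip p) * (LINT x|mass_measure k T. \<bar>?g x\<bar>)"
    by (rule extension_bound[OF assms(1) mass_bound_mass_measure[OF assms(1)] gB gF assms(3)])
  also have "\<dots> \<le> (\<Prod>p\<leftarrow>\<pi>. Lip p) * (F * mass k T)"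
    unfolding mass_def
    by (intro mult_left_mono abs_integral_le_bound gB gF finite_borel_mass_measure[OF assms(1)] prod_Lip_nonneg[OF assms(3)])
  finally show ?thesis using assms by (simp add: current_restrict_def Dk_def)
qed

text \<open>With the coordinates as remaining arguments the Jacobian is 1, so the integral of
  \<open>u x * f x\<close> is a value of the pushed-forward current, bounded by mass; duality turns
  this into a bound on the norm.\<close>

lemma int_density_L1_le:
  fixes T :: "'a::metric_space functional" and \<phi> :: "'a \<Rightarrow> real ^ 'n::finite"
  assumes T: "T \<in> currents CARD('n)" and \<phi>: "\<phi> \<in> LIP" and \<Omega>: "open \<Omega>"
    and u: "int_density (pushforward CARD('n) \<phi> (current_restrict CARD('n) T \<Omega>)) u"
  shows "(LINT x|lborel. \<bar>u x\<bar>) \<le> Lip \<phi> ^ CARD('n) * mass CARD('n) T"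
proof (rule L1_norm_dual_le)
  show "integrable lborel u" using u by (simp add: int_density_def)
  fix f :: "real ^ 'n \<Rightarrow> real" assume f: "f \<in> LIPb" "\<And>x. \<bar>f x\<bar> \<le> 1"
  let ?c = "coord_list (\<lambda>i (x :: real ^ 'n). x $ i)"
  have c: "?c \<in> LIPs CARD('n)" by (rule coord_list_LIPs[OF LIP_vec_nth])
  have fc: "(f, ?c) \<in> Dk CARD('n)" using f c by (simp add: Dk_def)
  have l: "coord_list (\<lambda>i x. \<phi> x $ i) \<in> LIPs CARD('n)" by (rule coord_list_LIPs[OF Lip_vec_nth_comp(1)[OF \<phi>]])
  have "(LINT x|lborel. u x * f x) = pushforward CARD('n) \<phi> (current_restrict CARD('n) T \<Omega>) f ?c"
    by (simp add: int_densityD[OF u fc] jacobian_det_coords)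
  also have "\<dots> = current_restrict CARD('n) T \<Omega> (\<lambda>x. f (\<phi> x)) (coord_list (\<lambda>i x. \<phi> x $ i))"
    using fc by (simp add: pushforward_def map_coord_list comp_def)
  also have "\<bar>\<dots>\<bar> \<le> (\<Prod>p\<leftarrow>coord_list (\<lambda>i x. \<phi> x $ i). Lip p) * (1 * mass CARD('n) T)"
    by (rule current_restrict_abs_le[OF T LIPb_comp[OF f(1) \<phi>] l _ f(2)]) (use \<Omega> in simp)
  also have "\<dots> \<le> Lip \<phi> ^ CARD('n) * (1 * mass CARD('n) T)"
    by (intro mult_right_mono prod_Lip_coord_list_le Lip_vec_nth_comp[OF \<phi>]) (simp add: mass_nonneg)
  finally show "\<bar>LINT x|lborel. u x * f x\<bar> \<le> Lip \<phi> ^ CARD('n) * mass CARD('n) T" by simp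
qed

text \<open>The terms of a convergent series are eventually of modulus below 1, and integers of
  modulus below 1 vanish, so the sum is finite.\<close>

lemma suminf_Ints:
  fixes a :: "nat \<Rightarrow> real"
  assumes "\<And>n. a n \<in> \<int>" "summable a"
  shows "suminf a \<in> \<int>"
proof -
  have "eventually (\<lambda>n. \<bar>a n\<bar> < 1) sequentially"
    using tendsto_rabs_zero[OF summable_LIMSEQ_zero[OF assms(2)]] by (intro order_tendstoD) auto
  then obtain N where N: "\<And>n. n \<ge> N \<Longrightarrow> \<bar>a n\<bar> < 1" by (auto simp: eventually_sequentially)
  have "a n = 0" if "n \<ge> N" for n using N[OF that] assms(1)[of n] by (auto elim!: Ints_cases)
  then have "suminf a = (\<Sum>n<N. a n)" by (intro suminf_finite) (auto simp: not_less)
  then show ?thesis using assms(1) by (simp add: Ints_sum)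
qed

lemma AE_summable_of_L1:
  fixes u :: "nat \<Rightarrow> 'b \<Rightarrow> real"
  assumes "\<And>n. integrable M (u n)" "summable (\<lambda>n. LINT x|M. \<bar>u n x\<bar>)"
  shows "AE x in M. summable (\<lambda>n. \<bar>u n x\<bar>)"
proof -
  have [measurable]: "u n \<in> borel_measurable M" for n using borel_measurable_integrable[OF assms(1)] .
  have "(\<integral>\<^sup>+x. (\<Sum>n. ennreal \<bar>u n x\<bar>) \<partial>M) = (\<Sum>n. \<integral>\<^sup>+x. ennreal \<bar>u n x\<bar> \<partial>M)"
    by (rule nn_integral_suminf) measurable
  also have "\<dots> = (\<Sum>n. ennreal (LINT x|M. \<bar>u n x\<bar>))"
    using assms(1) by (simp add: nn_integral_eq_integral)
  also have "\<dots> \<noteq> \<infinity>" using assms(2) by (simp add: ennreal_suminf_neq_top)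
  finally have "AE x in M. (\<Sum>n. ennreal \<bar>u n x\<bar>) \<noteq> \<infinity>" by (intro nn_integral_PInf_AE) auto
  then show ?thesis by eventually_elim (auto intro: summable_suminf_not_top)
qed

text \<open>Summable masses make the densities of the terms summable in L1, hence absolutely
  summable almost everywhere. A convergent series of integers has an integer sum, so the sum of the
  densities is again an integer density, and integration against a bounded Jacobian is done
  termwise.\<close>

lemma integer_rectifiable_series:
  fixes S :: "nat \<Rightarrow> 'a::metric_space functional"
  assumes S: "\<And>n. S n \<in> integer_rectifiable_currents TYPE('n::finite)" and sm: "summable (\<lambda>n. mass CARD('n) (S n))"
  shows "series_current S \<in> integer_rectifiable_currents TYPE('n)"
  unfolding integer_rectifiable_iff
proof (intro conjI allI impI)
  have Sr: "S n \<in> rectifiable_currents TYPE('n)" for n using S integer_rectifiable_iff by blast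
  then have Sc: "S n \<in> currents CARD('n)" for n by (simp add: rectifiable_currents_def)
  show "series_current S \<in> rectifiable_currents TYPE('n)" by (rule rectifiable_series[OF Sr sm])
  fix \<phi> :: "'a \<Rightarrow> real ^ 'n" and \<Omega> :: "'a set" assume "\<phi> \<in> LIP \<and> open \<Omega>"
  then have \<phi>: "\<phi> \<in> LIP" and \<Omega>: "open \<Omega>" by auto
  let ?A = "\<lambda>T. pushforward CARD('n) \<phi> (current_restrict CARD('n) T \<Omega>)"
  have "\<exists>u. int_density (?A (S n)) u" for n using S[of n] \<phi> \<Omega> unfolding integer_rectifiable_iff by blast
  then obtain u where u: "\<And>n. int_density (?A (S n)) (u n)" by metis
  have ui: "integrable lborel (u n)" and uB [measurable]: "u n \<in> borel_measurable borel"
    and uZ: "u n x \<in> \<int>" for n x using u[of n] by (auto simp: int_density_def)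
  have sumL1: "summable (\<lambda>n. LINT x|lborel. \<bar>u n x\<bar>)"
    by (rule summable_comparison_test'[OF summable_mult[OF sm, of "Lip \<phi> ^ CARD('n)"]])
      (use int_density_L1_le[OF Sc \<phi> \<Omega> u] in simp)
  have AEs: "AE x in lborel. summable (\<lambda>n. \<bar>u n x\<bar>)" by (rule AE_summable_of_L1[OF ui sumL1])
  \<comment> \<open>Almost everywhere the floor changes nothing. It makes \<open>U\<close> integer
    valued also where the series diverges and \<open>suminf\<close> is a default value.\<close>
  define U where "U x = real_of_int \<lfloor>\<Sum>n. u n x\<rfloor>" for x
  have UB [measurable]: "U \<in> borel_measurable borel" unfolding U_def by measurable
  have AEU: "AE x in lborel. (\<Sum>n. u n x) = U x"
    using AEs
  proof eventually_elim
    fix x assume "summable (\<lambda>n. \<bar>u n x\<bar>)"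
    then have "(\<Sum>n. u n x) \<in> \<int>" by (rule suminf_Ints[OF uZ summable_rabs_cancel])
    then obtain z where "(\<Sum>n. u n x) = of_int z" by (rule Ints_cases)
    then show "(\<Sum>n. u n x) = U x" by (simp only: U_def floor_of_int)
  qed
  have "integrable lborel (\<lambda>x. \<Sum>n. u n x)" using ui AEs sumL1 by (intro integrable_suminf) auto
  then have Ui: "integrable lborel U" by (rule integrable_cong_AE_imp) (use AEU in auto)
  have "?A (series_current S) f \<pi> = (LINT x|lborel. U x * f x * jacobian_det \<pi> x)"
    if D: "(f, \<pi>) \<in> Dk CARD('n)" for f :: "real ^ 'n \<Rightarrow> real" and \<pi>
  proof -
    have f: "f \<in> LIPb" and \<pi>: "\<pi> \<in> LIPs CARD('n)" using D by (auto simp: Dk_def)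
    obtain F where F: "0 < F" "\<And>x. \<bar>f x\<bar> \<le> F" using LIPb_bound[OF f] by metis
    obtain B where B: "0 \<le> B" "\<And>x :: real ^ 'n. \<bar>jacobian_det \<pi> x\<bar> \<le> B" using jacobian_det_bounded[OF \<pi>] by metis
    have [measurable]: "f \<in> borel_measurable borel" "(jacobian_det \<pi> :: real ^ 'n \<Rightarrow> real) \<in> borel_measurable borel"
      using LIP_measurable[OF LIPb_LIP[OF f]] jacobian_det_measurable[OF \<pi>] by auto
    define w where "w x = f x * jacobian_det \<pi> x" for x
    have [measurable]: "w \<in> borel_measurable borel" unfolding w_def by measurable
    have w: "\<bar>w x\<bar> \<le> F * B" for x unfolding w_def abs_mult by (intro mult_mono F B) (use F B in auto)
    have bd: "\<bar>u n x * w x\<bar> \<le> (F * B) * \<bar>u n x\<bar>" for n x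
      using mult_left_mono[OF w, of "\<bar>u n x\<bar>"] by (simp add: abs_mult mult.commute)
    have i: "integrable lborel (\<lambda>x. u n x * w x)" for n
    proof (rule Bochner_Integration.integrable_bound[OF integrable_mult_right[OF integrable_abs[OF ui], of "F * B"]])
      show "AE x in lborel. norm (u n x * w x) \<le> norm (F * B * \<bar>u n x\<bar>)"
        using bd[of n] by (intro AE_I2) (metis abs_ge_self order_trans real_norm_def)
    qed measurable
    have "(\<lambda>n. LINT x|lborel. u n x * w x) sums (LINT x|lborel. (\<Sum>n. u n x * w x))"
    proof (rule sums_integral[OF i])
      show "AE x in lborel. summable (\<lambda>n. norm (u n x * w x))"
        using AEs
      proof eventually_elim
        fix x assume "summable (\<lambda>n. \<bar>u n x\<bar>)"
        then have "summable (\<lambda>n. (F * B) * \<bar>u n x\<bar>)" by (rule summable_mult)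
        then show "summable (\<lambda>n. norm (u n x * w x))"
          by (rule summable_comparison_test') (simp only: real_norm_def abs_abs bd)
      qed
      show "summable (\<lambda>n. LINT x|lborel. norm (u n x * w x))"
      proof (rule summable_comparison_test'[OF summable_mult[OF sumL1, of "F * B"]])
        fix n
        have "(LINT x|lborel. \<bar>u n x * w x\<bar>) \<le> (LINT x|lborel. (F * B) * \<bar>u n x\<bar>)"
          by (rule integral_mono) (use i ui bd in auto)
        then show "norm (LINT x|lborel. norm (u n x * w x)) \<le> F * B * (LINT x|lborel. \<bar>u n x\<bar>)" by simp
      qed
    qed
    also have "(LINT x|lborel. (\<Sum>n. u n x * w x)) = (LINT x|lborel. U x * w x)"
    proof (rule integral_cong_AE)
      show "AE x in lborel. (\<Sum>n. u n x * w x) = U x * w x"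
        using AEs AEU
      proof eventually_elim
        fix x assume "summable (\<lambda>n. \<bar>u n x\<bar>)" "(\<Sum>n. u n x) = U x"
        then show "(\<Sum>n. u n x * w x) = U x * w x"
          using suminf_mult2[OF summable_rabs_cancel, of "\<lambda>n. u n x" "w x"] by simp
      qed
    qed measurable
    finally have s1: "(\<lambda>n. ?A (S n) f \<pi>) sums (LINT x|lborel. U x * w x)"
      by (simp only: w_def mult.assoc[symmetric] int_densityD[OF u D])
    have s2: "(\<lambda>n. ?A (S n) f \<pi>) sums ?A (series_current S) f \<pi>"
    proof -
      have "(f \<circ> \<phi>, map (\<lambda>p. p \<circ> \<phi>) \<pi>) \<in> Dk CARD('n)"
        using LIPb_comp[OF f \<phi>] \<pi> LIP_comp[OF _ \<phi>] by (auto simp: Dk_def LIPs_def comp_def)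
      then show ?thesis using D \<Omega> current_restrict_series_sums[OF Sc sm] by (simp add: pushforward_def)
    qed
    show ?thesis using sums_unique2[OF s2 s1] by (simp only: w_def mult.assoc)
  qed
  then have eq: "\<forall>(f, \<pi>)\<in>Dk CARD('n). ?A (series_current S) f \<pi> = (LINT x|lborel. U x * f x * jacobian_det \<pi> x)"
    by auto
  have "\<forall>x. U x \<in> \<int>" by (simp add: U_def)
  then have "int_density (?A (series_current S)) U"
    unfolding int_density_def by (intro conjI UB Ui eq)
  then show "\<exists>u. int_density (?A (series_current S)) u" by (intro exI[of _ U])
qed


subsection \<open>The group of integral currents\<close>

lemma integral_currentsD:
  assumes "T \<in> integral_currents TYPE('n::finite)"
  shows "T \<in> currents CARD('n)" "boundary CARD('n) T \<in> currents (CARD('n) - 1)"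
  using assms by (auto simp: integral_currents_def normal_currents_def)

lemma normal_mass_nonneg: "0 \<le> normal_mass k T"
  by (simp add: normal_mass_def mass_nonneg)

text \<open>\<open>boundary\<close> acts termwise on a series, and a summable
  \<open>normal_mass\<close> makes both the masses and the boundary masses summable. The limit is
  then a normal current by the same argument applied to the terms and to their boundaries.\<close>

lemma integral_series:
  fixes S :: "nat \<Rightarrow> 'a::metric_space functional"
  assumes S: "\<And>n. S n \<in> integral_currents TYPE('n::finite)" and sm: "summable (\<lambda>n. normal_mass CARD('n) (S n))"
  shows "series_current S \<in> integral_currents TYPE('n)"
    and "normal_mass CARD('n) (series_current S) \<le> (\<Sum>n. normal_mass CARD('n) (S n))"
proof -
  have Sc: "S n \<in> currents CARD('n)" and Sb: "boundary CARD('n) (S n) \<in> currents (CARD('n) - 1)" for n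
    using integral_currentsD[OF S] by auto
  have s1: "summable (\<lambda>n. mass CARD('n) (S n))"
    by (rule summable_comparison_test'[OF sm]) (simp add: normal_mass_def mass_nonneg)
  have s2: "summable (\<lambda>n. mass (CARD('n) - 1) (boundary CARD('n) (S n)))"
    by (rule summable_comparison_test'[OF sm]) (simp add: normal_mass_def mass_nonneg)
  have "series_current S \<in> integer_rectifiable_currents TYPE('n)"
    by (rule integer_rectifiable_series[OF _ s1]) (use S in \<open>auto simp: integral_currents_def\<close>)
  moreover have "series_current S \<in> normal_currents CARD('n)"
    unfolding normal_currents_def mem_Collect_eq boundary_series
    by (intro conjI series_in_currents[OF Sc s1] series_in_currents[OF Sb s2])
  ultimately show "series_current S \<in> integral_currents TYPE('n)" by (simp add: integral_currents_def)
  have "normal_mass CARD('n) (series_current S)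
    \<le> (\<Sum>n. mass CARD('n) (S n)) + (\<Sum>n. mass (CARD('n) - 1) (boundary CARD('n) (S n)))"
    unfolding normal_mass_def boundary_series
    by (intro add_mono mass_series_le Sc Sb s1 s2)
  also have "\<dots> = (\<Sum>n. normal_mass CARD('n) (S n))"
    unfolding normal_mass_def by (rule suminf_add[OF s1 s2])
  finally show "normal_mass CARD('n) (series_current S) \<le> (\<Sum>n. normal_mass CARD('n) (S n))" .
qed

lemma normal_mass_zero: "normal_mass k (0 :: 'a::metric_space functional) = 0"
proof -
  have "boundary k (0 :: 'a functional) = 0" by (intro HOL.ext) (simp add: boundary_def)
  then show ?thesis by (simp add: normal_mass_def mass_zero)
qed

lemma normal_mass_uminus: "normal_mass k (- T) = normal_mass k T"
  by (simp add: normal_mass_def mass_uminus boundary_uminus)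

text \<open>Needed to pad a sum of two currents to a series. The empty set carries the zero
  current.\<close>

lemma integral_zero: "(0 :: 'a::metric_space functional) \<in> integral_currents TYPE('n::finite)"
proof -
  have b0: "boundary CARD('n) (0 :: 'a functional) = 0" by (intro HOL.ext) (simp add: boundary_def)
  have "emeasure (mass_measure CARD('n) (0 :: 'a functional)) B = 0" if "B \<in> sets borel" for B
    using mass_measure_le[OF zero_in_currents mass_bound_zero that, of "CARD('n)"] by simp
  moreover have "hausdorff_delta k \<delta> ({} :: 'a set) = 0" if "\<delta> > 0" for k and \<delta>
  proof -
    have "hausdorff_delta k \<delta> ({} :: 'a set) \<le> (\<Sum>i::nat. if {} = ({} :: 'a set) then 0
        else ennreal (unit_ball_vol (real k) * (diameter ({} :: 'a set) / 2) ^ k))"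
      unfolding hausdorff_delta_def
      by (rule INF_lower[of "\<lambda>_. {}"]) (use that in \<open>simp add: diameter_def\<close>)
    then show ?thesis by simp
  qed
  then have "countably_rectifiable TYPE('n) ({} :: 'a set)"
    unfolding countably_rectifiable_def
    by (intro exI[of _ "\<lambda>_. {}"] exI[of _ "\<lambda>_ _. undefined"]) (auto simp: hausdorff_null_iff intro: exI[of _ 0])
  moreover have "AE x in mass_measure CARD('n) (0 :: 'a functional). x \<in> {}"
    using calculation(1)[of UNIV] finite_borel_mass_measure[OF zero_in_currents, of "CARD('n)", where 'a = 'a]
    by (intro AE_I[where N = UNIV]) auto
  ultimately have "(0 :: 'a functional) \<in> rectifiable_currents TYPE('n)"
    unfolding rectifiable_currents_def using zero_in_currents by blast
  moreover have "\<exists>u. int_density (pushforward CARD('n) \<phi> (current_restrict CARD('n) 0 \<Omega>)) u"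
    if "\<phi> \<in> LIP" "open \<Omega>" for \<phi> :: "'a \<Rightarrow> real ^ 'n" and \<Omega>
  proof (intro exI[of _ "\<lambda>_. 0"])
    have "current_restrict CARD('n) 0 \<Omega> (\<lambda>x. f (\<phi> x)) (map (\<lambda>p. p \<circ> \<phi>) \<pi>) = 0"
      if "(f, \<pi>) \<in> Dk CARD('n)" for f :: "real ^ 'n \<Rightarrow> real" and \<pi>
    proof -
      have f: "f \<in> LIPb" and \<pi>: "\<pi> \<in> LIPs CARD('n)" using that by (auto simp: Dk_def)
      obtain F where F: "\<And>x. \<bar>f x\<bar> \<le> F" using LIPb_bound[OF f] by metis
      have "map (\<lambda>p. p \<circ> \<phi>) \<pi> \<in> LIPs CARD('n)"
        using \<pi> LIP_comp[OF _ \<open>\<phi> \<in> LIP\<close>] by (auto simp: LIPs_def comp_def)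
      from current_restrict_abs_le[OF zero_in_currents LIPb_comp[OF f \<open>\<phi> \<in> LIP\<close>] this borel_open[OF \<open>open \<Omega>\<close>] F]
      show ?thesis by (simp add: mass_zero)
    qed
    then show "int_density (pushforward CARD('n) \<phi> (current_restrict CARD('n) 0 \<Omega>)) (\<lambda>_. 0)"
      by (auto simp: int_density_def pushforward_def comp_def)
  qed
  ultimately show ?thesis
    unfolding integral_currents_def integer_rectifiable_iff normal_currents_def Int_iff mem_Collect_eq b0
    using zero_in_currents by blast
qed

lemma integral_uminus:
  fixes T :: "'a::metric_space functional"
  assumes T: "T \<in> integral_currents TYPE('n::finite)"
  shows "- T \<in> integral_currents TYPE('n)"
proof -
  have Tc: "T \<in> currents CARD('n)" "boundary CARD('n) T \<in> currents (CARD('n) - 1)"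
    using integral_currentsD[OF T] by auto
  have "T \<in> rectifiable_currents TYPE('n)" and
    ex: "\<And>\<phi> \<Omega>. \<phi> \<in> LIP \<Longrightarrow> open \<Omega> \<Longrightarrow>
      \<exists>u. int_density (pushforward CARD('n) (\<phi> :: 'a \<Rightarrow> real ^ 'n) (current_restrict CARD('n) T \<Omega>)) u"
    using T unfolding integral_currents_def integer_rectifiable_iff Int_iff by blast+
  then have "- T \<in> rectifiable_currents TYPE('n)"
    unfolding rectifiable_currents_def mem_Collect_eq mass_measure_uminus using currents_uminus by blast
  moreover have "\<exists>u. int_density (pushforward CARD('n) \<phi> (current_restrict CARD('n) (- T) \<Omega>)) u"
    if \<phi>: "\<phi> \<in> LIP" "open \<Omega>" for \<phi> :: "'a \<Rightarrow> real ^ 'n" and \<Omega>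
  proof -
    obtain u where u: "int_density (pushforward CARD('n) \<phi> (current_restrict CARD('n) T \<Omega>)) u"
      using ex[OF \<phi>] by blast
    have "pushforward CARD('n) \<phi> (current_restrict CARD('n) (- T) \<Omega>) f \<pi>
        = (LINT x|lborel. - u x * f x * jacobian_det \<pi> x)"
      if D: "(f, \<pi>) \<in> Dk CARD('n)" for f :: "real ^ 'n \<Rightarrow> real" and \<pi>
      using int_densityD[OF u D] D by (simp add: pushforward_def current_restrict_uminus[OF Tc(1)])
    then have "int_density (pushforward CARD('n) \<phi> (current_restrict CARD('n) (- T) \<Omega>)) (\<lambda>x. - u x)"
      using u by (auto simp: int_density_def)
    then show ?thesis by (intro exI[of _ "\<lambda>x. - u x"])
  qed
  ultimately show ?thesis
    unfolding integral_currents_def integer_rectifiable_iff normal_currents_def Int_iff mem_Collect_eq boundary_uminus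
    using currents_uminus Tc by blast
qed

lemma integral_add:
  fixes R S :: "'a::metric_space functional"
  assumes "R \<in> integral_currents TYPE('n::finite)" "S \<in> integral_currents TYPE('n)"
  shows "R + S \<in> integral_currents TYPE('n)"
    and "normal_mass CARD('n) (R + S) \<le> normal_mass CARD('n) R + normal_mass CARD('n) S"
proof -
  let ?S = "\<lambda>n::nat. if n = 0 then R else if n = 1 then S else 0"
  have S: "?S n \<in> integral_currents TYPE('n)" for n by (simp add: assms integral_zero)
  have nz: "normal_mass CARD('n) (?S n) = 0" if "n \<notin> {0, 1}" for n using that by (simp add: normal_mass_zero)
  have sm: "summable (\<lambda>n. normal_mass CARD('n) (?S n))"
    by (rule summable_finite[of "{0, 1}"]) (use nz in auto)
  show "R + S \<in> integral_currents TYPE('n)" unfolding add_as_series by (rule integral_series(1)[OF S sm])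
  have "(\<Sum>n. normal_mass CARD('n) (?S n)) = (\<Sum>n\<in>{0, 1}. normal_mass CARD('n) (?S n))"
    by (rule suminf_finite) (use nz in auto)
  then show "normal_mass CARD('n) (R + S) \<le> normal_mass CARD('n) R + normal_mass CARD('n) S"
    using integral_series(2)[OF S sm] unfolding add_as_series[of R S] by simp
qed

lemma integral_eq_0:
  assumes "T \<in> integral_currents TYPE('n::finite)" "normal_mass CARD('n) T = 0"
  shows "T = 0"
proof (rule mass_eq_0_D[OF integral_currentsD(1)[OF assms(1)]])
  show "mass CARD('n) T = 0"
    using assms(2) mass_nonneg[of "CARD('n)" T] mass_nonneg[of "CARD('n) - 1" "boundary CARD('n) T"]
    unfolding normal_mass_def by linarith
qed

lemma sum_functional_apply: "(\<Sum>i\<in>A. S i) f \<pi> = (\<Sum>i\<in>A. (S i :: 'a functional) f \<pi>)"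
  by (induction A rule: infinite_finite_induct) auto

lemma series_current_tail:
  fixes S :: "nat \<Rightarrow> 'a::metric_space functional"
  assumes "\<And>n. S n \<in> currents k" "summable (\<lambda>n. mass k (S n))"
  shows "series_current S - (\<Sum>i<m. S i) = series_current (\<lambda>n. S (n + m))"
proof (intro HOL.ext)
  fix f \<pi>
  have "summable (\<lambda>n. S n f \<pi>)" using sums_summable[OF series_sums[OF assms]] .
  then show "(series_current S - (\<Sum>i<m. S i)) f \<pi> = series_current (\<lambda>n. S (n + m)) f \<pi>"
    unfolding series_current_def using suminf_minus_initial_segment[of "\<lambda>n. S n f \<pi>" m]
    by (simp add: sum_functional_apply)
qed

text \<open>The remainder after \<open>m\<close> terms is the series of the tail, so its norm is at
  most the tail of a convergent series of norms.\<close>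

lemma integral_complete:
  fixes S :: "nat \<Rightarrow> 'a::metric_space functional"
  assumes S: "\<And>n. S n \<in> integral_currents TYPE('n::finite)" and sm: "summable (\<lambda>n. normal_mass CARD('n) (S n))"
  shows "(\<lambda>m. normal_mass CARD('n) (series_current S - (\<Sum>i<m. S i))) \<longlonglongrightarrow> 0"
proof -
  have s1: "summable (\<lambda>n. mass CARD('n) (S n))"
    by (rule summable_comparison_test'[OF sm]) (simp add: normal_mass_def mass_nonneg)
  have le: "normal_mass CARD('n) (series_current S - (\<Sum>i<m. S i)) \<le> (\<Sum>n. normal_mass CARD('n) (S (n + m)))" for m
    unfolding series_current_tail[OF integral_currentsD(1)[OF S] s1]
    by (rule integral_series(2)[OF S]) (rule summable_ignore_initial_segment[OF sm])
  have "(\<lambda>m. \<Sum>n. normal_mass CARD('n) (S (n + m))) \<longlonglongrightarrow> 0" by (rule suminf_exist_split2[OF sm])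
  then show ?thesis
    by (rule tendsto_sandwich[OF _ _ tendsto_const, rotated 2]) (auto intro!: always_eventually le normal_mass_nonneg)
qed


subsection \<open>Decomposition in a complete normed group\<close>

text \<open>Isolates what the decomposition uses of integral currents. Completeness is stated for
  series because the exhaustion produces series. The last assumption says that a nonzero element is
  not a norm-additive sum of arbitrarily fine pieces: for some threshold no such series exists with
  all terms below it.\<close>

locale normed_group_without_dust =
  fixes G :: "'g::ab_group_add set" and N :: "'g \<Rightarrow> real"
  assumes zero_mem: "0 \<in> G"
    and add_mem: "x \<in> G \<Longrightarrow> y \<in> G \<Longrightarrow> x + y \<in> G"
    and uminus_mem: "x \<in> G \<Longrightarrow> - x \<in> G"
    and N_nonneg: "0 \<le> N x"
    and N_zero: "N 0 = 0"
    and N_eq_0: "x \<in> G \<Longrightarrow> N x = 0 \<Longrightarrow> x = 0"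
    and N_uminus: "N (- x) = N x"
    and N_triangle: "x \<in> G \<Longrightarrow> y \<in> G \<Longrightarrow> N (x + y) \<le> N x + N y"
    and complete: "(\<And>n. s n \<in> G) \<Longrightarrow> summable (\<lambda>n. N (s n)) \<Longrightarrow>
      \<exists>x\<in>G. (\<lambda>n. N (x - (\<Sum>i<n. s i))) \<longlonglongrightarrow> 0"
    and no_dust: "x \<in> G \<Longrightarrow> x \<noteq> 0 \<Longrightarrow> \<exists>e>0. \<forall>s. (\<forall>n. s n \<in> G \<and> N (s n) \<le> e) \<longrightarrow>
      (\<lambda>n. N (s n)) sums N x \<longrightarrow> \<not> (\<lambda>n. N (x - (\<Sum>i<n. s i))) \<longlonglongrightarrow> 0"
begin

text \<open>Only \<open>c \<in> G\<close> is recorded; for \<open>x\<close> in \<open>G\<close> the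
  complement \<open>x - c\<close> lies in \<open>G\<close> as well.\<close>

definition piece :: "'g \<Rightarrow> 'g \<Rightarrow> bool" where
  "piece c x \<longleftrightarrow> c \<in> G \<and> N x = N c + N (x - c)"

definition indecomposable :: "'g \<Rightarrow> bool" where
  "indecomposable x \<longleftrightarrow> \<not> (\<exists>r\<in>G - {0}. \<exists>s\<in>G - {0}. x = r + s \<and> N x = N r + N s)"

lemma diff_mem: "x \<in> G \<Longrightarrow> y \<in> G \<Longrightarrow> x - y \<in> G"
  using add_mem[OF _ uminus_mem, of x y] by simp

lemma N_diff_swap: "N (x - y) = N (y - x)"
  using N_uminus[of "x - y"] by simp

lemma sum_mem: "(\<And>i. i \<in> A \<Longrightarrow> s i \<in> G) \<Longrightarrow> (\<Sum>i\<in>A. s i) \<in> G"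
  by (induction A rule: infinite_finite_induct) (auto intro: zero_mem add_mem)

lemma piece_le: "piece c x \<Longrightarrow> N c \<le> N x"
  using N_nonneg[of "x - c"] by (simp add: piece_def)

lemma piece_zero: "piece 0 x"
  by (simp add: piece_def zero_mem N_zero)

lemma piece_refl: "x \<in> G \<Longrightarrow> piece x x"
  by (simp add: piece_def N_zero)

text \<open>The two splittings add to \<open>N x = N c + N (y - c) + N (x - y)\<close>. The triangle
  inequality for \<open>x - c\<close> gives one inequality and that for \<open>x\<close> the
  other.\<close>

lemma piece_trans:
  assumes x: "x \<in> G" and "piece c y" "piece y x"
  shows "piece c x"
proof -
  have y: "y \<in> G" "N x = N y + N (x - y)" and c: "c \<in> G" "N y = N c + N (y - c)"
    using assms by (auto simp: piece_def)
  have "N (x - c) \<le> N (x - y) + N (y - c)"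
    using N_triangle[OF diff_mem[OF x y(1)] diff_mem[OF y(1) c(1)]] by simp
  moreover have "N x \<le> N c + N (x - c)" using N_triangle[OF c(1) diff_mem[OF x c(1)]] by simp
  ultimately show ?thesis using y c by (simp add: piece_def)
qed

lemma N_diff_le: "x \<in> G \<Longrightarrow> y \<in> G \<Longrightarrow> \<bar>N x - N y\<bar> \<le> N (x - y)"
  using N_triangle[of "x - y" y] N_triangle[of "y - x" x] diff_mem[of x y] diff_mem[of y x] N_diff_swap[of x y]
  by simp

lemma N_tendsto:
  assumes "\<And>n. y n \<in> G" "y0 \<in> G" "(\<lambda>n. N (y n - y0)) \<longlonglongrightarrow> 0"
  shows "(\<lambda>n. N (y n)) \<longlonglongrightarrow> N y0"
proof -
  have "(\<lambda>n. N (y n) - N y0) \<longlonglongrightarrow> 0"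
    by (rule Lim_null_comparison[OF _ assms(3)]) (simp add: N_diff_le assms)
  then show ?thesis by (rule LIM_zero_cancel)
qed

text \<open>The supremum of the norms of admissible pieces need not be attained, so half of it is
  aimed at. Admitting \<open>c = 0\<close> keeps the choice possible when no piece of
  \<open>y\<close> lies in \<open>C\<close>.\<close>

lemma large_piece:
  assumes "y \<in> G" "C \<subseteq> G"
  shows "\<exists>c. (c = 0 \<or> c \<in> C) \<and> piece c y \<and> (\<forall>c'\<in>C. piece c' y \<longrightarrow> N c' \<le> 2 * N c)"
proof -
  define V where "V = {N c | c. (c = 0 \<or> c \<in> C) \<and> piece c y}"
  have ne: "V \<noteq> {}" using piece_zero[of y] unfolding V_def by blast
  have bdd: "bdd_above V" unfolding V_def using piece_le by (intro bdd_aboveI[of _ "N y"]) auto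
  have up: "N c \<le> Sup V" if "c \<in> C" "piece c y" for c
    by (rule cSup_upper[OF _ bdd]) (use that in \<open>auto simp: V_def\<close>)
  show ?thesis
  proof (cases "Sup V \<le> 0")
    case True
    then show ?thesis using up piece_zero[of y] N_zero by (intro exI[of _ 0]) force
  next
    case False
    then obtain v where "v \<in> V" "Sup V / 2 < v" using less_cSupD[OF ne, of "Sup V / 2"] by auto
    then show ?thesis using up unfolding V_def by fastforce
  qed
qed

text \<open>Additivity bounds the norms of the removed pieces by \<open>N x\<close>, so they are
  summable and the remainders \<open>R n\<close> converge to some \<open>r\<close>. A piece of
  \<open>r\<close> lying in \<open>C\<close> is also a piece of every \<open>R n\<close>, where the
  greedy choice gives \<open>N c \<le> 2 * N (s n)\<close>; the right side tends to 0.\<close>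

lemma exhaust:
  assumes x: "x \<in> G" and C: "C \<subseteq> G"
  obtains s r where "\<And>n. s n = 0 \<or> s n \<in> C" "piece r x" "(\<lambda>n. N (s n)) sums (N x - N r)"
    "(\<lambda>n. N (x - r - (\<Sum>i<n. s i))) \<longlonglongrightarrow> 0" "\<And>c. c \<in> C \<Longrightarrow> piece c r \<Longrightarrow> c = 0"
proof -
  define sel where "sel y = (SOME c. (c = 0 \<or> c \<in> C) \<and> piece c y \<and> (\<forall>c'\<in>C. piece c' y \<longrightarrow> N c' \<le> 2 * N c))" for y
  have sel: "sel y = 0 \<or> sel y \<in> C" "piece (sel y) y" "\<And>c'. c' \<in> C \<Longrightarrow> piece c' y \<Longrightarrow> N c' \<le> 2 * N (sel y)"
    if "y \<in> G" for y
    using someI_ex[OF large_piece[OF that C]] unfolding sel_def[symmetric] by blast+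
  define R where "R = rec_nat x (\<lambda>_ y. y - sel y)"
  have R0: "R 0 = x" and RS: "R (Suc n) = R n - sel (R n)" for n by (simp_all add: R_def)
  have RG: "R n \<in> G" for n
  proof (induction n)
    case (Suc n)
    have "sel (R n) \<in> G" using sel(1)[OF Suc] C zero_mem by auto
    then show ?case using Suc by (simp add: RS diff_mem)
  qed (simp add: R0 x)
  define s where "s n = sel (R n)" for n
  have sG: "s n \<in> G" for n using sel(1)[OF RG[of n]] C zero_mem by (auto simp: s_def)
  have Rsum: "R (n + m) = R n - (\<Sum>i<m. s (n + i))" for n m
    by (induction m) (simp_all add: RS s_def)
  have NR: "N (R n) = (\<Sum>i<m. N (s (n + i))) + N (R (n + m))" for n m
  proof (induction m)
    case (Suc m)
    have "N (R (n + m)) = N (s (n + m)) + N (R (Suc (n + m)))"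
      using sel(2)[OF RG[of "n + m"]] by (simp add: piece_def s_def RS)
    then show ?case using Suc by simp
  qed simp
  \<comment> \<open>The difference of two remainders is a sum of removed pieces, whose norms were
    subtracted without loss. This inequality is closed under limits in \<open>m\<close>.\<close>
  have Rle: "N (R n) \<ge> N (R n - R (n + m)) + N (R (n + m))" for n m
  proof -
    have "N (\<Sum>i<m. s (n + i)) \<le> (\<Sum>i<m. N (s (n + i)))" for m
    proof (induction m)
      case (Suc m)
      then show ?case using N_triangle[OF sum_mem sG, of "{..<m}" "\<lambda>i. s (n + i)" "n + m"] sG by simp
    qed (simp add: N_zero)
    moreover have "R n - R (n + m) = (\<Sum>i<m. s (n + i))" by (simp add: Rsum)
    ultimately show ?thesis using NR[of n m] by (simp add: add_mono)
  qed
  have sm: "summable (\<lambda>n. N (s n))"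
  proof (rule summableI_nonneg_bounded)
    show "(\<Sum>i<n. N (s i)) \<le> N x" for n using NR[of 0 n] N_nonneg[of "R n"] by (simp add: R0)
  qed (rule N_nonneg)
  obtain y where y: "y \<in> G" "(\<lambda>n. N (y - (\<Sum>i<n. s i))) \<longlonglongrightarrow> 0" using complete[OF sG sm] by blast
  define r where "r = x - y"
  have rG: "r \<in> G" using x y by (simp add: r_def diff_mem)
  have Rn: "R n = x - (\<Sum>i<n. s i)" for n using Rsum[of 0 n] by (simp add: R0)
  have Rr: "(\<lambda>n. N (R n - r)) \<longlonglongrightarrow> 0" using y(2) by (simp add: Rn r_def)
  have NRr: "(\<lambda>n. N (R n)) \<longlonglongrightarrow> N r" by (rule N_tendsto[OF RG rG Rr])
  \<comment> \<open>Letting \<open>m\<close> tend to infinity in \<open>Rle\<close> gives one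
    inequality; the other is the triangle inequality.\<close>
  have pr: "piece r (R n)" for n
  proof -
    have "(\<lambda>m. N (R (m + n) - r)) \<longlonglongrightarrow> 0" by (rule LIMSEQ_ignore_initial_segment[OF Rr])
    then have z: "(\<lambda>m. N ((R n - R (n + m)) - (R n - r))) \<longlonglongrightarrow> 0"
      by (simp add: add.commute N_diff_swap[of r])
    have "(\<lambda>m. N (R n - R (n + m))) \<longlonglongrightarrow> N (R n - r)"
      by (rule N_tendsto[OF _ _ z]) (auto intro: diff_mem RG rG)
    moreover have "(\<lambda>m. N (R (n + m))) \<longlonglongrightarrow> N r"
      using LIMSEQ_ignore_initial_segment[OF NRr, of n] by (simp add: add.commute)
    ultimately have "(\<lambda>m. N (R n - R (n + m)) + N (R (n + m))) \<longlonglongrightarrow> N (R n - r) + N r" by (rule tendsto_add)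
    then have "N (R n - r) + N r \<le> N (R n)" by (rule LIMSEQ_le_const2) (use Rle in blast)
    moreover have "N (R n) \<le> N r + N (R n - r)" using N_triangle[OF rG diff_mem[OF RG rG]] by simp
    ultimately show ?thesis using rG by (simp add: piece_def)
  qed
  show ?thesis
  proof
    show "s n = 0 \<or> s n \<in> C" for n using sel(1)[OF RG] by (simp add: s_def)
    show "piece r x" using pr[of 0] by (simp add: R0)
    have "(\<lambda>n. N x - N (R n)) \<longlonglongrightarrow> N x - N r" by (intro tendsto_intros NRr)
    moreover have "N x - N (R n) = (\<Sum>i<n. N (s i))" for n using NR[of 0 n] by (simp add: R0)
    ultimately show "(\<lambda>n. N (s n)) sums (N x - N r)" by (simp add: sums_def)
    show "(\<lambda>n. N (x - r - (\<Sum>i<n. s i))) \<longlonglongrightarrow> 0" using y(2) by (simp add: r_def)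
    show "c = 0" if "c \<in> C" "piece c r" for c
    proof (rule N_eq_0)
      show "c \<in> G" using that C by blast
      have b: "N c \<le> 2 * N (s n)" for n
        unfolding s_def by (rule sel(3)[OF RG that(1) piece_trans[OF RG that(2) pr]])
      have "(\<lambda>n. 2 * N (s n)) \<longlonglongrightarrow> 2 * 0"
        by (intro tendsto_intros summable_LIMSEQ_zero[OF sm])
      then have "N c \<le> 2 * 0" by (rule LIMSEQ_le_const) (use b in blast)
      then show "N c = 0" using N_nonneg[of c] by simp
    qed
  qed
qed

lemma indecomposable_piece_exists:
  assumes x: "x \<in> G" "x \<noteq> 0"
  obtains c where "piece c x" "c \<noteq> 0" "indecomposable c"
proof -
  obtain e where e: "e > 0" "\<And>s. (\<And>n. s n \<in> G \<and> N (s n) \<le> e) \<Longrightarrow>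
      (\<lambda>n. N (s n)) sums N x \<Longrightarrow> \<not> (\<lambda>n. N (x - (\<Sum>i<n. s i))) \<longlonglongrightarrow> 0"
    using no_dust[OF x] by blast
  define C where "C = {c \<in> G. N c \<le> e}"
  have CG: "C \<subseteq> G" by (auto simp: C_def)
  obtain s r where s: "\<And>n. s n = 0 \<or> s n \<in> C" and r: "piece r x" and sums: "(\<lambda>n. N (s n)) sums (N x - N r)"
    and lim: "(\<lambda>n. N (x - r - (\<Sum>i<n. s i))) \<longlonglongrightarrow> 0" and none: "\<And>c. c \<in> C \<Longrightarrow> piece c r \<Longrightarrow> c = 0"
    using exhaust[OF x(1) CG] by metis
  have "r \<noteq> 0"
  proof
    assume r0: "r = 0"
    have "s n \<in> G \<and> N (s n) \<le> e" for n using s[of n] e(1) zero_mem N_zero by (auto simp: C_def)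
    from e(2)[OF this] show False using sums lim r0 by (simp add: N_zero)
  qed
  have rG: "r \<in> G" using r by (simp add: piece_def)
  define V where "V = {N c | c. piece c r \<and> c \<noteq> 0}"
  have ne: "V \<noteq> {}" using piece_refl[OF rG] \<open>r \<noteq> 0\<close> by (auto simp: V_def)
  have bdd: "bdd_below V" using N_nonneg by (intro bdd_belowI[of _ 0]) (auto simp: V_def)
  have low: "Inf V \<le> N c" if "piece c r" "c \<noteq> 0" for c
    by (rule cInf_lower[OF _ bdd]) (use that in \<open>auto simp: V_def\<close>)
  have big: "N c > e" if "piece c r" "c \<noteq> 0" for c
    using none[of c] that by (force simp: C_def piece_def)
  \<comment> \<open>The tolerance is the very \<open>e\<close> that bounds nonzero pieces of
    \<open>r\<close> from below. If \<open>c = a + b\<close> splits additively, then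
    \<open>N a\<close> is at least the infimum and \<open>N b\<close> exceeds \<open>e\<close>,
    which contradicts the choice of \<open>c\<close>.\<close>
  obtain v where v: "v \<in> V" "v < Inf V + e" using cInf_lessD[OF ne, of "Inf V + e"] e(1) by auto
  then obtain c where c: "piece c r" "c \<noteq> 0" "N c < Inf V + e" by (auto simp: V_def)
  have "indecomposable c"
    unfolding indecomposable_def
  proof
    assume "\<exists>a\<in>G - {0}. \<exists>b\<in>G - {0}. c = a + b \<and> N c = N a + N b"
    then obtain a b where ab: "a \<in> G" "a \<noteq> 0" "b \<in> G" "b \<noteq> 0" "c = a + b" "N c = N a + N b" by blast
    have "piece a c" "piece b c" using ab by (auto simp: piece_def)
    then have "piece a r" "piece b r" using piece_trans[OF rG _ c(1)] by auto
    then show False using low[of a] big[of b] ab c(3) by simp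
  qed
  then show ?thesis using that[OF piece_trans[OF x(1) c(1) r] c(2)] by blast
qed

theorem indecomposable_decomposition:
  assumes x: "x \<in> G"
  obtains s where "\<And>n. s n = 0 \<or> s n \<in> G - {0} \<and> indecomposable (s n)" "(\<lambda>n. N (s n)) sums N x"
    "(\<lambda>n. N (x - (\<Sum>i<n. s i))) \<longlonglongrightarrow> 0"
proof -
  define C where "C = {c \<in> G. c \<noteq> 0 \<and> indecomposable c}"
  have CG: "C \<subseteq> G" by (auto simp: C_def)
  obtain s r where s: "\<And>n. s n = 0 \<or> s n \<in> C" and r: "piece r x" and sums: "(\<lambda>n. N (s n)) sums (N x - N r)"
    and lim: "(\<lambda>n. N (x - r - (\<Sum>i<n. s i))) \<longlonglongrightarrow> 0" and none: "\<And>c. c \<in> C \<Longrightarrow> piece c r \<Longrightarrow> c = 0"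
    using exhaust[OF x CG] by metis
  have rG: "r \<in> G" using r by (simp add: piece_def)
  have "r = 0"
  proof (rule ccontr)
    assume "r \<noteq> 0"
    then obtain c where c: "piece c r" "c \<noteq> 0" "indecomposable c" by (rule indecomposable_piece_exists[OF rG])
    then have "c \<in> C" by (simp add: C_def piece_def)
    then show False using none c by blast
  qed
  then show ?thesis using that[of s] s sums lim by (auto simp: C_def N_zero)
qed

end


subsection \<open>Locality and the product rule\<close>

context
  fixes T :: "'a::metric_space functional" and m :: nat and \<rho> :: "('a \<Rightarrow> real) list"
  assumes T: "T \<in> currents (Suc m)" and \<rho>: "\<rho> \<in> LIPs m"
begin

lemma currents_hd_lincomb:
  assumes "f \<in> LIPb" "p \<in> LIP" "q \<in> LIP"
  shows "T f ((\<lambda>x. a * p x + b * q x) # \<rho>) = a * T f (p # \<rho>) + b * T f (q # \<rho>)"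
proof -
  have "p # \<rho> \<in> LIPs (Suc m)" using assms \<rho> by (simp add: LIPs_Cons)
  from currents_lincomb_slot[OF T assms(1) this _ assms(2,3), of 0] show ?thesis by simp
qed

lemma currents_hd_add:
  "f \<in> LIPb \<Longrightarrow> p \<in> LIP \<Longrightarrow> q \<in> LIP \<Longrightarrow> T f ((\<lambda>x. p x + q x) # \<rho>) = T f (p # \<rho>) + T f (q # \<rho>)"
  using currents_hd_lincomb[of f p q 1 1] by simp

lemma currents_hd_diff:
  "f \<in> LIPb \<Longrightarrow> p \<in> LIP \<Longrightarrow> q \<in> LIP \<Longrightarrow> T f ((\<lambda>x. p x - q x) # \<rho>) = T f (p # \<rho>) - T f (q # \<rho>)"
  using currents_hd_lincomb[of f p q 1 "-1"] by simp

lemma currents_hd_cmult: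
  "f \<in> LIPb \<Longrightarrow> p \<in> LIP \<Longrightarrow> T f ((\<lambda>x. c * p x) # \<rho>) = c * T f (p # \<rho>)"
  using currents_hd_lincomb[of f p p c 0] by simp

lemma currents_hd_open_local:
  assumes "f \<in> LIPb" "p \<in> LIP" "open U" "{x. f x \<noteq> 0} \<subseteq> U" "\<And>x. x \<in> U \<Longrightarrow> p x = c"
  shows "T f (p # \<rho>) = 0"
proof -
  have loc: "\<And>f \<pi>. (f, \<pi>) \<in> Dk (Suc m) \<Longrightarrow>
        (\<exists>i<Suc m. \<exists>U c. open U \<and> {x. f x \<noteq> 0} \<subseteq> U \<and> (\<forall>x\<in>U. (\<pi> ! i) x = c)) \<Longrightarrow> T f \<pi> = 0"
    using T unfolding currents_def by blast
  have "(f, p # \<rho>) \<in> Dk (Suc m)" using assms \<rho> by (simp add: Dk_def LIPs_Cons)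
  moreover have "\<exists>i<Suc m. \<exists>U c. open U \<and> {x. f x \<noteq> 0} \<subseteq> U \<and> (\<forall>x\<in>U. ((p # \<rho>) ! i) x = c)"
    using assms by (intro exI[of _ 0] conjI exI[of _ U] exI[of _ c]) auto
  ultimately show ?thesis by (rule loc)
qed

lemma currents_hd_const: "f \<in> LIPb \<Longrightarrow> T f ((\<lambda>_. c) # \<rho>) = 0"
  by (rule currents_hd_open_local[of f _ UNIV c]) (auto simp: LIP_const)

lemma currents_hd_tendsto:
  assumes f: "f \<in> LIPb" and p: "p \<in> LIP" "\<And>n. q n \<in> LIP" "\<And>x. (\<lambda>n. q n x) \<longlonglongrightarrow> p x" "\<And>n. Lip (q n) \<le> L"
  shows "(\<lambda>n. T f (q n # \<rho>)) \<longlonglongrightarrow> T f (p # \<rho>)"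
proof -
  have cont: "\<And>f \<pi> \<pi>n. (f, \<pi>) \<in> Dk (Suc m) \<Longrightarrow> (\<forall>n. (f, \<pi>n n) \<in> Dk (Suc m)) \<Longrightarrow>
        (\<forall>i<Suc m. \<forall>x. (\<lambda>n. (\<pi>n n ! i) x) \<longlonglongrightarrow> (\<pi> ! i) x) \<Longrightarrow>
        (\<forall>i<Suc m. bdd_above (range (\<lambda>n. Lip (\<pi>n n ! i)))) \<Longrightarrow>
        (\<lambda>n. T f (\<pi>n n)) \<longlonglongrightarrow> T f \<pi>"
    using T unfolding currents_def by blast
  show ?thesis
  proof (rule cont)
    show "(f, p # \<rho>) \<in> Dk (Suc m)" "\<forall>n. (f, q n # \<rho>) \<in> Dk (Suc m)"
      using f p \<rho> by (auto simp: Dk_def LIPs_Cons)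
    show "\<forall>i<Suc m. \<forall>x. (\<lambda>n. ((q n # \<rho>) ! i) x) \<longlonglongrightarrow> ((p # \<rho>) ! i) x"
      using p(3) by (auto simp: nth_Cons split: nat.split)
    show "\<forall>i<Suc m. bdd_above (range (\<lambda>n. Lip ((q n # \<rho>) ! i)))"
    proof (intro allI impI)
      fix i show "bdd_above (range (\<lambda>n. Lip ((q n # \<rho>) ! i)))"
        using p(4) by (cases i) (auto intro!: bdd_aboveI[of _ L])
    qed
  qed
qed

text \<open>The locality axiom asks for constancy near \<open>{f \<noteq> 0}\<close>; soft thresholding of \<open>p - c\<close>
  reduces constancy on \<open>{f \<noteq> 0}\<close> to that case.\<close>

lemma currents_hd_local:
  assumes f: "f \<in> LIPb" and p: "p \<in> LIP" and c: "\<And>x. f x \<noteq> 0 \<Longrightarrow> p x = c"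
  shows "T f (p # \<rho>) = 0"
proof -
  define d where "d n = 1 / real (Suc n)" for n
  define q where "q n x = max (p x - c - d n) 0 + min (p x - c + d n) 0" for n x
  have d0: "d n > 0" for n by (simp add: d_def)
  have dlim: "d \<longlonglongrightarrow> 0" unfolding d_def using LIMSEQ_Suc[OF lim_1_over_n[where 'a = real]] .
  have qp: "\<bar>q n x - q n y\<bar> \<le> \<bar>p x - p y\<bar>" for n x y
    using d0[of n] unfolding q_def by (auto simp: max_def min_def)
  have qL: "\<bar>q n x - q n y\<bar> \<le> Lip p * dist x y" for n x y
    using qp[of n x y] Lip_bound_real[OF p, of x y] by linarith
  have q: "q n \<in> LIP" "Lip (q n) \<le> Lip p" for n
    using LIP_realI[OF qL] Lip_le_real[OF qL Lip_nonneg[OF p]] by auto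
  have zero: "T f (q n # \<rho>) = 0" for n
  proof (rule currents_hd_open_local[OF f q(1), of "{x. \<bar>p x - c\<bar> < d n}" n 0])
    show "open {x. \<bar>p x - c\<bar> < d n}"
      by (intro open_Collect_less continuous_intros LIP_continuous_on[OF p])
    show "{x. f x \<noteq> 0} \<subseteq> {x. \<bar>p x - c\<bar> < d n}" using c d0 by auto
    show "q n x = 0" if "x \<in> {x. \<bar>p x - c\<bar> < d n}" for x
      using that by (auto simp: q_def abs_less_iff)
  qed
  have "(\<lambda>n. T f (q n # \<rho>)) \<longlonglongrightarrow> T f ((\<lambda>x. p x - c) # \<rho>)"
  proof (rule currents_hd_tendsto[OF f _ q(1) _ q(2)])
    show "(\<lambda>x. p x - c) \<in> LIP" by (intro LIP_diff p LIP_const)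
    show "(\<lambda>n. q n x) \<longlonglongrightarrow> p x - c" for x
    proof -
      have "(\<lambda>n. q n x) \<longlonglongrightarrow> max (p x - c - 0) 0 + min (p x - c + 0) 0"
        unfolding q_def by (intro tendsto_intros dlim)
      then show ?thesis by (simp add: max_def min_def split: if_splits)
    qed
  qed
  then have "T f ((\<lambda>x. p x - c) # \<rho>) = 0" by (simp add: zero LIMSEQ_const_iff)
  then show ?thesis using currents_hd_diff[OF f p LIP_const, of c] currents_hd_const[OF f] by simp
qed

lemma currents_hd_cong:
  assumes "f \<in> LIPb" "p \<in> LIP" "q \<in> LIP" "\<And>x. f x \<noteq> 0 \<Longrightarrow> p x = q x"
  shows "T f (p # \<rho>) = T f (q # \<rho>)"
  using currents_hd_local[OF assms(1) LIP_diff[OF assms(2,3)], of 0] currents_hd_diff[OF assms(1-3)] assms(4)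
  by simp

lemma currents_hd_bound:
  assumes "f \<in> LIPb" "p \<in> LIP" "Lip p \<le> L"
  shows "\<bar>T f (p # \<rho>)\<bar> \<le> L * (\<Prod>q\<leftarrow>\<rho>. Lip q) * (LINT x|mass_measure (Suc m) T. \<bar>f x\<bar>)"
proof -
  have "\<bar>T f (p # \<rho>)\<bar> \<le> (\<Prod>q\<leftarrow>p # \<rho>. Lip q) * (LINT x|mass_measure (Suc m) T. \<bar>f x\<bar>)"
    by (rule mass_boundD[OF mass_bound_mass_measure[OF T] assms(1)]) (use assms \<rho> in \<open>simp add: LIPs_Cons\<close>)
  also have "\<dots> \<le> L * (\<Prod>q\<leftarrow>\<rho>. Lip q) * (LINT x|mass_measure (Suc m) T. \<bar>f x\<bar>)"
    using assms(3) prod_Lip_nonneg[OF \<rho>] by (auto intro!: mult_right_mono)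
  finally show ?thesis .
qed

end

text \<open>Hat functions at the integers form a partition of unity. At \<open>y\<close> only the
  floor of \<open>y\<close> and its successor contribute, and the index range contains both.\<close>

lemma sum_tents:
  assumes "\<bar>y\<bar> \<le> real_of_int M"
  shows "(\<Sum>i\<in>{-M-1..M+1}. max 0 (1 - \<bar>y - real_of_int i\<bar>)) = 1"
proof -
  define j where "j = \<lfloor>y\<rfloor>"
  have j: "real_of_int j \<le> y" "y < real_of_int j + 1" unfolding j_def by linarith+
  have "-M - 1 \<le> j" "j \<le> M" using assms j by linarith+
  then have "(\<Sum>i\<in>{-M-1..M+1}. max 0 (1 - \<bar>y - real_of_int i\<bar>)) = (\<Sum>i\<in>{j, j+1}. max 0 (1 - \<bar>y - real_of_int i\<bar>))"
  proof (intro sum.mono_neutral_right ballI)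
    fix i assume "i \<in> {-M-1..M+1} - {j, j+1}"
    then have "i \<le> j - 1 \<or> i \<ge> j + 2" by auto
    then have "real_of_int i \<le> real_of_int j - 1 \<or> real_of_int i \<ge> real_of_int j + 2" by linarith
    then show "max 0 (1 - \<bar>y - real_of_int i\<bar>) = 0" using j by linarith
  qed auto
  also have "\<dots> = 1" using j by simp
  finally show ?thesis .
qed

context
  fixes T :: "'a::metric_space functional" and m :: nat and \<rho> :: "('a \<Rightarrow> real) list"
  assumes T: "T \<in> currents (Suc m)" and \<rho>: "\<rho> \<in> LIPs m"
begin

text \<open>Expand the square around \<open>t\<close>: the terms linear in \<open>g\<close> cancel
  between the two sides, and two quadratically small terms remain. Each is of order
  \<open>\<delta>\<close>, one by its Lipschitz constant, the other by the size of
  \<open>h x * (g x - t)\<close>; together they give the factor 4.\<close>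

lemma square_rule_local:
  assumes h: "h \<in> LIPb" and g: "g \<in> LIPb" and loc: "\<And>x. h x \<noteq> 0 \<Longrightarrow> \<bar>g x - t\<bar> \<le> \<delta>" and \<delta>: "\<delta> > 0"
  shows "\<bar>T h ((\<lambda>x. g x * g x) # \<rho>) - T (\<lambda>x. 2 * (h x * g x)) (g # \<rho>)\<bar>
    \<le> 4 * \<delta> * Lip g * (\<Prod>q\<leftarrow>\<rho>. Lip q) * (LINT x|mass_measure (Suc m) T. \<bar>h x\<bar>)"
proof -
  let ?P = "\<Prod>q\<leftarrow>\<rho>. Lip q" and ?\<mu> = "mass_measure (Suc m) T"
  note gL = LIPb_LIP[OF g]
  note fb = finite_borel_mass_measure[OF T]
  have P: "0 \<le> ?P" by (rule prod_Lip_nonneg[OF \<rho>])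
  have gt: "(\<lambda>x. g x - t) \<in> LIPb" by (intro LIPb_diff g LIPb_const)
  have hg: "(\<lambda>x. h x * (g x - t)) \<in> LIPb" by (rule LIPb_mult[OF h gt])
  \<comment> \<open>Truncation at \<open>\<delta>\<close> gives the square around \<open>t\<close> a
    Lipschitz constant of order \<open>\<delta>\<close>, and by locality it is invisible to
    \<open>T\<close> because nothing changes where \<open>h\<close> is nonzero.\<close>
  define q where "q x = (min \<bar>g x - t\<bar> \<delta>) * (min \<bar>g x - t\<bar> \<delta>)" for x
  have qL: "\<bar>q x - q y\<bar> \<le> (2 * \<delta> * Lip g) * dist x y" for x y
  proof -
    let ?a = "min \<bar>g x - t\<bar> \<delta>" and ?b = "min \<bar>g y - t\<bar> \<delta>"
    have "\<bar>q x - q y\<bar> = \<bar>(?a + ?b) * (?a - ?b)\<bar>" by (simp add: q_def algebra_simps)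
    also have "\<dots> = (?a + ?b) * \<bar>?a - ?b\<bar>" using \<delta> by (simp add: abs_mult)
    also have "\<dots> \<le> (2 * \<delta>) * \<bar>g x - g y\<bar>" using \<delta> by (intro mult_mono) auto
    also have "\<dots> \<le> (2 * \<delta>) * (Lip g * dist x y)" using \<delta> by (intro mult_left_mono Lip_bound_real gL) auto
    finally show ?thesis by simp
  qed
  have q: "q \<in> LIP" "Lip q \<le> 2 * \<delta> * Lip g"
    using LIP_realI[OF qL] Lip_le_real[OF qL] \<delta> Lip_nonneg[OF gL] by auto
  have gg: "(\<lambda>x. (g x - t) * (g x - t)) \<in> LIP" by (rule LIPb_LIP[OF LIPb_mult[OF gt gt]])
  have "T h (q # \<rho>) = T h ((\<lambda>x. (g x - t) * (g x - t)) # \<rho>)"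
  proof (rule currents_hd_cong[OF T \<rho> h q(1) gg])
    fix x assume "h x \<noteq> 0"
    then have "min \<bar>g x - t\<bar> \<delta> = \<bar>g x - t\<bar>" using loc by simp
    then show "q x = (g x - t) * (g x - t)" by (simp add: q_def)
  qed
  also have "(\<lambda>x. (g x - t) * (g x - t)) = (\<lambda>x. (g x * g x) - ((2 * t) * g x - t * t))"
    by (simp add: fun_eq_iff algebra_simps)
  also have "T h (\<dots> # \<rho>) = T h ((\<lambda>x. g x * g x) # \<rho>) - T h ((\<lambda>x. (2 * t) * g x - t * t) # \<rho>)"
    by (intro currents_hd_diff[OF T \<rho> h] LIPb_LIP[OF LIPb_mult] LIP_diff LIP_cmult LIP_const g gL)
  also have "T h ((\<lambda>x. (2 * t) * g x - t * t) # \<rho>) = 2 * t * T h (g # \<rho>)"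
    using currents_hd_diff[OF T \<rho> h LIP_cmult[OF gL] LIP_const, of "2 * t" "t * t"]
      currents_hd_const[OF T \<rho> h] currents_hd_cmult[OF T \<rho> h gL] by simp
  finally have 1: "T h ((\<lambda>x. g x * g x) # \<rho>) = T h (q # \<rho>) + 2 * t * T h (g # \<rho>)" by simp
  have \<pi>: "g # \<rho> \<in> LIPs (Suc m)" using gL \<rho> by (simp add: LIPs_Cons)
  have "(\<lambda>x. 2 * (h x * g x)) = (\<lambda>x. 2 * (h x * (g x - t)) + (2 * t) * h x)"
    by (simp add: fun_eq_iff algebra_simps)
  then have 2: "T (\<lambda>x. 2 * (h x * g x)) (g # \<rho>) = 2 * T (\<lambda>x. h x * (g x - t)) (g # \<rho>) + 2 * t * T h (g # \<rho>)"
    using currents_lincomb[OF T hg h \<pi>, of 2 "2 * t"] by simp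
  have "\<bar>T (\<lambda>x. h x * (g x - t)) (g # \<rho>)\<bar> \<le> Lip g * ?P * (LINT x|?\<mu>. \<bar>h x * (g x - t)\<bar>)"
    by (rule currents_hd_bound[OF T \<rho> hg gL order_refl])
  also have "\<dots> \<le> Lip g * ?P * (LINT x|?\<mu>. \<delta> * \<bar>h x\<bar>)"
  proof (rule mult_left_mono[OF integral_mono])
    show "\<bar>h x * (g x - t)\<bar> \<le> \<delta> * \<bar>h x\<bar>" for x
      using loc[of x] by (cases "h x = 0") (auto simp: abs_mult mult.commute intro: mult_left_mono)
  qed (use LIPb_integrable[OF h fb] LIPb_integrable[OF hg fb] P Lip_nonneg[OF gL] in auto)
  finally have 3: "\<bar>T (\<lambda>x. h x * (g x - t)) (g # \<rho>)\<bar> \<le> \<delta> * Lip g * ?P * (LINT x|?\<mu>. \<bar>h x\<bar>)"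
    by (simp add: mult_ac)
  have 4: "\<bar>T h (q # \<rho>)\<bar> \<le> 2 * \<delta> * Lip g * ?P * (LINT x|?\<mu>. \<bar>h x\<bar>)"
    by (rule currents_hd_bound[OF T \<rho> h q])
  have "T h ((\<lambda>x. g x * g x) # \<rho>) - T (\<lambda>x. 2 * (h x * g x)) (g # \<rho>)
      = T h (q # \<rho>) - 2 * T (\<lambda>x. h x * (g x - t)) (g # \<rho>)"
    using 1 2 by simp
  then show ?thesis using 3 4 by linarith
qed

text \<open>Cut \<open>h\<close> by hat functions of the value of \<open>g\<close> at mesh
  \<open>\<delta>\<close>. On each part the local rule has an error proportional to
  \<open>\<delta>\<close> times the integral of that part; the hats sum to 1, so the total error is
  of order \<open>\<delta>\<close> for every \<open>\<delta>\<close>.\<close>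

lemma square_rule:
  assumes h: "h \<in> LIPb" and g: "g \<in> LIPb"
  shows "T h ((\<lambda>x. g x * g x) # \<rho>) = T (\<lambda>x. 2 * (h x * g x)) (g # \<rho>)"
proof -
  let ?P = "\<Prod>q\<leftarrow>\<rho>. Lip q" and ?\<mu> = "mass_measure (Suc m) T"
  define D where "D h = T h ((\<lambda>x. g x * g x) # \<rho>) - T (\<lambda>x. 2 * (h x * g x)) (g # \<rho>)" for h
  note gL = LIPb_LIP[OF g]
  note fb = finite_borel_mass_measure[OF T]
  have P: "0 \<le> ?P" by (rule prod_Lip_nonneg[OF \<rho>])
  have \<pi>: "g # \<rho> \<in> LIPs (Suc m)" "(\<lambda>x. g x * g x) # \<rho> \<in> LIPs (Suc m)"
    using gL \<rho> LIPb_LIP[OF LIPb_mult[OF g g]] by (auto simp: LIPs_Cons)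
  have Dadd: "D (\<lambda>x. a x + b x) = D a + D b" if ab: "a \<in> LIPb" "b \<in> LIPb" for a b
  proof -
    have "(\<lambda>x. 2 * ((a x + b x) * g x)) = (\<lambda>x. 2 * (a x * g x) + 2 * (b x * g x))"
      by (simp add: fun_eq_iff algebra_simps)
    then show ?thesis
      using currents_add[OF T ab \<pi>(2)]
        currents_lincomb[OF T LIPb_mult[OF ab(1) g] LIPb_mult[OF ab(2) g] \<pi>(1), of 2 2]
        currents_cmult[OF T LIPb_mult[OF ab(1) g] \<pi>(1), of 2] currents_cmult[OF T LIPb_mult[OF ab(2) g] \<pi>(1), of 2]
      by (simp add: D_def)
  qed
  have D0: "D (\<lambda>_. 0) = 0"
    using Dadd[of "\<lambda>_. 0" "\<lambda>_. 0"] LIPb_const[of 0] by simp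
  have Dsum: "D (\<lambda>x. \<Sum>i\<in>A. a i x) = (\<Sum>i\<in>A. D (a i))" if "\<And>i. a i \<in> LIPb" for A :: "int set" and a
    by (induction A rule: infinite_finite_induct) (simp_all add: D0 Dadd LIPb_sum that)
  obtain B where B: "0 < B" "\<And>x. \<bar>g x\<bar> \<le> B" using LIPb_bound[OF g] by metis
  have "\<bar>D h\<bar> \<le> 0 + (4 * Lip g * ?P * (LINT x|?\<mu>. \<bar>h x\<bar>)) * \<delta>" if \<delta>: "\<delta> > 0" for \<delta>
  proof -
    \<comment> \<open>\<open>M\<close> bounds the rescaled values \<open>g x / \<delta>\<close>, so
      that the finitely many hats indexed by \<open>I\<close> already sum to 1 everywhere.\<close>
    define M where "M = \<lceil>B / \<delta>\<rceil>"
    define I where "I = {-M-1..M+1}"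
    define \<eta> where "\<eta> i x = max 0 (1 - \<bar>g x / \<delta> - real_of_int i\<bar>)" for i x
    have sum1: "(\<Sum>i\<in>I. \<eta> i x) = 1" for x
    proof -
      have "\<bar>g x / \<delta>\<bar> \<le> B / \<delta>" using B(2)[of x] \<delta> by (simp add: abs_divide divide_right_mono)
      then have "\<bar>g x / \<delta>\<bar> \<le> real_of_int M" unfolding M_def by linarith
      then show ?thesis unfolding \<eta>_def I_def by (rule sum_tents)
    qed
    have \<eta>L: "\<eta> i \<in> LIPb" for i
    proof (rule LIPbI[of _ 1])
      have "(\<lambda>x. (1 / \<delta>) * g x - real_of_int i) \<in> LIP" by (intro LIP_diff LIP_cmult LIP_const gL)
      then have abs: "(\<lambda>x. \<bar>g x / \<delta> - real_of_int i\<bar>) \<in> LIP" using LIP_abs by fastforce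
      show "\<eta> i \<in> LIP" unfolding \<eta>_def by (rule LIP_max[OF LIP_const LIP_diff[OF LIP_const abs]])
    qed (auto simp: \<eta>_def)
    have \<eta>0: "0 \<le> \<eta> i x" for i x by (simp add: \<eta>_def)
    have h\<eta>: "(\<lambda>x. h x * \<eta> i x) \<in> LIPb" for i by (rule LIPb_mult[OF h \<eta>L])
    have "h = (\<lambda>x. \<Sum>i\<in>I. h x * \<eta> i x)" using sum1 by (simp add: sum_distrib_left[symmetric])
    then have "D h = (\<Sum>i\<in>I. D (\<lambda>x. h x * \<eta> i x))" using Dsum[of "\<lambda>i x. h x * \<eta> i x", OF h\<eta>] by metis
    then have "\<bar>D h\<bar> \<le> (\<Sum>i\<in>I. \<bar>D (\<lambda>x. h x * \<eta> i x)\<bar>)" by simp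
    also have "\<dots> \<le> (\<Sum>i\<in>I. 4 * \<delta> * Lip g * ?P * (LINT x|?\<mu>. \<bar>h x * \<eta> i x\<bar>))"
    proof (rule sum_mono)
      fix i
      show "\<bar>D (\<lambda>x. h x * \<eta> i x)\<bar> \<le> 4 * \<delta> * Lip g * ?P * (LINT x|?\<mu>. \<bar>h x * \<eta> i x\<bar>)"
        unfolding D_def
      proof (rule square_rule_local[OF h\<eta> g _ \<delta>, where t = "real_of_int i * \<delta>"])
        fix x assume "h x * \<eta> i x \<noteq> 0"
        then have "\<bar>g x / \<delta> - real_of_int i\<bar> < 1" by (auto simp: \<eta>_def max_def split: if_splits)
        then have "\<bar>g x / \<delta> - real_of_int i\<bar> * \<delta> \<le> 1 * \<delta>" using \<delta> by (intro mult_right_mono) auto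
        also have "\<bar>g x / \<delta> - real_of_int i\<bar> * \<delta> = \<bar>(g x / \<delta> - real_of_int i) * \<delta>\<bar>" using \<delta> by (simp add: abs_mult)
        also have "(g x / \<delta> - real_of_int i) * \<delta> = g x - real_of_int i * \<delta>" using \<delta> by (simp add: field_simps)
        finally show "\<bar>g x - real_of_int i * \<delta>\<bar> \<le> \<delta>" by simp
      qed
    qed
    also have "\<dots> = 4 * \<delta> * Lip g * ?P * (\<Sum>i\<in>I. (LINT x|?\<mu>. \<bar>h x * \<eta> i x\<bar>))"
      by (simp add: sum_distrib_left)
    also have "(\<Sum>i\<in>I. (LINT x|?\<mu>. \<bar>h x * \<eta> i x\<bar>)) = (LINT x|?\<mu>. (\<Sum>i\<in>I. \<bar>h x * \<eta> i x\<bar>))"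
      by (rule Bochner_Integration.integral_sum[symmetric]) (use LIPb_integrable[OF h\<eta> fb] in auto)
    also have "\<dots> = (LINT x|?\<mu>. \<bar>h x\<bar>)"
      by (simp add: abs_mult \<eta>0 sum_distrib_left[symmetric] sum1)
    finally show ?thesis by (simp add: mult_ac)
  qed
  moreover have "0 \<le> 4 * Lip g * ?P * (LINT x|?\<mu>. \<bar>h x\<bar>)"
    using P Lip_nonneg[OF gL] by (intro mult_nonneg_nonneg) auto
  ultimately have "\<bar>D h\<bar> \<le> 0" by (rule le_epsilon_mult)
  then show ?thesis by (simp add: D_def)
qed

text \<open>Polarisation: apply the square rule with \<open>h = 1\<close> to \<open>f + g\<close>,
  \<open>f\<close> and \<open>g\<close>, and compare.\<close>

lemma product_rule:
  assumes f: "f \<in> LIPb" and g: "g \<in> LIPb"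
  shows "T (\<lambda>_. 1) ((\<lambda>x. f x * g x) # \<rho>) = T f (g # \<rho>) + T g (f # \<rho>)"
proof -
  note fL = LIPb_LIP[OF f] and gL = LIPb_LIP[OF g]
  have sq: "T (\<lambda>_. 1) ((\<lambda>x. p x * p x) # \<rho>) = 2 * T p (p # \<rho>)" if p: "p \<in> LIPb" for p
    using square_rule[OF LIPb_const[of 1] p] currents_cmult[OF T p, of "p # \<rho>" 2] LIPb_LIP[OF p] \<rho>
    by (simp add: LIPs_Cons)
  have fg: "(\<lambda>x. f x + g x) \<in> LIPb" by (rule LIPb_add[OF f g])
  have "T (\<lambda>x. f x + g x) ((\<lambda>x. f x + g x) # \<rho>) = T f ((\<lambda>x. f x + g x) # \<rho>) + T g ((\<lambda>x. f x + g x) # \<rho>)"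
    by (rule currents_add[OF T f g]) (use LIPb_LIP[OF fg] \<rho> in \<open>simp add: LIPs_Cons\<close>)
  then have 1: "T (\<lambda>x. f x + g x) ((\<lambda>x. f x + g x) # \<rho>)
      = T f (f # \<rho>) + T f (g # \<rho>) + T g (f # \<rho>) + T g (g # \<rho>)"
    using currents_hd_add[OF T \<rho> f fL gL] currents_hd_add[OF T \<rho> g fL gL] by simp
  have fgm: "(\<lambda>x. f x * g x) \<in> LIP" by (rule LIPb_LIP[OF LIPb_mult[OF f g]])
  have "(\<lambda>x. (f x + g x) * (f x + g x)) = (\<lambda>x. 2 * (f x * g x) + (f x * f x + g x * g x))"
    by (simp add: fun_eq_iff algebra_simps)
  then have "T (\<lambda>_. 1) ((\<lambda>x. (f x + g x) * (f x + g x)) # \<rho>)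
      = T (\<lambda>_. 1) ((\<lambda>x. 2 * (f x * g x)) # \<rho>) + T (\<lambda>_. 1) ((\<lambda>x. f x * f x + g x * g x) # \<rho>)"
    using currents_hd_add[OF T \<rho> LIPb_const LIP_cmult[OF fgm] LIP_add[OF LIPb_LIP[OF LIPb_mult[OF f f]] LIPb_LIP[OF LIPb_mult[OF g g]]]]
    by simp
  also have "T (\<lambda>_. 1) ((\<lambda>x. f x * f x + g x * g x) # \<rho>) = 2 * T f (f # \<rho>) + 2 * T g (g # \<rho>)"
    using currents_hd_add[OF T \<rho> LIPb_const LIPb_LIP[OF LIPb_mult[OF f f]] LIPb_LIP[OF LIPb_mult[OF g g]]]
      sq[OF f] sq[OF g] by simp
  also have "T (\<lambda>_. 1) ((\<lambda>x. 2 * (f x * g x)) # \<rho>) = 2 * T (\<lambda>_. 1) ((\<lambda>x. f x * g x) # \<rho>)"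
    by (rule currents_hd_cmult[OF T \<rho> LIPb_const fgm])
  finally show ?thesis using sq[OF fg] 1 by simp
qed

end


subsection \<open>Translation estimates\<close>

lemma nn_integral_lborel_shift:
  fixes c :: "'b::euclidean_space"
  assumes [measurable]: "g \<in> borel_measurable borel"
  shows "(\<integral>\<^sup>+x. g (x + c) \<partial>lborel) = (\<integral>\<^sup>+x. g x \<partial>lborel)"
proof -
  have "(\<integral>\<^sup>+x. g x \<partial>lborel) = (\<integral>\<^sup>+x. g x \<partial>distr lborel borel ((+) c))" by (simp add: lborel_distr_plus)
  also have "\<dots> = (\<integral>\<^sup>+x. g (c + x) \<partial>lborel)" by (rule nn_integral_distr) auto
  finally show ?thesis by (simp add: add.commute)
qed

lemma integral_lborel_shift:
  fixes c :: "'b::euclidean_space" and g :: "'b \<Rightarrow> real"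
  assumes [measurable]: "g \<in> borel_measurable borel"
  shows "(LINT x|lborel. g (x + c)) = (LINT x|lborel. g x)"
proof -
  have "(LINT x|lborel. g x) = (LINT x|distr lborel borel ((+) c). g x)" by (simp add: lborel_distr_plus)
  also have "\<dots> = (LINT x|lborel. g (c + x))" by (rule integral_distr) auto
  finally show ?thesis by (simp add: add.commute)
qed

lemma integrable_lborel_shift:
  fixes c :: "'b::euclidean_space" and g :: "'b \<Rightarrow> real"
  assumes g: "integrable lborel g"
  shows "integrable lborel (\<lambda>x. g (x + c))"
proof -
  have [measurable]: "g \<in> borel_measurable borel" using borel_measurable_integrable[OF g] by simp
  have "integrable (distr lborel borel ((+) c)) g" using g by (simp add: lborel_distr_plus)
  then have "integrable lborel (\<lambda>x. g (c + x))" by (subst (asm) integrable_distr_eq) auto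
  then show ?thesis by (simp add: add.commute)
qed

text \<open>Averaging \<open>f\<close> along a segment in direction \<open>j\<close> gives a bounded Lipschitz primitive of
  \<open>f - f (\<cdot> - t e\<^sub>j)\<close>.\<close>

definition segment_average :: "'n::finite \<Rightarrow> real \<Rightarrow> (real ^ 'n \<Rightarrow> real) \<Rightarrow> real ^ 'n \<Rightarrow> real" where
  "segment_average j t f x = integral {0..t} (\<lambda>s. f (x - s *\<^sub>R axis j 1))"

context
  fixes f :: "real ^ 'n::finite \<Rightarrow> real" and t :: real and j :: 'n
  assumes f: "f \<in> LIPb" and t: "0 \<le> t"
begin

lemma line_continuous: "continuous_on A (\<lambda>s. f (x - s *\<^sub>R axis j 1))"
  by (intro continuous_on_compose2[OF LIP_continuous_on[OF LIPb_LIP[OF f], of UNIV]] continuous_intros) auto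

lemma line_integrable: "(\<lambda>s. f (x - s *\<^sub>R axis j 1)) integrable_on {0..t}"
  by (rule integrable_continuous_real[OF line_continuous])

lemma segment_average_bound:
  assumes "\<And>x. \<bar>f x\<bar> \<le> C"
  shows "\<bar>segment_average j t f x\<bar> \<le> C * t"
proof -
  have "norm (integral {0..t} (\<lambda>s. f (x - s *\<^sub>R axis j 1))) \<le> C * (t - 0)"
    by (rule integral_bound[OF t line_continuous]) (use assms in simp)
  then show ?thesis by (simp add: segment_average_def)
qed

lemma segment_average_LIPb: "segment_average j t f \<in> LIPb"
proof -
  obtain C where C: "\<And>x. \<bar>f x\<bar> \<le> C" using LIPb_bound[OF f] by metis
  show ?thesis
  proof (rule LIPbI[OF LIP_realI segment_average_bound[OF C]])
    fix x y
    have "segment_average j t f x - segment_average j t f y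
      = integral {0..t} (\<lambda>s. f (x - s *\<^sub>R axis j 1) - f (y - s *\<^sub>R axis j 1))"
      unfolding segment_average_def by (rule integral_diff[symmetric, OF line_integrable line_integrable])
    moreover have "norm (integral {0..t} (\<lambda>s. f (x - s *\<^sub>R axis j 1) - f (y - s *\<^sub>R axis j 1)))
      \<le> (Lip f * dist x y) * (t - 0)"
    proof (rule integral_bound[OF t])
      fix s
      show "norm (f (x - s *\<^sub>R axis j 1) - f (y - s *\<^sub>R axis j 1)) \<le> Lip f * dist x y"
        using Lip_bound_real[OF LIPb_LIP[OF f], of "x - s *\<^sub>R axis j 1" "y - s *\<^sub>R axis j 1"] by (simp add: dist_norm)
    qed (intro continuous_on_diff line_continuous)
    ultimately show "\<bar>segment_average j t f x - segment_average j t f y\<bar> \<le> (Lip f * t) * dist x y"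
      by (simp add: mult_ac)
  qed
qed

lemma partial_deriv_segment_average:
  "partial_deriv j (segment_average j t f) x = f x - f (x - t *\<^sub>R axis j 1)"
proof -
  define \<phi> where "\<phi> v = f (x + v *\<^sub>R axis j 1)" for v
  \<comment> \<open>The lower limit \<open>- t - 1\<close> leaves room around both 0 and
    \<open>- t\<close>, the two points at which \<open>\<Phi>\<close> is differentiated.\<close>
  define \<Phi> where "\<Phi> v = integral {- t - 1..v} \<phi>" for v
  have c: "continuous_on A \<phi>" for A
    unfolding \<phi>_def
    by (intro continuous_on_compose2[OF LIP_continuous_on[OF LIPb_LIP[OF f], of UNIV]] continuous_intros) auto
  have \<Phi>': "(\<Phi> has_real_derivative \<phi> v) (at v)" if v: "- t - 1 < v" "v < 1" for v
  proof -
    have "(\<Phi> has_real_derivative \<phi> v) (at v within {- t - 1..1})"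
      unfolding \<Phi>_def by (rule integral_has_real_derivative[OF c]) (use v in auto)
    moreover have "at v within {- t - 1..1} = at v" using v by (intro at_within_interior) auto
    ultimately show ?thesis by simp
  qed
  have eq: "segment_average j t f (x + v *\<^sub>R axis j 1) = \<Phi> v - \<Phi> (v - t)" if v: "v \<in> {-1<..<1}" for v
  proof -
    have "((\<lambda>s. \<phi> (v - s)) has_integral (- \<Phi> (v - t)) - (- \<Phi> (v - 0))) {0..t}"
    proof (rule fundamental_theorem_of_calculus[OF t])
      fix s assume s: "s \<in> {0..t}"
      have "((\<lambda>s. - \<Phi> (v - s)) has_real_derivative \<phi> (v - s)) (at s)"
        using v s by (auto intro!: derivative_eq_intros DERIV_chain2[OF \<Phi>'])
      then show "((\<lambda>s. - \<Phi> (v - s)) has_vector_derivative \<phi> (v - s)) (at s within {0..t})"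
        by (simp add: has_real_derivative_iff_has_vector_derivative has_vector_derivative_at_within)
    qed
    then have "integral {0..t} (\<lambda>s. \<phi> (v - s)) = \<Phi> v - \<Phi> (v - t)" by (simp add: integral_unique)
    then show ?thesis by (simp add: segment_average_def \<phi>_def algebra_simps)
  qed
  have "((\<lambda>v. \<Phi> v - \<Phi> (v - t)) has_real_derivative \<phi> 0 - \<phi> (0 - t)) (at 0)"
    using t by (auto intro!: derivative_eq_intros \<Phi>' DERIV_chain2[OF \<Phi>'])
  then have "((\<lambda>v. segment_average j t f (x + v *\<^sub>R axis j 1)) has_real_derivative \<phi> 0 - \<phi> (0 - t)) (at 0)"
    by (rule has_field_derivative_transform_within_open[of _ _ _ "{-1<..<1}"]) (auto simp: eq)
  then show ?thesis unfolding partial_deriv_def by (simp add: DERIV_imp_deriv \<phi>_def)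
qed

end

section \<open>Translation of functions of bounded variation; integer values\<close>

context
  fixes u :: "real ^ 'n::finite \<Rightarrow> real" and P :: real
  assumes u: "integrable lborel u" "u \<in> borel_measurable borel"
    and var: "\<And>\<psi> C j. \<psi> \<in> LIPb \<Longrightarrow> (\<And>x. \<bar>\<psi> x\<bar> \<le> C) \<Longrightarrow>
      \<bar>LINT x|lborel. u x * partial_deriv j \<psi> x\<bar> \<le> P * C"
begin

lemma variation_bound_nonneg: "0 \<le> P"
proof -
  have "\<bar>LINT x|lborel. u x * partial_deriv undefined (\<lambda>_. 0) x\<bar> \<le> P * 1"
    by (rule var[OF LIPb_const]) simp
  then show ?thesis by linarith
qed

text \<open>By duality it suffices to test with bounded Lipschitz \<open>f\<close>. Changing
  variables moves the shift onto \<open>f\<close>, and the resulting difference is minus the partial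
  derivative of its segment average, a function bounded by \<open>t\<close>.\<close>

lemma axis_translation_L1:
  assumes t: "0 \<le> t"
  shows "(LINT x|lborel. \<bar>u (x + t *\<^sub>R axis j 1) - u x\<bar>) \<le> P * t"
proof (rule L1_norm_dual_le)
  let ?e = "t *\<^sub>R axis j (1::real) :: real ^ 'n"
  note [measurable] = u(2)
  show "integrable lborel (\<lambda>x. u (x + ?e) - u x)"
    by (intro Bochner_Integration.integrable_diff integrable_lborel_shift u(1))
  fix f :: "real ^ 'n \<Rightarrow> real" assume f: "f \<in> LIPb" and f1: "\<And>x. \<bar>f x\<bar> \<le> 1"
  have [measurable]: "f \<in> borel_measurable borel" using LIP_measurable[OF LIPb_LIP[OF f]] by simp
  have i: "integrable lborel (\<lambda>x. u x * f (x + c))" for c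
    by (rule Bochner_Integration.integrable_bound[OF u(1)]) (auto simp: abs_mult intro!: mult_left_le f1)
  have i2: "integrable lborel (\<lambda>x. u (x + ?e) * f x)"
    using integrable_lborel_shift[OF i[of "- ?e"], of ?e] by simp
  have "(LINT x|lborel. (u (x + ?e) - u x) * f x) = (LINT x|lborel. u (x + ?e) * f x - u x * f x)"
    by (simp add: algebra_simps)
  also have "\<dots> = (LINT x|lborel. u (x + ?e) * f x) - (LINT x|lborel. u x * f x)"
    using i2 i[of 0] by simp
  also have "(LINT x|lborel. u (x + ?e) * f x) = (LINT x|lborel. u x * f (x + - ?e))"
    using integral_lborel_shift[of "\<lambda>x. u x * f (x + - ?e)" ?e] by simp
  also have "(LINT x|lborel. u x * f (x + - ?e)) - (LINT x|lborel. u x * f x)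
      = (LINT x|lborel. u x * f (x + - ?e) - u x * f x)"
    using i[of "- ?e"] i[of 0] by simp
  also have "\<dots> = (LINT x|lborel. - (u x * partial_deriv j (segment_average j t f) x))"
    by (simp add: partial_deriv_segment_average[OF f t] algebra_simps)
  also have "\<bar>\<dots>\<bar> \<le> P * (1 * t)"
    using var[OF segment_average_LIPb[OF f t] segment_average_bound[OF f t f1]] by simp
  finally show "\<bar>LINT x|lborel. (u (x + ?e) - u x) * f x\<bar> \<le> P * t" by simp
qed

text \<open>Telescopes the translation over the coordinate directions; each step is an axis
  translation, since the integral is invariant under the shifts already made.\<close>

lemma box_translation_L1:
  assumes r: "\<And>j. 0 \<le> h $ j" "\<And>j. h $ j \<le> r"
  shows "(\<integral>\<^sup>+x. ennreal \<bar>u (x + h) - u x\<bar> \<partial>lborel) \<le> ennreal (real CARD('n) * r * P)"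
proof -
  note [measurable] = u(2)
  have "(\<integral>\<^sup>+x. ennreal \<bar>u (x + (\<Sum>j\<in>A. (h $ j) *\<^sub>R axis j 1)) - u x\<bar> \<partial>lborel) \<le> ennreal (\<Sum>j\<in>A. P * h $ j)"
    if "finite A" for A
    using that
  proof (induction A rule: finite_induct)
    case (insert j A)
    let ?s = "\<Sum>j\<in>A. (h $ j) *\<^sub>R axis j (1::real)" and ?e = "(h $ j) *\<^sub>R axis j (1::real)"
    have "(\<integral>\<^sup>+x. ennreal \<bar>u (x + (\<Sum>j\<in>insert j A. (h $ j) *\<^sub>R axis j 1)) - u x\<bar> \<partial>lborel)
      \<le> (\<integral>\<^sup>+x. ennreal \<bar>u (x + ?s + ?e) - u (x + ?s)\<bar> + ennreal \<bar>u (x + ?s) - u x\<bar> \<partial>lborel)"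
    proof (rule nn_integral_mono)
      fix x
      have "(x + (\<Sum>j\<in>insert j A. (h $ j) *\<^sub>R axis j 1)) = x + ?s + ?e" using insert by (simp add: add_ac)
      then show "ennreal \<bar>u (x + (\<Sum>j\<in>insert j A. (h $ j) *\<^sub>R axis j 1)) - u x\<bar>
        \<le> ennreal \<bar>u (x + ?s + ?e) - u (x + ?s)\<bar> + ennreal \<bar>u (x + ?s) - u x\<bar>"
        by (simp only: ennreal_plus[symmetric] abs_ge_zero) (intro ennreal_leI, linarith)
    qed
    also have "\<dots> = (\<integral>\<^sup>+x. ennreal \<bar>u (x + ?s + ?e) - u (x + ?s)\<bar> \<partial>lborel) + (\<integral>\<^sup>+x. ennreal \<bar>u (x + ?s) - u x\<bar> \<partial>lborel)"
      by (rule nn_integral_add) measurable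
    also have "(\<integral>\<^sup>+x. ennreal \<bar>u (x + ?s + ?e) - u (x + ?s)\<bar> \<partial>lborel) = (\<integral>\<^sup>+x. ennreal \<bar>u (x + ?e) - u x\<bar> \<partial>lborel)"
      by (rule nn_integral_lborel_shift) measurable
    also have "\<dots> = ennreal (LINT x|lborel. \<bar>u (x + ?e) - u x\<bar>)"
      by (rule nn_integral_eq_integral) (auto intro!: integrable_abs Bochner_Integration.integrable_diff integrable_lborel_shift u(1))
    also have "\<dots> + (\<integral>\<^sup>+x. ennreal \<bar>u (x + ?s) - u x\<bar> \<partial>lborel) \<le> ennreal (P * h $ j) + ennreal (\<Sum>j\<in>A. P * h $ j)"
      by (intro add_mono ennreal_leI axis_translation_L1 r(1) insert.IH)
    also have "\<dots> = ennreal (\<Sum>j\<in>insert j A. P * h $ j)"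
      using insert r(1) variation_bound_nonneg by (simp add: ennreal_plus[symmetric] sum_nonneg del: ennreal_plus)
    finally show ?case .
  qed simp
  from this[of UNIV] have "(\<integral>\<^sup>+x. ennreal \<bar>u (x + h) - u x\<bar> \<partial>lborel) \<le> ennreal (\<Sum>j\<in>UNIV. P * h $ j)"
    using basis_expansion[of h] by (simp add: scalar_mult_eq_scaleR)
  also have "(\<Sum>j\<in>UNIV. P * h $ j) \<le> (\<Sum>j\<in>(UNIV :: 'n set). P * r)"
    by (intro sum_mono mult_left_mono r variation_bound_nonneg)
  then have "ennreal (\<Sum>j\<in>UNIV. P * h $ j) \<le> ennreal (real CARD('n) * r * P)"
    by (intro ennreal_leI) (simp add: mult_ac)
  finally show ?thesis .
qed

text \<open>Since \<open>\<bar>{u \<noteq> 0}\<bar> \<le> \<parallel>u\<parallel>\<^sub>1 \<le> r\<^sup>k / 2\<close>, at least half of the translates of \<open>x\<close> by the cube of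
  side \<open>r\<close> are zeros of \<open>u\<close>.\<close>

lemma integer_valued_L1_le:
  assumes Z: "\<And>x. u x \<in> \<int>" and r: "0 < r" "2 * (LINT x|lborel. \<bar>u x\<bar>) \<le> r ^ CARD('n)"
  shows "(LINT x|lborel. \<bar>u x\<bar>) \<le> 2 * real CARD('n) * r * P"
proof -
  note [measurable] = u(2)
  define c where "c = r ^ CARD('n)"
  have c: "c > 0" using r by (simp add: c_def)
  define Q where "Q = cbox (0 :: real ^ 'n) (\<chi> i. r)"
  have [measurable]: "Q \<in> sets borel" by (simp add: Q_def)
  have Qiff: "h \<in> Q \<longleftrightarrow> (\<forall>j. 0 \<le> h $ j \<and> h $ j \<le> r)" for h by (simp add: Q_def mem_box_cart)
  have "measure lborel Q = (\<Prod>i\<in>(UNIV :: 'n set). r)"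
    unfolding Q_def by (subst content_cbox_cart) (use r in \<open>auto simp: interval_ne_empty_cart\<close>)
  then have mQ: "emeasure lborel Q = ennreal c"
    unfolding c_def Q_def
    using emeasure_eq_ennreal_measure[of lborel "cbox (0 :: real ^ 'n) (\<chi> i. r)"]
      emeasure_lborel_cbox_finite[of "0 :: real ^ 'n" "\<chi> i. r"] by (simp add: less_top)
  define \<Theta> where "\<Theta> = (LINT x|lborel. \<bar>u x\<bar>)"
  have \<Theta>nn: "(\<integral>\<^sup>+x. ennreal \<bar>u x\<bar> \<partial>lborel) = ennreal \<Theta>"
    unfolding \<Theta>_def using u(1) by (intro nn_integral_eq_integral) auto
  have u1: "1 \<le> \<bar>u x\<bar>" if "u x \<noteq> 0" for x using Z[of x] that by (auto elim!: Ints_cases)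
  have half: "ennreal (c / 2) \<le> emeasure lborel {h \<in> Q. u (x + h) = 0}" for x
  proof -
    have "emeasure lborel {h. u (h + x) \<noteq> 0} = (\<integral>\<^sup>+h. indicator {h. u (h + x) \<noteq> 0} h \<partial>lborel)"
      by (rule nn_integral_indicator[symmetric]) simp
    also have "\<dots> = (\<integral>\<^sup>+h. indicator {h. u h \<noteq> 0} (h + x) \<partial>lborel)"
      by (rule nn_integral_cong) (simp split: split_indicator)
    also have "\<dots> = (\<integral>\<^sup>+h. indicator {h. u h \<noteq> 0} h \<partial>lborel)" by (rule nn_integral_lborel_shift) measurable
    also have "\<dots> \<le> (\<integral>\<^sup>+h. ennreal \<bar>u h\<bar> \<partial>lborel)"
      using u1 by (intro nn_integral_mono) (auto split: split_indicator simp: one_ennreal_def[symmetric] ennreal_1[symmetric] simp del: ennreal_1 intro!: ennreal_leI)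
    also have "\<dots> \<le> ennreal (c / 2)" unfolding \<Theta>nn using r(2) by (intro ennreal_leI) (simp add: c_def \<Theta>_def)
    finally have small: "emeasure lborel {h. u (x + h) \<noteq> 0} \<le> ennreal (c / 2)" by (simp add: add.commute)
    have "ennreal (c / 2) + ennreal (c / 2) = emeasure lborel Q"
      using c by (simp add: mQ ennreal_plus[symmetric] del: ennreal_plus)
    also have "\<dots> \<le> emeasure lborel ({h \<in> Q. u (x + h) = 0} \<union> {h. u (x + h) \<noteq> 0})"
      by (rule emeasure_mono) auto
    also have "\<dots> \<le> emeasure lborel {h \<in> Q. u (x + h) = 0} + emeasure lborel {h. u (x + h) \<noteq> 0}"
      by (rule emeasure_subadditive) measurable
    also have "\<dots> \<le> emeasure lborel {h \<in> Q. u (x + h) = 0} + ennreal (c / 2)"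
      using small by (rule add_left_mono)
    finally show ?thesis by (simp add: ennreal_add_left_cancel_le add.commute)
  qed
  \<comment> \<open>Wherever \<open>u (x + h) = 0\<close> the difference
    \<open>\<bar>u (x + h) - u x\<bar>\<close> equals \<open>\<bar>u x\<bar>\<close>. For each
    \<open>x\<close> this happens for \<open>h\<close> in at least half of \<open>Q\<close>, so the
    average over \<open>Q\<close> of the translation norms is at least half of
    \<open>\<Theta>\<close>. Fubini then lets the translation estimate be applied for each
    \<open>h\<close>.\<close>
  have "ennreal (c / 2) * ennreal \<Theta> = (\<integral>\<^sup>+x. ennreal (c / 2) * ennreal \<bar>u x\<bar> \<partial>lborel)"
    by (simp add: nn_integral_cmult \<Theta>nn)
  also have "\<dots> \<le> (\<integral>\<^sup>+x. (\<integral>\<^sup>+h. indicator Q h * ennreal \<bar>u (x + h) - u x\<bar> \<partial>lborel) \<partial>lborel)"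
  proof (rule nn_integral_mono)
    fix x
    have "ennreal (c / 2) * ennreal \<bar>u x\<bar> \<le> emeasure lborel {h \<in> Q. u (x + h) = 0} * ennreal \<bar>u x\<bar>"
      by (intro mult_right_mono half) simp
    also have "\<dots> = (\<integral>\<^sup>+h. ennreal \<bar>u x\<bar> * indicator {h \<in> Q. u (x + h) = 0} h \<partial>lborel)"
      by (subst nn_integral_cmult_indicator) (auto simp: mult.commute)
    also have "\<dots> \<le> (\<integral>\<^sup>+h. indicator Q h * ennreal \<bar>u (x + h) - u x\<bar> \<partial>lborel)"
      by (intro nn_integral_mono) (auto split: split_indicator)
    finally show "ennreal (c / 2) * ennreal \<bar>u x\<bar> \<le> (\<integral>\<^sup>+h. indicator Q h * ennreal \<bar>u (x + h) - u x\<bar> \<partial>lborel)" .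
  qed
  also have "\<dots> = (\<integral>\<^sup>+h. (\<integral>\<^sup>+x. indicator Q h * ennreal \<bar>u (x + h) - u x\<bar> \<partial>lborel) \<partial>lborel)"
    by (rule lborel_pair.Fubini') measurable
  also have "\<dots> \<le> (\<integral>\<^sup>+h. ennreal (real CARD('n) * r * P) * indicator Q h \<partial>lborel)"
  proof (rule nn_integral_mono)
    fix h :: "real ^ 'n"
    have "(\<integral>\<^sup>+x. indicator Q h * ennreal \<bar>u (x + h) - u x\<bar> \<partial>lborel)
        = indicator Q h * (\<integral>\<^sup>+x. ennreal \<bar>u (x + h) - u x\<bar> \<partial>lborel)"
      by (rule nn_integral_cmult) measurable
    then show "(\<integral>\<^sup>+x. indicator Q h * ennreal \<bar>u (x + h) - u x\<bar> \<partial>lborel) \<le> ennreal (real CARD('n) * r * P) * indicator Q h"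
      using box_translation_L1[of h r] by (auto simp: Qiff split: split_indicator)
  qed
  also have "\<dots> = ennreal (real CARD('n) * r * P) * ennreal c"
    by (subst nn_integral_cmult_indicator) (auto simp: mQ)
  finally have "ennreal (c / 2 * \<Theta>) \<le> ennreal (real CARD('n) * r * P * c)"
    using c r variation_bound_nonneg by (simp add: ennreal_mult'[symmetric] ennreal_mult''[symmetric])
  then have "c / 2 * \<Theta> \<le> real CARD('n) * r * P * c" using c r variation_bound_nonneg by (subst (asm) ennreal_le_iff) auto
  then have "c * \<Theta> \<le> c * (2 * real CARD('n) * r * P)" by (simp add: algebra_simps)
  then show ?thesis using c by (simp add: \<Theta>_def)
qed

end


subsection \<open>Superlevel sets\<close>

lemma sum_layers: "0 \<le> y \<Longrightarrow> (\<Sum>j<M. min 1 (max 0 (y - real j))) = min (real M) y"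
proof (induction M)
  case (Suc M)
  then show ?case by (simp add: min_def max_def)
qed simp

text \<open>A discretised layer cake formula. \<open>f\<close> is \<open>\<delta>\<close> times the
  sum of its truncations \<open>t j\<close>, and for every level \<open>s\<close> in the strip
  \<open>I j\<close> the truncation differs from the superlevel indicator only on
  \<open>A j\<close>. These sets are disjoint, so the total error is at most \<open>\<delta>\<close>
  times a multiple of the mass. The majorant \<open>a\<close> carries the measurability in
  \<open>s\<close>.\<close>

lemma layer_cake_le:
  fixes T :: "'a::metric_space functional"
  assumes T: "T \<in> currents k" and f: "f \<in> LIPb" "\<And>x. 0 \<le> f x" "\<And>x. f x \<le> F" and F: "0 < F"
    and \<pi>: "\<pi> \<in> LIPs k" and a [measurable]: "a \<in> borel_measurable borel"
    and le: "\<And>s. ennreal \<bar>extension k T (indicator {x. s < f x}) \<pi>\<bar> \<le> a s"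
  shows "ennreal \<bar>T f \<pi>\<bar> \<le> (\<integral>\<^sup>+s. a s * indicator {0..F} s \<partial>lborel)"
proof -
  let ?\<mu> = "mass_measure k T" and ?P = "\<Prod>p\<leftarrow>\<pi>. Lip p"
  note P = prod_Lip_nonneg[OF \<pi>]
  note fb = finite_borel_mass_measure[OF T]
  interpret finite_measure ?\<mu> using fb by simp
  have sets: "sets ?\<mu> = sets borel" using fb by simp
  have fB [measurable]: "f \<in> borel_measurable borel" using LIP_measurable[OF LIPb_LIP[OF f(1)]] by simp
  define J where "J = (\<integral>\<^sup>+s. a s * indicator {0..F} s \<partial>lborel)"
  have main: "ennreal \<bar>T f \<pi>\<bar> \<le> J + ennreal (F / real (Suc M) * (?P * mass k T))" for M
  proof -
    define \<delta> where "\<delta> = F / real (Suc M)"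
    have \<delta>: "\<delta> > 0" "real (Suc M) * \<delta> = F" using F by (auto simp: \<delta>_def)
    define t where "t j x = min 1 (max 0 (f x / \<delta> - real j))" for j x
    have tL: "t j \<in> LIPb" for j
    proof (rule LIPbI[of _ 1])
      have "(\<lambda>x. (1 / \<delta>) * f x) \<in> LIP" by (rule LIP_cmult[OF LIPb_LIP[OF f(1)]])
      then have "(\<lambda>x. f x / \<delta>) \<in> LIP" by simp
      then show "t j \<in> LIP" unfolding t_def by (intro LIP_min LIP_max LIP_const LIP_diff)
    qed (auto simp: t_def)
    define A where "A j = {x. real j * \<delta> < f x \<and> f x \<le> real (Suc j) * \<delta>}" for j
    have AB: "A j \<in> sets borel" for j unfolding A_def by measurable
    define I where "I j = {real j * \<delta>..<real (Suc j) * \<delta>}" for j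
    have step: "ennreal (\<delta> * \<bar>T (t j) \<pi>\<bar>) \<le> (\<integral>\<^sup>+s. a s * indicator (I j) s \<partial>lborel) + ennreal (\<delta> * (?P * measure ?\<mu> (A j)))" for j
    proof -
      have pt: "ennreal \<bar>T (t j) \<pi>\<bar> \<le> a s + ennreal (?P * measure ?\<mu> (A j))" if s: "s \<in> I j" for s
      proof -
        have iB: "indicator {x. s < f x} \<in> borel_measurable borel" by simp
        have d: "\<bar>indicator {x. s < f x} x - t j x\<bar> \<le> indicator (A j) x" for x
        proof (cases "x \<in> A j")
          case True then show ?thesis by (auto simp: t_def indicator_def)
        next
          case False
          then consider "f x \<le> real j * \<delta>" | "f x > real (Suc j) * \<delta>" by (force simp: A_def)
          then show ?thesis
          proof cases
            case 1
            then have "f x / \<delta> \<le> real j" using \<delta> by (simp add: divide_le_eq)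
            moreover have "\<not> s < f x" using 1 s by (auto simp: I_def)
            ultimately show ?thesis by (simp add: t_def)
          next
            case 2
            then have "f x / \<delta> > real (Suc j)" using \<delta> by (simp add: less_divide_eq)
            moreover have "s < f x" using 2 s by (auto simp: I_def)
            ultimately show ?thesis by (simp add: t_def)
          qed
        qed
        have "\<bar>extension k T (indicator {x. s < f x}) \<pi> - T (t j) \<pi>\<bar>
          \<le> ?P * (LINT x|?\<mu>. \<bar>indicator {x. s < f x} x - t j x\<bar>)"
          by (rule extension_diff_bound[OF T mass_bound_mass_measure[OF T] iB _ tL \<pi>, of 1]) simp
        also have "\<dots> \<le> ?P * (LINT x|?\<mu>. indicator (A j) x)"
        proof (rule mult_left_mono[OF integral_mono P])
          have "(\<lambda>x. indicator {x. s < f x} x - t j x) \<in> borel_measurable borel"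
            using LIP_measurable[OF LIPb_LIP[OF tL], of borel] by simp
          then show "integrable ?\<mu> (\<lambda>x. \<bar>indicator {x. s < f x} x - t j x\<bar>)"
            by (intro integrable_abs bounded_integrable[OF fb, of _ 1] order_trans[OF d]) (auto simp: indicator_def)
          show "integrable ?\<mu> (indicator (A j) :: _ \<Rightarrow> real)" using AB sets by (simp add: emeasure_eq_measure)
        qed (rule d)
        also have "(LINT x|?\<mu>. indicator (A j) x) = measure ?\<mu> (A j)"
          using AB sets finite_borel_space[OF sets] by simp
        finally have "\<bar>T (t j) \<pi>\<bar> \<le> \<bar>extension k T (indicator {x. s < f x}) \<pi>\<bar> + ?P * measure ?\<mu> (A j)" by simp
        then have "ennreal \<bar>T (t j) \<pi>\<bar> \<le> ennreal \<bar>extension k T (indicator {x. s < f x}) \<pi>\<bar> + ennreal (?P * measure ?\<mu> (A j))"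
          using P by (simp add: ennreal_plus[symmetric] ennreal_leI del: ennreal_plus)
        also have "\<dots> \<le> a s + ennreal (?P * measure ?\<mu> (A j))" by (rule add_right_mono[OF le])
        finally show ?thesis .
      qed
      have eI: "emeasure lborel (I j) = ennreal \<delta>" using \<delta> by (simp add: I_def algebra_simps)
      have "ennreal (\<delta> * \<bar>T (t j) \<pi>\<bar>) = (\<integral>\<^sup>+s. ennreal \<bar>T (t j) \<pi>\<bar> * indicator (I j) s \<partial>lborel)"
        using \<delta> by (subst nn_integral_cmult_indicator) (auto simp: I_def[symmetric] eI ennreal_mult' mult.commute, simp add: I_def)
      also have "\<dots> \<le> (\<integral>\<^sup>+s. a s * indicator (I j) s + ennreal (?P * measure ?\<mu> (A j)) * indicator (I j) s \<partial>lborel)"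
        by (rule nn_integral_mono) (use pt in \<open>auto split: split_indicator\<close>)
      also have "\<dots> = (\<integral>\<^sup>+s. a s * indicator (I j) s \<partial>lborel) + (\<integral>\<^sup>+s. ennreal (?P * measure ?\<mu> (A j)) * indicator (I j) s \<partial>lborel)"
        by (rule nn_integral_add) (auto simp: I_def)
      also have "(\<integral>\<^sup>+s. ennreal (?P * measure ?\<mu> (A j)) * indicator (I j) s \<partial>lborel) = ennreal (\<delta> * (?P * measure ?\<mu> (A j)))"
        using \<delta> P by (subst nn_integral_cmult_indicator) (auto simp: I_def[symmetric] eI ennreal_mult' mult.commute, simp add: I_def)
      finally show ?thesis .
    qed
    have \<pi>t: "T f \<pi> = \<delta> * (\<Sum>j<Suc M. T (t j) \<pi>)"
    proof -
      have sumT: "T (\<lambda>x. \<Sum>j<n. t j x) \<pi> = (\<Sum>j<n. T (t j) \<pi>)" for n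
      proof (induction n)
        case 0
        show ?case using currents_cmult[OF T LIPb_const[of 0] \<pi>, of 0] by simp
      next
        case (Suc n)
        then show ?case using currents_add[OF T LIPb_sum tL \<pi>, of "{..<n}" t] tL by simp
      qed
      have "f x = \<delta> * (\<Sum>j<Suc M. t j x)" for x
      proof -
        have "f x / \<delta> \<le> real (Suc M)" using f(3)[of x] \<delta> by (simp add: divide_le_eq)
        moreover have "0 \<le> f x / \<delta>" using f(2) \<delta> by simp
        ultimately have "(\<Sum>j<Suc M. t j x) = f x / \<delta>" unfolding t_def by (subst sum_layers) (auto simp: min_def)
        then show ?thesis using \<delta>(1) by simp
      qed
      then have "f = (\<lambda>x. \<delta> * (\<Sum>j<Suc M. t j x))" by blast
      then have "T f \<pi> = T (\<lambda>x. \<delta> * (\<Sum>j<Suc M. t j x)) \<pi>" by (rule arg_cong)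
      also have "\<dots> = \<delta> * T (\<lambda>x. \<Sum>j<Suc M. t j x) \<pi>" by (rule currents_cmult[OF T LIPb_sum[OF tL] \<pi>])
      finally show ?thesis by (simp only: sumT)
    qed
    have "\<bar>T f \<pi>\<bar> \<le> (\<Sum>j<Suc M. \<delta> * \<bar>T (t j) \<pi>\<bar>)"
      unfolding \<pi>t abs_mult sum_distrib_left[symmetric] using \<delta>(1)
    by (intro mult_mono sum_abs) (auto simp del: sum.lessThan_Suc intro: sum_nonneg)
    then have "ennreal \<bar>T f \<pi>\<bar> \<le> (\<Sum>j<Suc M. ennreal (\<delta> * \<bar>T (t j) \<pi>\<bar>))"
      using \<delta>(1) by (subst sum_ennreal) (auto intro: ennreal_leI)
    also have "\<dots> \<le> (\<Sum>j<Suc M. (\<integral>\<^sup>+s. a s * indicator (I j) s \<partial>lborel) + ennreal (\<delta> * (?P * measure ?\<mu> (A j))))"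
      by (rule sum_mono) (rule step)
    also have "\<dots> = (\<Sum>j<Suc M. (\<integral>\<^sup>+s. a s * indicator (I j) s \<partial>lborel)) + ennreal (\<Sum>j<Suc M. \<delta> * (?P * measure ?\<mu> (A j)))"
      unfolding sum.distrib using \<delta>(1) P by (subst sum_ennreal) (auto simp del: sum.lessThan_Suc)
    also have "(\<Sum>j<Suc M. (\<integral>\<^sup>+s. a s * indicator (I j) s \<partial>lborel)) = (\<integral>\<^sup>+s. (\<Sum>j<Suc M. a s * indicator (I j) s) \<partial>lborel)"
      by (rule nn_integral_sum[symmetric]) (simp add: I_def)
    also have "\<dots> \<le> J"
      unfolding J_def
    proof (rule nn_integral_mono)
      fix s
      have I_unique: "j = nat \<lfloor>s / \<delta>\<rfloor>" if "s \<in> I j" for j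
      proof -
        have "real j \<le> s / \<delta>" "s / \<delta> < real j + 1" using that \<delta>(1) by (auto simp: I_def field_simps)
        then have "\<lfloor>s / \<delta>\<rfloor> = int j" by linarith
        then show ?thesis by simp
      qed
      have I_sub: "s \<in> {0..F}" if "s \<in> I j" "j < Suc M" for j
      proof -
        have "real (Suc j) * \<delta> \<le> real (Suc M) * \<delta>" using that(2) \<delta>(1) by (intro mult_right_mono) auto
        moreover have "0 \<le> real j * \<delta>" using \<delta>(1) by simp
        ultimately show ?thesis using that(1) unfolding \<delta>(2) I_def atLeastLessThan_iff atLeastAtMost_iff by linarith
      qed
      show "(\<Sum>j<Suc M. a s * indicator (I j) s) \<le> a s * indicator {0..F} s"
      proof (cases "\<exists>j<Suc M. s \<in> I j")
        case True
        then obtain j where j: "j < Suc M" "s \<in> I j" by blast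
        have "(\<Sum>i<Suc M. a s * indicator (I i) s) = (\<Sum>i\<in>{j}. a s * indicator (I i) s)"
        proof (rule sum.mono_neutral_right)
          show "\<forall>i\<in>{..<Suc M} - {j}. a s * indicator (I i) s = 0"
            using I_unique[OF j(2)] I_unique by (metis DiffE indicator_simps(2) insertI1 mult_zero_right)
        qed (use j in auto)
        then show ?thesis using j I_sub[OF j(2,1)] by simp
      next
        case False
        then have z: "(\<Sum>j<Suc M. a s * indicator (I j) s) = 0" by (intro sum.neutral) auto
        show ?thesis unfolding z by simp
      qed
    qed
    also have "(\<Sum>j<Suc M. \<delta> * (?P * measure ?\<mu> (A j))) = \<delta> * (?P * (\<Sum>j<Suc M. measure ?\<mu> (A j)))"
      by (simp only: sum_distrib_left)
    finally have fin: "ennreal \<bar>T f \<pi>\<bar> \<le> J + ennreal (\<delta> * (?P * (\<Sum>j<Suc M. measure ?\<mu> (A j))))"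
      by (simp only: add_right_mono)
    have "(\<Sum>j<Suc M. measure ?\<mu> (A j)) \<le> mass k T"
    proof -
      have "disjoint_family_on A {..<Suc M}"
        unfolding disjoint_family_on_def
      proof (intro ballI impI)
        fix i j :: nat assume "i \<noteq> j"
        have *: "A i \<inter> A j = {}" if "i < j" for i j
        proof -
          have "real (Suc i) * \<delta> \<le> real j * \<delta>" using that \<delta>(1) by (intro mult_right_mono) auto
          then show ?thesis unfolding A_def by fastforce
        qed
        then show "A i \<inter> A j = {}" using \<open>i \<noteq> j\<close> by (metis Int_commute nat_neq_iff)
      qed
      then have "measure ?\<mu> (\<Union>j<Suc M. A j) = (\<Sum>j<Suc M. measure ?\<mu> (A j))"
        using AB sets by (intro finite_measure_finite_Union) auto
      moreover have "measure ?\<mu> (\<Union>j<Suc M. A j) \<le> measure ?\<mu> UNIV"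
        using sets by (intro finite_measure_mono) auto
      ultimately show ?thesis by (simp add: mass_def)
    qed
    then have "J + ennreal (\<delta> * (?P * (\<Sum>j<Suc M. measure ?\<mu> (A j)))) \<le> J + ennreal (\<delta> * (?P * mass k T))"
      by (intro add_left_mono ennreal_leI mult_left_mono P less_imp_le[OF \<delta>(1)])
    from order_trans[OF fin this] show ?thesis unfolding \<delta>_def .
  qed
  have "(\<lambda>n. F / real (Suc n) * (?P * mass k T)) \<longlonglongrightarrow> 0 * (?P * mass k T)"
    by (intro tendsto_intros LIMSEQ_Suc[OF lim_const_over_n])
  then have "(\<lambda>n. J + ennreal (F / real (Suc n) * (?P * mass k T))) \<longlonglongrightarrow> J + ennreal (0 * (?P * mass k T))"
    by (rule tendsto_add[OF tendsto_const tendsto_ennrealI])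
  then have "ennreal \<bar>T f \<pi>\<bar> \<le> J + ennreal (0 * (?P * mass k T))"
    by (rule LIMSEQ_le_const) (use main in blast)
  then show ?thesis by (simp add: J_def)
qed

text \<open>A Lipschitz substitute for the indicator of \<open>{x. s < f x}\<close>: it rises from 0
  to 1 while \<open>f\<close> runs through the interval from \<open>s\<close> to
  \<open>s + 1 / N\<close>.\<close>

definition ramp :: "real \<Rightarrow> real \<Rightarrow> ('a \<Rightarrow> real) \<Rightarrow> 'a \<Rightarrow> real" where
  "ramp N s f x = min 1 (max 0 (N * (f x - s)))"

lemma ramp_LIPb:
  assumes "f \<in> LIP"
  shows "ramp N s f \<in> LIPb"
proof (rule LIPbI[of _ 1])
  show "ramp N s f \<in> LIP"
    unfolding ramp_def by (intro LIP_min LIP_max LIP_const LIP_cmult LIP_diff assms)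
qed (auto simp: ramp_def)

lemma ramp_Lip:
  assumes "f \<in> LIP" "0 \<le> N"
  shows "Lip (ramp N s f) \<le> N * Lip f"
proof (rule Lip_le_real)
  fix x y
  have "\<bar>ramp N s f x - ramp N s f y\<bar> \<le> \<bar>N * (f x - s) - N * (f y - s)\<bar>" unfolding ramp_def by linarith
  also have "\<dots> = N * \<bar>f x - f y\<bar>" using assms(2) by (simp add: right_diff_distrib[symmetric] abs_mult)
  also have "\<dots> \<le> N * (Lip f * dist x y)" by (intro mult_left_mono Lip_bound_real assms)
  finally show "\<bar>ramp N s f x - ramp N s f y\<bar> \<le> N * Lip f * dist x y" by simp
qed (intro mult_nonneg_nonneg assms(2) Lip_nonneg assms(1))

text \<open>The transition zone of the ramp, enlarged by \<open>1 / N\<close> on either side to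
  leave room for Lipschitz cut-offs.\<close>

definition strip :: "real \<Rightarrow> real \<Rightarrow> ('a \<Rightarrow> real) \<Rightarrow> 'a set" where
  "strip N s f = {x. s - 1 / N \<le> f x \<and> f x \<le> s + 2 / N}"

text \<open>The boundary of the restriction to a superlevel set: the product rule splits it into
  the restricted boundary and the slice, whose mass is at most that of a thin strip.\<close>

lemma ramp_boundary_bound:
  fixes T :: "'a::metric_space functional"
  assumes T: "T \<in> currents (Suc m)" and bT: "boundary (Suc m) T \<in> currents m"
    and f: "f \<in> LIP" and g: "g \<in> LIPb" "\<And>x. \<bar>g x\<bar> \<le> C" and \<rho>: "\<rho> \<in> LIPs m" and N: "0 < N"
  shows "\<bar>T (ramp N s f) (g # \<rho>)\<bar> \<le> (\<Prod>q\<leftarrow>\<rho>. Lip q) * C *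
    (mass m (boundary (Suc m) T) + Lip f * (N * measure (mass_measure (Suc m) T) (strip N s f)))"
proof -
  let ?P = "\<Prod>q\<leftarrow>\<rho>. Lip q" and ?\<mu> = "mass_measure (Suc m) T"
  note P = prod_Lip_nonneg[OF \<rho>]
  note fb = finite_borel_mass_measure[OF T]
  interpret finite_measure ?\<mu> using fb by simp
  have sets: "sets ?\<mu> = sets borel" using fb by simp
  have fB [measurable]: "f \<in> borel_measurable borel" using LIP_measurable[OF f] by simp
  have C: "0 \<le> C" using order_trans[OF abs_ge_zero g(2)] .
  let ?h = "ramp N s f"
  have h: "?h \<in> LIPb" by (rule ramp_LIPb[OF f])
  have hg: "(\<lambda>x. ?h x * g x) \<in> LIPb" by (rule LIPb_mult[OF h g(1)])
  have hg_le: "\<bar>?h x * g x\<bar> \<le> C" for x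
    using mult_mono[of "\<bar>?h x\<bar>" 1 "\<bar>g x\<bar>" C] g(2) by (simp add: abs_mult ramp_def)
  have "T (\<lambda>_. 1) ((\<lambda>x. ?h x * g x) # \<rho>) = boundary (Suc m) T (\<lambda>x. ?h x * g x) \<rho>"
    using hg \<rho> by (simp add: boundary_def Dk_def)
  then have 1: "\<bar>T (\<lambda>_. 1) ((\<lambda>x. ?h x * g x) # \<rho>)\<bar> \<le> ?P * (C * mass m (boundary (Suc m) T))"
    using current_abs_le[OF bT hg \<rho> hg_le] by simp
  \<comment> \<open>\<open>a\<close> lives where the ramp is 0 and \<open>b\<close> where it is 1,
    so locality kills \<open>T\<close> on \<open>g x * a x\<close> and \<open>g x * b x\<close> with
    the ramp as argument. The rest \<open>c\<close> vanishes off the strip and has modulus at most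
    1.\<close>
  define a where "a x = min 1 (max 0 (N * (s - f x)))" for x
  define b where "b x = min 1 (max 0 (N * (f x - s) - 1))" for x
  define c where "c x = 1 - a x - b x" for x
  have aL: "a \<in> LIPb" unfolding a_def
    by (rule LIPbI[of _ 1]) (auto intro!: LIP_min LIP_max LIP_const LIP_cmult LIP_diff f)
  have bL: "b \<in> LIPb" unfolding b_def
    by (rule LIPbI[of _ 1]) (auto intro!: LIP_min LIP_max LIP_const LIP_cmult LIP_diff f)
  have cL: "c \<in> LIPb" unfolding c_def by (intro LIPb_diff LIPb_const aL bL)
  have gaL: "(\<lambda>x. g x * a x) \<in> LIPb" and gbL: "(\<lambda>x. g x * b x) \<in> LIPb" and gcL: "(\<lambda>x. g x * c x) \<in> LIPb"
    by (intro LIPb_mult g(1) aL bL cL)+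
  have \<pi>: "?h # \<rho> \<in> LIPs (Suc m)" using LIPb_LIP[OF h] \<rho> by (simp add: LIPs_Cons)
  have "T (\<lambda>x. g x * a x) (?h # \<rho>) = 0"
  proof (rule currents_hd_local[OF T \<rho> gaL LIPb_LIP[OF h], of 0])
    fix x assume "g x * a x \<noteq> 0"
    then have "N * (s - f x) > 0" by (auto simp: a_def max_def split: if_splits)
    then have "N * (f x - s) < 0" by (simp add: algebra_simps)
    then show "?h x = 0" by (simp add: ramp_def)
  qed
  moreover have "T (\<lambda>x. g x * b x) (?h # \<rho>) = 0"
  proof (rule currents_hd_local[OF T \<rho> gbL LIPb_LIP[OF h], of 1])
    fix x assume "g x * b x \<noteq> 0"
    then have "N * (f x - s) - 1 > 0" by (auto simp: b_def max_def split: if_splits)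
    then show "?h x = 1" by (simp add: ramp_def)
  qed
  moreover have "g = (\<lambda>x. (g x * a x + g x * b x) + g x * c x)" by (simp add: fun_eq_iff c_def algebra_simps)
  then have "T g (?h # \<rho>) = T (\<lambda>x. (g x * a x + g x * b x) + g x * c x) (?h # \<rho>)" by (rule arg_cong)
  then have "T g (?h # \<rho>) = T (\<lambda>x. g x * a x) (?h # \<rho>) + T (\<lambda>x. g x * b x) (?h # \<rho>) + T (\<lambda>x. g x * c x) (?h # \<rho>)"
    using currents_add[OF T LIPb_add[OF gaL gbL] gcL \<pi>] currents_add[OF T gaL gbL \<pi>] by simp
  ultimately have "\<bar>T g (?h # \<rho>)\<bar> = \<bar>T (\<lambda>x. g x * c x) (?h # \<rho>)\<bar>" by simp
  also have "\<dots> \<le> (N * Lip f) * ?P * (LINT x|?\<mu>. \<bar>g x * c x\<bar>)"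
    by (rule currents_hd_bound[OF T \<rho> gcL LIPb_LIP[OF h] ramp_Lip[OF f]]) (use N in simp)
  also have "\<dots> \<le> (N * Lip f) * ?P * (LINT x|?\<mu>. C * indicator (strip N s f) x)"
  proof (rule mult_left_mono[OF integral_mono])
    have sB: "strip N s f \<in> sets ?\<mu>" unfolding strip_def sets by measurable
    then show "integrable ?\<mu> (\<lambda>x. C * indicator (strip N s f) x)" by (simp add: emeasure_eq_measure)
    show "integrable ?\<mu> (\<lambda>x. \<bar>g x * c x\<bar>)" using LIPb_integrable[OF gcL fb] by simp
    show "\<bar>g x * c x\<bar> \<le> C * indicator (strip N s f) x" for x
    proof -
      have "\<bar>c x\<bar> \<le> indicator (strip N s f) x"
      proof (cases "x \<in> strip N s f")
        case True
        have "N * (s - f x) = - (N * (f x - s))" by (simp add: algebra_simps)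
        then have "\<bar>c x\<bar> \<le> 1" unfolding c_def a_def b_def by linarith
        then show ?thesis using True by simp
      next
        case False
        then consider "f x < s - 1 / N" | "f x > s + 2 / N" by (force simp: strip_def)
        then have "c x = 0"
        proof cases
          case 1
          then have "N * (s - f x) > 1" using N by (simp add: field_simps)
          moreover from this have "N * (f x - s) < 0" by (simp add: algebra_simps)
          ultimately show ?thesis by (simp add: c_def a_def b_def)
        next
          case 2
          then have "N * (f x - s) > 2" using N by (simp add: field_simps)
          moreover from this have "N * (s - f x) < 0" by (simp add: algebra_simps)
          ultimately show ?thesis by (simp add: c_def a_def b_def)
        qed
        then show ?thesis by simp
      qed
      then show ?thesis unfolding abs_mult by (intro mult_mono g(2) C) auto
    qed
    show "0 \<le> N * Lip f * ?P" using N Lip_nonneg[OF f] P by simp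
  qed
  also have "(LINT x|?\<mu>. C * indicator (strip N s f) x) = C * measure ?\<mu> (strip N s f)"
    using finite_borel_space[OF sets] by simp
  finally have 2: "\<bar>T g (?h # \<rho>)\<bar> \<le> (N * Lip f) * ?P * (C * measure ?\<mu> (strip N s f))" .
  have "T ?h (g # \<rho>) = T (\<lambda>_. 1) ((\<lambda>x. ?h x * g x) # \<rho>) - T g (?h # \<rho>)"
    using product_rule[OF T \<rho> h g(1)] by simp
  then have "\<bar>T ?h (g # \<rho>)\<bar> \<le> ?P * (C * mass m (boundary (Suc m) T)) + (N * Lip f) * ?P * (C * measure ?\<mu> (strip N s f))"
    using 1 2 by linarith
  then show ?thesis by (simp add: algebra_simps)
qed

lemma ramp_tendsto:
  fixes f :: "'a \<Rightarrow> real"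
  shows "(\<lambda>n. ramp (real (Suc n)) s f x) \<longlonglongrightarrow> indicator {x. s < f x} x"
proof (cases "s < f x")
  case False
  then have "ramp (real (Suc n)) s f x = 0" for n
  proof -
    have "real (Suc n) * (f x - s) \<le> 0" using False by (intro mult_nonneg_nonpos) auto
    then show ?thesis by (simp add: ramp_def)
  qed
  then show ?thesis using False by simp
next
  case True
  then obtain n0 where n0: "1 < real n0 * (f x - s)" using reals_Archimedean3[of "f x - s"] by auto
  have "eventually (\<lambda>n. ramp (real (Suc n)) s f x = 1) sequentially"
    unfolding eventually_sequentially
  proof (intro exI allI impI)
    fix n assume "n0 \<le> n"
    then have "real n0 * (f x - s) \<le> real (Suc n) * (f x - s)" using True by (intro mult_right_mono) auto
    then show "ramp (real (Suc n)) s f x = 1" using n0 by (simp add: ramp_def)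
  qed
  then show ?thesis using True by (simp add: tendsto_eventually)
qed

text \<open>The ramps converge in L1 to the superlevel indicator, so the values of \<open>T\<close>
  converge to the extension. A bound that holds for infinitely many \<open>n\<close> therefore
  passes to the limit; this is why control by a lower limit of strip masses suffices.\<close>

lemma superlevel_boundary_bound:
  fixes T :: "'a::metric_space functional"
  assumes T: "T \<in> currents (Suc m)" and bT: "boundary (Suc m) T \<in> currents m"
    and f: "f \<in> LIP" and g: "g \<in> LIPb" "\<And>x. \<bar>g x\<bar> \<le> C" and \<rho>: "\<rho> \<in> LIPs m"
    and b: "\<exists>\<^sub>F n in sequentially. real (Suc n) * measure (mass_measure (Suc m) T) (strip (real (Suc n)) s f) \<le> b"
  shows "\<bar>extension (Suc m) T (indicator {x. s < f x}) (g # \<rho>)\<bar>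
    \<le> (\<Prod>q\<leftarrow>\<rho>. Lip q) * C * (mass m (boundary (Suc m) T) + Lip f * b)"
proof -
  let ?\<mu> = "mass_measure (Suc m) T" and ?h = "\<lambda>n. ramp (real (Suc n)) s f"
  let ?K = "(\<Prod>q\<leftarrow>\<rho>. Lip q) * C * (mass m (boundary (Suc m) T) + Lip f * b)"
  note fb = finite_borel_mass_measure[OF T]
  interpret finite_measure ?\<mu> using fb by simp
  have C: "0 \<le> C" using order_trans[OF abs_ge_zero g(2)] .
  have fB [measurable]: "f \<in> borel_measurable borel" using LIP_measurable[OF f] by simp
  have hL: "?h n \<in> LIPb" for n by (rule ramp_LIPb[OF f])
  have \<pi>: "g # \<rho> \<in> LIPs (Suc m)" using LIPb_LIP[OF g(1)] \<rho> by (simp add: LIPs_Cons)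
  have "(\<lambda>n. LINT x|?\<mu>. \<bar>?h n x - indicator {x. s < f x} x\<bar>) \<longlonglongrightarrow> (LINT x|?\<mu>. 0)"
  proof (rule integral_dominated_convergence[where w = "\<lambda>_. 1"])
    show "AE x in ?\<mu>. (\<lambda>n. \<bar>?h n x - indicator {x. s < f x} x\<bar>) \<longlonglongrightarrow> 0"
      by (intro AE_I2 tendsto_rabs_zero LIM_zero ramp_tendsto)
    have "(\<lambda>x. \<bar>?h n x - indicator {x. s < f x} x\<bar>) \<in> borel_measurable borel" for n
      using LIP_measurable[OF LIPb_LIP[OF hL], of borel] by simp
    then show "(\<lambda>x. \<bar>?h n x - indicator {x. s < f x} x\<bar>) \<in> borel_measurable ?\<mu>" for n
      using fb measurable_cong_sets by blast
    show "AE x in ?\<mu>. norm \<bar>?h n x - indicator {x. s < f x} x\<bar> \<le> 1" for n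
      by (intro AE_I2) (auto simp: ramp_def indicator_def)
  qed auto
  then have L1: "L1_lim ?\<mu> ?h (indicator {x. s < f x})" using hL by (simp add: L1_lim_def)
  have iB: "indicator {x. s < f x} \<in> borel_measurable borel" by simp
  have "(\<lambda>n. T (?h n) (g # \<rho>)) \<longlonglongrightarrow> extension (Suc m) T (indicator {x. s < f x}) (g # \<rho>)"
    by (rule extension_tendsto[OF T mass_bound_mass_measure[OF T] iB _ \<pi> L1, of 1]) simp
  then have lim: "(\<lambda>n. \<bar>T (?h n) (g # \<rho>)\<bar>) \<longlonglongrightarrow> \<bar>extension (Suc m) T (indicator {x. s < f x}) (g # \<rho>)\<bar>"
    by (rule tendsto_rabs)
  show ?thesis
  proof (rule ccontr)
    assume "\<not> ?thesis"
    then have "eventually (\<lambda>n. ?K < \<bar>T (?h n) (g # \<rho>)\<bar>) sequentially"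
      using lim by (intro order_tendstoD) auto
    then have "\<exists>\<^sub>F n in sequentially. real (Suc n) * measure ?\<mu> (strip (real (Suc n)) s f) \<le> b \<and> ?K < \<bar>T (?h n) (g # \<rho>)\<bar>"
      by (intro frequently_rev_mp[OF b]) (auto elim: eventually_mono)
    then obtain n where n: "real (Suc n) * measure ?\<mu> (strip (real (Suc n)) s f) \<le> b" "?K < \<bar>T (?h n) (g # \<rho>)\<bar>"
      using frequently_ex by blast
    have "\<bar>T (?h n) (g # \<rho>)\<bar> \<le> (\<Prod>q\<leftarrow>\<rho>. Lip q) * C *
        (mass m (boundary (Suc m) T) + Lip f * (real (Suc n) * measure ?\<mu> (strip (real (Suc n)) s f)))"
      by (rule ramp_boundary_bound[OF T bT f g \<rho>]) simp
    also have "\<dots> \<le> ?K"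
      by (intro mult_left_mono add_left_mono n(1) Lip_nonneg f mult_nonneg_nonneg prod_Lip_nonneg[OF \<rho>] C)
    finally show False using n(2) by simp
  qed
qed


subsection \<open>Small integral currents act superlinearly weakly\<close>

definition tuple_map :: "('a \<Rightarrow> real) list \<Rightarrow> 'a \<Rightarrow> real ^ 'n::finite" where
  "tuple_map \<pi> x = (\<chi> i. (\<pi> ! to_nat_on UNIV i) x)"

lemma tuple_map_LIP:
  assumes "\<pi> \<in> LIPs CARD('n::finite)"
  shows "(tuple_map \<pi> :: 'a::metric_space \<Rightarrow> real ^ 'n) \<in> LIP"
proof -
  let ?\<phi> = "tuple_map \<pi> :: 'a \<Rightarrow> real ^ 'n"
  define L where "L = (\<Sum>i\<in>(UNIV :: 'n set). Lip (\<pi> ! to_nat_on UNIV i))"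
  have pL: "\<pi> ! to_nat_on UNIV i \<in> LIP" for i :: 'n by (rule LIPs_nth[OF assms to_nat_on_less_CARD])
  have "L-lipschitz_on UNIV ?\<phi>"
  proof (rule lipschitz_onI)
    show "0 \<le> L" unfolding L_def by (intro sum_nonneg Lip_nonneg pL)
    fix x y
    have "dist (?\<phi> x) (?\<phi> y) \<le> (\<Sum>i\<in>UNIV. \<bar>(?\<phi> x - ?\<phi> y) $ i\<bar>)" unfolding dist_norm by (rule norm_le_l1_cart)
    also have "\<dots> \<le> (\<Sum>i\<in>(UNIV :: 'n set). Lip (\<pi> ! to_nat_on UNIV i) * dist x y)"
      unfolding tuple_map_def by (intro sum_mono) (use Lip_bound_real[OF pL] in simp)
    finally show "dist (?\<phi> x) (?\<phi> y) \<le> L * dist x y" by (simp add: L_def sum_distrib_right)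
  qed
  then show ?thesis unfolding LIP_def by blast
qed

lemma map_tuple_map:
  assumes "\<pi> \<in> LIPs CARD('n::finite)"
  shows "map (\<lambda>p. p \<circ> tuple_map \<pi>) (coord_list (\<lambda>i (x :: real ^ 'n). x $ i)) = \<pi>"
  using coord_list_of_nth[OF assms] by (simp add: map_coord_list comp_def tuple_map_def)

text \<open>Exchanging index \<open>j\<close> with the index enumerated first puts
  \<open>\<psi>\<close> at the head of the list, the slot for which the boundary bound is stated.
  The other entries remain coordinates.\<close>

lemma coord_list_transpose:
  fixes j :: "'n::finite" and \<psi> :: "real ^ 'n \<Rightarrow> real"
  defines "i0 \<equiv> from_nat_into (UNIV :: 'n set) 0"
  defines "q \<equiv> (\<lambda>i. if Transposition.transpose i0 j i = j then \<psi> else (\<lambda>x. x $ Transposition.transpose i0 j i))"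
  obtains l where "coord_list q = \<psi> # map (\<lambda>i x. x $ i) l" "length l = CARD('n) - 1"
proof -
  let ?\<tau> = "Transposition.transpose i0 j"
  define l where "l = map (\<lambda>m. ?\<tau> (from_nat_into (UNIV :: 'n set) m)) [1..<CARD('n)]"
  have tonat: "to_nat_on (UNIV :: 'n set) (from_nat_into UNIV m) = m" if "m < CARD('n)" for m
    using that to_nat_on_finite[of "UNIV :: 'n set"] by (intro to_nat_on_from_nat_into) (auto simp: bij_betw_def)
  have "q (from_nat_into UNIV m) = (\<lambda>x. x $ ?\<tau> (from_nat_into UNIV m))" if "m \<in> set [1..<CARD('n)]" for m
  proof -
    have "from_nat_into (UNIV :: 'n set) m \<noteq> i0"
    proof
      assume "from_nat_into (UNIV :: 'n set) m = i0"
      then have "to_nat_on (UNIV :: 'n set) (from_nat_into UNIV m) = to_nat_on (UNIV :: 'n set) (from_nat_into UNIV 0)"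
        by (simp add: i0_def)
      then show False using tonat[of m] tonat[of 0] that by simp
    qed
    then have "?\<tau> (from_nat_into UNIV m) \<noteq> j" by (metis transpose_apply_first transpose_involutory)
    then show ?thesis by (simp add: q_def)
  qed
  then have "map (\<lambda>m. q (from_nat_into UNIV m)) [1..<CARD('n)] = map (\<lambda>i x. x $ i) l"
    by (simp add: l_def comp_def)
  moreover have "[0..<CARD('n)] = 0 # [1..<CARD('n)]" by (simp add: upt_conv_Cons)
  moreover have "q i0 = \<psi>" by (simp add: q_def)
  ultimately have "coord_list q = \<psi> # map (\<lambda>i x. x $ i) l" by (simp add: coord_list_def i0_def[symmetric])
  then show ?thesis using that[of l] by (simp add: l_def)
qed

lemma superlevel_estimate:
  fixes T :: "'a::metric_space functional" and \<pi> :: "('a \<Rightarrow> real) list"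
  assumes T: "T \<in> integral_currents TYPE('n::finite)" and f: "f \<in> LIP" and \<pi>: "\<pi> \<in> LIPs CARD('n)"
    and L: "Lip (tuple_map \<pi> :: 'a \<Rightarrow> real ^ 'n) \<le> L"
    and r: "0 < r" "2 * (L ^ CARD('n) * mass CARD('n) T) \<le> r ^ CARD('n)"
    and b: "\<exists>\<^sub>F n in sequentially. real (Suc n) * measure (mass_measure CARD('n) T) (strip (real (Suc n)) s f) \<le> b"
  shows "\<bar>extension CARD('n) T (indicator {x. s < f x}) \<pi>\<bar>
    \<le> 2 * real CARD('n) * r * (L ^ (CARD('n) - 1) * (mass (CARD('n) - 1) (boundary CARD('n) T) + Lip f * b))"
proof -
  define m where "m = CARD('n) - 1"
  have km: "CARD('n) = Suc m" by (simp add: m_def)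
  have Tc: "T \<in> currents CARD('n)" and bT: "boundary CARD('n) T \<in> currents m"
    using integral_currentsD[OF T] by (auto simp: m_def)
  define \<Omega> where "\<Omega> = {x. s < f x}"
  have \<Omega>: "open \<Omega>" unfolding \<Omega>_def by (intro open_Collect_less continuous_intros LIP_continuous_on[OF f])
  define \<phi> where "\<phi> = (tuple_map \<pi> :: 'a \<Rightarrow> real ^ 'n)"
  have \<phi>: "\<phi> \<in> LIP" unfolding \<phi>_def by (rule tuple_map_LIP[OF \<pi>])
  have L\<phi>: "0 \<le> Lip \<phi>" "Lip \<phi> \<le> L" using Lip_nonneg[OF \<phi>] L by (auto simp: \<phi>_def)
  let ?A = "pushforward CARD('n) \<phi> (current_restrict CARD('n) T \<Omega>)"
  have ex: "\<exists>u. int_density ?A u"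
    using T \<phi> \<Omega> unfolding integral_currents_def integer_rectifiable_iff Int_iff by blast
  then obtain u where u: "int_density ?A u" by blast
  have A1: "?A (\<lambda>_. 1) \<pi>' = extension CARD('n) T (indicator \<Omega>) (map (\<lambda>p. p \<circ> \<phi>) \<pi>')"
    if "\<pi>' \<in> LIPs CARD('n)" for \<pi>' :: "(real ^ 'n \<Rightarrow> real) list"
  proof -
    have "map (\<lambda>p. p \<circ> \<phi>) \<pi>' \<in> LIPs CARD('n)"
      using that LIP_comp[OF _ \<phi>] by (auto simp: LIPs_def comp_def)
    then show ?thesis using that by (simp add: pushforward_def current_restrict_def Dk_def LIPb_const comp_def)
  qed
  \<comment> \<open>Up to the sign of the transposition, this integral is the value of the
    restricted current at 1, \<open>\<psi>\<close> and the remaining coordinates. The bound for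
    superlevel sets thus limits the variation of \<open>u\<close>; it involves \<open>\<psi>\<close>
    only through its supremum.\<close>
  have var: "\<bar>LINT x|lborel. u x * partial_deriv j \<psi> x\<bar>
      \<le> (L ^ m * (mass m (boundary CARD('n) T) + Lip f * b)) * C"
    if \<psi>: "\<psi> \<in> LIPb" and C: "\<And>x. \<bar>\<psi> x\<bar> \<le> C" for \<psi> :: "real ^ 'n \<Rightarrow> real" and C j
  proof -
    let ?\<tau> = "Transposition.transpose (from_nat_into (UNIV :: 'n set) 0) j"
    let ?q = "\<lambda>i. if ?\<tau> i = j then \<psi> else (\<lambda>x. x $ ?\<tau> i)"
    obtain l where l: "coord_list ?q = \<psi> # map (\<lambda>i x. x $ i) l" "length l = m"
      unfolding m_def by (rule coord_list_transpose)
    have qL: "coord_list ?q \<in> LIPs CARD('n)" by (rule coord_list_LIPs) (simp add: LIPb_LIP[OF \<psi>] LIP_vec_nth)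
    define \<rho> where "\<rho> = map (\<lambda>i x. \<phi> x $ i) l"
    have \<rho>: "\<rho> \<in> LIPs m" unfolding \<rho>_def LIPs_def using l(2) Lip_vec_nth_comp(1)[OF \<phi>] by auto
    have "?A (\<lambda>_. 1) (coord_list ?q) = (LINT x|lborel. u x * 1 * jacobian_det (coord_list ?q) x)"
      by (rule int_densityD[OF u]) (simp add: Dk_def LIPb_const qL)
    also have "\<dots> = (LINT x|lborel. of_int (sign ?\<tau>) * (u x * partial_deriv j \<psi> x))"
      by (subst jacobian_det_coord_list[OF permutes_swap_id[OF UNIV_I UNIV_I]]) (simp add: mult_ac)
    also have "\<dots> = of_int (sign ?\<tau>) * (LINT x|lborel. u x * partial_deriv j \<psi> x)" by simp
    finally have "\<bar>?A (\<lambda>_. 1) (coord_list ?q)\<bar> = \<bar>LINT x|lborel. u x * partial_deriv j \<psi> x\<bar>"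
      by (simp add: abs_mult sign_def)
    moreover have "?A (\<lambda>_. 1) (coord_list ?q) = extension CARD('n) T (indicator \<Omega>) ((\<lambda>x. \<psi> (\<phi> x)) # \<rho>)"
      using A1[OF qL] by (simp add: l(1) \<rho>_def comp_def)
    moreover have "\<bar>extension CARD('n) T (indicator \<Omega>) ((\<lambda>x. \<psi> (\<phi> x)) # \<rho>)\<bar>
      \<le> (\<Prod>q\<leftarrow>\<rho>. Lip q) * C * (mass m (boundary CARD('n) T) + Lip f * b)"
      unfolding \<Omega>_def km
      by (rule superlevel_boundary_bound[OF Tc[unfolded km] bT[unfolded km] f LIPb_comp[OF \<psi> \<phi>] C \<rho> b[unfolded km]])
    moreover have "(\<Prod>q\<leftarrow>\<rho>. Lip q) * C * (mass m (boundary CARD('n) T) + Lip f * b)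
      \<le> L ^ m * C * (mass m (boundary CARD('n) T) + Lip f * b)"
    proof (intro mult_right_mono)
      have "(\<Prod>q\<leftarrow>\<rho>. Lip q) \<le> (\<Prod>i<m. L)"
      proof (rule prod_list_le_prod[OF \<rho>])
        fix i assume "i < m"
        then show "Lip (\<rho> ! i) \<le> L"
          using order_trans[OF Lip_vec_nth_comp(2)[OF \<phi>] L\<phi>(2)] l(2) by (simp add: \<rho>_def)
      qed
      then show "(\<Prod>q\<leftarrow>\<rho>. Lip q) \<le> L ^ m" by simp
      show "0 \<le> C" using order_trans[OF abs_ge_zero C] .
      obtain n where "real (Suc n) * measure (mass_measure CARD('n) T) (strip (real (Suc n)) s f) \<le> b"
        using frequently_ex[OF b] by blast
      then have "0 \<le> b" by (rule order_trans[rotated]) simp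
      then show "0 \<le> mass m (boundary CARD('n) T) + Lip f * b"
        by (intro add_nonneg_nonneg mass_nonneg mult_nonneg_nonneg Lip_nonneg f)
    qed
    ultimately show ?thesis by (simp add: mult_ac)
  qed
  have uB: "u \<in> borel_measurable borel" "integrable lborel u" "\<And>x. u x \<in> \<int>"
    using u by (auto simp: int_density_def)
  \<comment> \<open>Assuming smallness of the mass, rather than of a norm of \<open>u\<close>,
    allows the same \<open>r\<close> at all levels \<open>s\<close>.\<close>
  have small: "2 * (LINT x|lborel. \<bar>u x\<bar>) \<le> r ^ CARD('n)"
  proof -
    have "(LINT x|lborel. \<bar>u x\<bar>) \<le> Lip \<phi> ^ CARD('n) * mass CARD('n) T" by (rule int_density_L1_le[OF Tc \<phi> \<Omega> u])
    also have "\<dots> \<le> L ^ CARD('n) * mass CARD('n) T" by (intro mult_right_mono power_mono L\<phi> mass_nonneg)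
    finally show ?thesis using r(2) by simp
  qed
  let ?c = "coord_list (\<lambda>i (x :: real ^ 'n). x $ i)"
  have c: "?c \<in> LIPs CARD('n)" by (rule coord_list_LIPs[OF LIP_vec_nth])
  have "extension CARD('n) T (indicator \<Omega>) \<pi> = ?A (\<lambda>_. 1) ?c"
    unfolding A1[OF c] by (simp add: \<phi>_def map_tuple_map[OF \<pi>])
  also have "\<dots> = (LINT x|lborel. u x)"
    using int_densityD[OF u, of "\<lambda>_. 1" ?c] c by (simp add: Dk_def LIPb_const jacobian_det_coords)
  finally have "\<bar>extension CARD('n) T (indicator \<Omega>) \<pi>\<bar> \<le> (LINT x|lborel. \<bar>u x\<bar>)" by simp
  also have "\<dots> \<le> 2 * real CARD('n) * r * (L ^ m * (mass m (boundary CARD('n) T) + Lip f * b))"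
    by (rule integer_valued_L1_le[OF uB(2,1) var uB(3) r(1) small])
  finally show ?thesis by (simp add: \<Omega>_def m_def)
qed

text \<open>Stands in for the mass of the slice at \<open>s\<close>: a lower density at
  \<open>s\<close> of the image of \<open>\<mu>\<close> under \<open>f\<close>. It is a lower limit
  so that Fatou's lemma applies.\<close>

definition slice_mass :: "'a measure \<Rightarrow> ('a \<Rightarrow> real) \<Rightarrow> real \<Rightarrow> ennreal" where
  "slice_mass \<mu> f s = liminf (\<lambda>n. ennreal (real (Suc n)) * emeasure \<mu> (strip (real (Suc n)) s f))"

text \<open>Fatou reduces the bound to fixed \<open>n\<close>. There Fubini applies: the levels
  \<open>s\<close> whose strip contains a given \<open>x\<close> form an interval of length
  \<open>3 / real (Suc n)\<close>, which the factor \<open>real (Suc n)\<close> turns into the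
  constant 3.\<close>

lemma slice_mass_integral:
  fixes \<mu> :: "'a::metric_space measure"
  assumes \<mu>: "finite_borel \<mu>" and f: "f \<in> LIP"
  shows "slice_mass \<mu> f \<in> borel_measurable borel"
    and "(\<integral>\<^sup>+s. slice_mass \<mu> f s \<partial>lborel) \<le> ennreal (3 * measure \<mu> UNIV)"
proof -
  interpret finite_measure \<mu> using \<mu> by simp
  interpret pair_sigma_finite \<mu> lborel ..
  have [measurable]: "f \<in> borel_measurable \<mu>" by (rule LIP_measurable[OF f]) (use \<mu> in simp)
  have sp: "space \<mu> = UNIV" by (rule finite_borel_space) (use \<mu> in simp)
  define q where "q n s = ennreal (real (Suc n)) * emeasure \<mu> (strip (real (Suc n)) s f)" for n s
  define i where "i n x s = (indicator {z :: real \<times> real. snd z - 1 / real (Suc n) \<le> fst z \<and> fst z \<le> snd z + 2 / real (Suc n)} (f x, s) :: ennreal)" for n x s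
  have ist: "i n x s = indicator (strip (real (Suc n)) s f) x" for n x s
    by (simp add: i_def strip_def indicator_def)
  have im [measurable]: "case_prod (i n) \<in> borel_measurable (\<mu> \<Otimes>\<^sub>M lborel)" for n
    unfolding i_def indicator_def by measurable
  have im2: "(\<lambda>x. i n x s) \<in> borel_measurable \<mu>" for n s
    unfolding i_def indicator_def by measurable
  have sB: "strip (real (Suc n)) s f \<in> sets \<mu>" for n s
  proof -
    have "{x \<in> space \<mu>. s - 1 / real (Suc n) \<le> f x \<and> f x \<le> s + 2 / real (Suc n)} \<in> sets \<mu>" by measurable
    then show ?thesis by (simp add: strip_def sp)
  qed
  have qi: "q n s = ennreal (real (Suc n)) * (\<integral>\<^sup>+x. i n x s \<partial>\<mu>)" for n s
    unfolding q_def ist by (simp only: nn_integral_indicator[OF sB])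
  have im3: "case_prod (\<lambda>s x. i n x s) \<in> borel_measurable (lborel \<Otimes>\<^sub>M \<mu>)" for n
    unfolding i_def indicator_def by measurable
  have int_m: "(\<lambda>s. \<integral>\<^sup>+x. i n x s \<partial>\<mu>) \<in> borel_measurable lborel" for n
    by (rule sigma_finite_measure.borel_measurable_nn_integral[OF finite_measure.axioms(1)[OF conjunct2[OF \<mu>]] im3])
  have qm: "q n \<in> borel_measurable lborel" for n
    unfolding qi using int_m by (intro borel_measurable_times_ennreal) simp_all
  have sm: "slice_mass \<mu> f = (\<lambda>s. liminf (\<lambda>n. q n s))" unfolding slice_mass_def q_def by (rule HOL.ext) (rule refl)
  show "slice_mass \<mu> f \<in> borel_measurable borel"
    unfolding sm using borel_measurable_liminf[of q lborel] qm by simp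
  have int_q: "(\<integral>\<^sup>+s. q n s \<partial>lborel) = ennreal (3 * measure \<mu> UNIV)" for n
  proof -
    have "(\<integral>\<^sup>+s. (\<integral>\<^sup>+x. i n x s \<partial>\<mu>) \<partial>lborel) = (\<integral>\<^sup>+x. (\<integral>\<^sup>+s. i n x s \<partial>lborel) \<partial>\<mu>)"
      by (rule Fubini'[OF im])
    also have "\<dots> = (\<integral>\<^sup>+x. ennreal (3 / real (Suc n)) \<partial>\<mu>)"
    proof (rule nn_integral_cong)
      fix x
      have "(\<integral>\<^sup>+s. i n x s \<partial>lborel) = (\<integral>\<^sup>+s. indicator {f x - 2 / real (Suc n)..f x + 1 / real (Suc n)} s \<partial>lborel)"
        by (rule nn_integral_cong) (auto simp: i_def indicator_def)
      also have "\<dots> = ennreal ((f x + 1 / real (Suc n)) - (f x - 2 / real (Suc n)))"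
        by (subst nn_integral_indicator) (auto simp: field_simps)
      also have "(f x + 1 / real (Suc n)) - (f x - 2 / real (Suc n)) = 3 / real (Suc n)" by (simp add: add_divide_distrib[symmetric])
      finally show "(\<integral>\<^sup>+s. i n x s \<partial>lborel) = ennreal (3 / real (Suc n))" .
    qed
    also have "\<dots> = ennreal (3 / real (Suc n)) * ennreal (measure \<mu> UNIV)"
      by (simp add: sp emeasure_eq_measure)
    finally have "(\<integral>\<^sup>+s. q n s \<partial>lborel) = ennreal (real (Suc n)) * (ennreal (3 / real (Suc n)) * ennreal (measure \<mu> UNIV))"
      unfolding qi by (simp only: nn_integral_cmult[OF int_m])
    also have "\<dots> = ennreal (real (Suc n) * (3 / real (Suc n) * measure \<mu> UNIV))"
      by (simp add: ennreal_mult'[symmetric] del: of_nat_Suc)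
    finally show ?thesis by simp
  qed
  have "(\<integral>\<^sup>+s. slice_mass \<mu> f s \<partial>lborel) \<le> liminf (\<lambda>n. \<integral>\<^sup>+s. q n s \<partial>lborel)"
    unfolding sm by (rule nn_integral_liminf[OF qm])
  then show "(\<integral>\<^sup>+s. slice_mass \<mu> f s \<partial>lborel) \<le> ennreal (3 * measure \<mu> UNIV)"
    by (simp add: int_q Liminf_const)
qed

lemma slice_mass_frequently:
  assumes "finite_measure \<mu>" "slice_mass \<mu> f s < ennreal b"
  shows "\<exists>\<^sub>F n in sequentially. real (Suc n) * measure \<mu> (strip (real (Suc n)) s f) \<le> b"
proof (rule ccontr)
  assume "\<not> ?thesis"
  then have "eventually (\<lambda>n. b < real (Suc n) * measure \<mu> (strip (real (Suc n)) s f)) sequentially"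
    by (simp add: not_frequently not_le)
  then have "eventually (\<lambda>n. ennreal b \<le> ennreal (real (Suc n)) * emeasure \<mu> (strip (real (Suc n)) s f)) sequentially"
  proof eventually_elim
    fix n assume "b < real (Suc n) * measure \<mu> (strip (real (Suc n)) s f)"
    then have "ennreal b \<le> ennreal (real (Suc n) * measure \<mu> (strip (real (Suc n)) s f))" by (intro ennreal_leI) simp
    then show "ennreal b \<le> ennreal (real (Suc n)) * emeasure \<mu> (strip (real (Suc n)) s f)"
      by (simp add: finite_measure.emeasure_eq_measure[OF assms(1)] ennreal_mult' del: of_nat_Suc)
  qed
  then have "ennreal b \<le> slice_mass \<mu> f s" unfolding slice_mass_def by (rule Liminf_bounded)
  then show False using assms(2) by simp
qed

text \<open>The level estimate is integrated over \<open>s\<close>. The boundary mass is constant in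
  \<open>s\<close> and picks up the length \<open>F\<close> of the range of levels; the slice masses
  contribute the constant 3 from \<open>slice_mass_integral\<close>.\<close>

lemma dust_estimate_nonneg:
  fixes T :: "'a::metric_space functional" and \<pi> :: "('a \<Rightarrow> real) list"
  assumes T: "T \<in> integral_currents TYPE('n::finite)"
    and f: "f \<in> LIPb" "\<And>x. 0 \<le> f x" "\<And>x. f x \<le> F" "0 < F" and \<pi>: "\<pi> \<in> LIPs CARD('n)"
    and L: "Lip (tuple_map \<pi> :: 'a \<Rightarrow> real ^ 'n) \<le> L" "1 \<le> L"
    and r: "0 < r" "2 * (L ^ CARD('n) * mass CARD('n) T) \<le> r ^ CARD('n)"
  shows "\<bar>T f \<pi>\<bar> \<le> r * (2 * real CARD('n) * L ^ (CARD('n) - 1) * (F + 3 * (Lip f + 1))) * normal_mass CARD('n) T"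
proof -
  let ?\<mu> = "mass_measure CARD('n) T"
  have Tc: "T \<in> currents CARD('n)" using integral_currentsD[OF T] by simp
  note fb = finite_borel_mass_measure[OF Tc]
  have fL: "f \<in> LIP" by (rule LIPb_LIP[OF f(1)])
  define c where "c = 2 * real CARD('n) * r * L ^ (CARD('n) - 1)"
  have c: "c > 0" using r L by (simp add: c_def)
  define B where "B = mass (CARD('n) - 1) (boundary CARD('n) T)"
  have B: "0 \<le> B" by (simp add: B_def mass_nonneg)
  \<comment> \<open>The added 1 keeps the factor positive. For constant \<open>f\<close> a factor 0
    would turn an infinite slice mass into 0, and the bound \<open>level\<close> could not be
    asserted at such an \<open>s\<close>.\<close>
  define \<Lambda> where "\<Lambda> = Lip f + 1"
  have \<Lambda>: "\<Lambda> > 0" using Lip_nonneg[OF fL] by (simp add: \<Lambda>_def)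
  note sm = slice_mass_integral[OF fb fL]
  note [measurable] = sm(1)
  have level: "ennreal \<bar>extension CARD('n) T (indicator {x. s < f x}) \<pi>\<bar> \<le> ennreal (c * B) + ennreal (c * \<Lambda>) * slice_mass ?\<mu> f s" for s
  proof -
    let ?E = "\<bar>extension CARD('n) T (indicator {x. s < f x}) \<pi>\<bar>"
    have est: "?E \<le> c * (B + \<Lambda> * b)" if "slice_mass ?\<mu> f s < ennreal b" for b
    proof -
      have b: "0 \<le> b" using that by (cases "0 \<le> b") (auto simp: ennreal_neg)
      have "?E \<le> c * (B + Lip f * b)"
        using superlevel_estimate[OF T fL \<pi> L(1) r slice_mass_frequently[OF conjunct2[OF fb] that]]
        by (simp only: c_def B_def mult.assoc)
      also have "\<dots> \<le> c * (B + \<Lambda> * b)" using c b by (intro mult_left_mono add_left_mono mult_right_mono) (auto simp: \<Lambda>_def)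
      finally show ?thesis .
    qed
    show ?thesis
    proof (cases "slice_mass ?\<mu> f s" rule: ennreal_cases)
      case top
      then show ?thesis using c \<Lambda> by (simp add: ennreal_mult_top)
    next
      case (real d)
      \<comment> \<open>\<open>est\<close> requires a number strictly above the slice mass, so
        \<open>d\<close> is approached from above.\<close>
      have "?E \<le> c * (B + \<Lambda> * d) + (c * \<Lambda>) * e" if "e > 0" for e
        using est[of "d + e"] real that by (simp add: ennreal_less_iff algebra_simps del: ennreal_plus)
      then have "?E \<le> c * (B + \<Lambda> * d)" by (rule le_epsilon_mult[OF _ mult_nonneg_nonneg[OF less_imp_le[OF c] less_imp_le[OF \<Lambda>]]])
      then have "ennreal ?E \<le> ennreal (c * (B + \<Lambda> * d))" by (rule ennreal_leI)
      also have "\<dots> = ennreal (c * B) + ennreal (c * \<Lambda>) * ennreal d"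
        using c B \<Lambda> real(1) by (simp add: ennreal_mult'[symmetric] ennreal_plus[symmetric] algebra_simps del: ennreal_plus)
      finally show ?thesis unfolding real(2) .
    qed
  qed
  have "ennreal \<bar>T f \<pi>\<bar> \<le> (\<integral>\<^sup>+s. (ennreal (c * B) + ennreal (c * \<Lambda>) * slice_mass ?\<mu> f s) * indicator {0..F} s \<partial>lborel)"
    by (rule layer_cake_le[OF Tc f(1-3) f(4) \<pi> _ level]) measurable
  also have "\<dots> \<le> (\<integral>\<^sup>+s. ennreal (c * B) * indicator {0..F} s + ennreal (c * \<Lambda>) * slice_mass ?\<mu> f s \<partial>lborel)"
    by (rule nn_integral_mono) (auto split: split_indicator)
  also have "\<dots> = ennreal (c * B) * ennreal F + ennreal (c * \<Lambda>) * (\<integral>\<^sup>+s. slice_mass ?\<mu> f s \<partial>lborel)"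
    using f(4) by (subst nn_integral_add) (auto simp: nn_integral_cmult nn_integral_cmult_indicator)
  also have "\<dots> \<le> ennreal (c * B) * ennreal F + ennreal (c * \<Lambda>) * ennreal (3 * mass CARD('n) T)"
    using sm(2) by (intro add_left_mono mult_left_mono) (auto simp: mass_def)
  also have "\<dots> = ennreal (c * B * F + c * \<Lambda> * (3 * mass CARD('n) T))"
    using c B \<Lambda> f(4) mass_nonneg[of "CARD('n)" T] by (simp add: ennreal_mult'[symmetric] ennreal_plus[symmetric] del: ennreal_plus)
  finally have "\<bar>T f \<pi>\<bar> \<le> c * B * F + c * \<Lambda> * (3 * mass CARD('n) T)"
    using c B \<Lambda> f(4) mass_nonneg[of "CARD('n)" T] by (subst (asm) ennreal_le_iff) auto
  also have "\<dots> \<le> c * (F + 3 * \<Lambda>) * (mass CARD('n) T + B)"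
  proof -
    have "0 \<le> c * (F * mass CARD('n) T + 3 * \<Lambda> * B)"
      using c B \<Lambda> f(4) mass_nonneg[of "CARD('n)" T] by simp
    then show ?thesis by (simp add: algebra_simps)
  qed
  finally show ?thesis by (simp add: c_def B_def \<Lambda>_def normal_mass_def mult_ac)
qed

text \<open>A signed \<open>f\<close> is written as the difference of \<open>f + F\<close> and the
  constant \<open>F\<close>, both nonnegative. \<open>C\<close> and \<open>L\<close> depend on the
  pair alone, so they can be fixed before \<open>r\<close> and before the currents.\<close>

lemma dust_estimate:
  fixes f :: "'a::metric_space \<Rightarrow> real"
  assumes "(f, \<pi>) \<in> Dk CARD('n::finite)"
  obtains C L where "0 \<le> C" "1 \<le> L"
    "\<And>T r. T \<in> integral_currents TYPE('n) \<Longrightarrow> 0 < r \<Longrightarrow>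
      2 * (L ^ CARD('n) * mass CARD('n) T) \<le> r ^ CARD('n) \<Longrightarrow>
      \<bar>T f \<pi>\<bar> \<le> r * C * normal_mass CARD('n) T"
proof -
  have f: "f \<in> LIPb" and \<pi>: "\<pi> \<in> LIPs CARD('n)" using assms by (auto simp: Dk_def)
  obtain F where F: "0 < F" "\<And>x. \<bar>f x\<bar> \<le> F" using LIPb_bound[OF f] by metis
  \<comment> \<open>At least 1, so that powers of \<open>L\<close> may be divided by when a
    threshold for the norms is computed from \<open>r\<close>.\<close>
  define L where "L = max 1 (Lip (tuple_map \<pi> :: 'a \<Rightarrow> real ^ 'n))"
  define K where "K = 2 * real CARD('n) * L ^ (CARD('n) - 1)"
  define g where "g x = 1 * f x + F * 1" for x
  have gL: "g \<in> LIPb" unfolding g_def by (rule LIPb_lincomb[OF f LIPb_const])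
  have g: "0 \<le> g x" "g x \<le> 2 * F" for x using F(2)[of x] by (auto simp: g_def abs_le_iff)
  define C where "C = K * (2 * F + 3 * (Lip g + 1)) + K * (F + 3 * (Lip (\<lambda>_ :: 'a. F) + 1))"
  have K: "0 \<le> K" by (simp add: K_def L_def)
  have "\<bar>T f \<pi>\<bar> \<le> r * C * normal_mass CARD('n) T"
    if T: "T \<in> integral_currents TYPE('n)" and r: "0 < r" "2 * (L ^ CARD('n) * mass CARD('n) T) \<le> r ^ CARD('n)" for T r
  proof -
    have Tc: "T \<in> currents CARD('n)" using integral_currentsD[OF T] by simp
    have "T f \<pi> = T g \<pi> - T (\<lambda>_. F) \<pi>"
      unfolding g_def using currents_lincomb[OF Tc f LIPb_const \<pi>, of 1 F 1] currents_cmult[OF Tc LIPb_const[of 1] \<pi>, of F]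
      by simp
    moreover have "\<bar>T g \<pi>\<bar> \<le> r * (K * (2 * F + 3 * (Lip g + 1))) * normal_mass CARD('n) T"
      unfolding K_def by (rule dust_estimate_nonneg[OF T gL g _ \<pi> _ _ r]) (use F in \<open>auto simp: L_def\<close>)
    moreover have "\<bar>T (\<lambda>_. F) \<pi>\<bar> \<le> r * (K * (F + 3 * (Lip (\<lambda>_ :: 'a. F) + 1))) * normal_mass CARD('n) T"
      unfolding K_def by (rule dust_estimate_nonneg[OF T LIPb_const _ _ _ \<pi> _ _ r]) (use F in \<open>auto simp: L_def\<close>)
    ultimately have "\<bar>T f \<pi>\<bar> \<le> r * (K * (2 * F + 3 * (Lip g + 1))) * normal_mass CARD('n) T
      + r * (K * (F + 3 * (Lip (\<lambda>_ :: 'a. F) + 1))) * normal_mass CARD('n) T" by linarith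
    also have "\<dots> = r * C * normal_mass CARD('n) T"
      unfolding C_def distrib_left[of r] distrib_right[of _ _ "normal_mass CARD('n) T"] ..
    finally show ?thesis .
  qed
  moreover have "0 \<le> C"
    unfolding C_def using K F(1) Lip_nonneg[OF LIPb_LIP[OF gL]] Lip_nonneg[OF LIP_const[of F], where 'a = 'a] by simp
  moreover have "1 \<le> L" by (simp add: L_def)
  ultimately show ?thesis using that by blast
qed


subsection \<open>The decomposition theorem\<close>

lemma normal_mass_limit_sums:
  fixes T :: "'a::metric_space functional"
  assumes T: "T \<in> integral_currents TYPE('n::finite)" and S: "\<And>n. S n \<in> integral_currents TYPE('n)"
    and lim: "(\<lambda>n. normal_mass CARD('n) (T - (\<Sum>i<n. S i))) \<longlonglongrightarrow> 0" and D: "(f, \<pi>) \<in> Dk CARD('n)"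
  shows "(\<lambda>n. S n f \<pi>) sums T f \<pi>"
proof -
  have f: "f \<in> LIPb" and \<pi>: "\<pi> \<in> LIPs CARD('n)" using D by (auto simp: Dk_def)
  obtain F where F: "0 < F" "\<And>x. \<bar>f x\<bar> \<le> F" using LIPb_bound[OF f] by metis
  let ?P = "\<Prod>p\<leftarrow>\<pi>. Lip p"
  have sumI: "(\<Sum>i<n. S i) \<in> integral_currents TYPE('n)" for n
  proof (induction n)
    case 0
    show ?case by (simp only: lessThan_0 sum.empty integral_zero)
  next
    case (Suc n)
    show ?case unfolding sum.lessThan_Suc by (rule integral_add(1)[OF Suc S])
  qed
  have R: "T - (\<Sum>i<n. S i) \<in> currents CARD('n)" for n
    using integral_currentsD(1)[OF integral_add(1)[OF T integral_uminus[OF sumI[of n]]]] by simp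
  have le: "\<bar>T f \<pi> - (\<Sum>i<n. S i f \<pi>)\<bar> \<le> ?P * (F * normal_mass CARD('n) (T - (\<Sum>i<n. S i)))" for n
  proof -
    have "\<bar>(T - (\<Sum>i<n. S i)) f \<pi>\<bar> \<le> ?P * (F * mass CARD('n) (T - (\<Sum>i<n. S i)))"
      by (rule current_abs_le[OF R f \<pi> F(2)])
    also have "\<dots> \<le> ?P * (F * normal_mass CARD('n) (T - (\<Sum>i<n. S i)))"
      using F by (intro mult_left_mono prod_Lip_nonneg[OF \<pi>]) (auto simp: normal_mass_def mass_nonneg)
    finally show ?thesis by (simp add: sum_functional_apply)
  qed
  have "(\<lambda>n. ?P * (F * normal_mass CARD('n) (T - (\<Sum>i<n. S i)))) \<longlonglongrightarrow> 0"
    by (intro tendsto_mult_right_zero lim)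
  then have "(\<lambda>n. T f \<pi> - (\<Sum>i<n. S i f \<pi>)) \<longlonglongrightarrow> 0"
    by (rule Lim_null_comparison[rotated]) (simp add: le)
  then have "(\<lambda>n. T f \<pi> - (T f \<pi> - (\<Sum>i<n. S i f \<pi>))) \<longlonglongrightarrow> T f \<pi> - 0" by (intro tendsto_intros)
  then show ?thesis by (simp add: sums_def)
qed

text \<open>Pick a pair on which \<open>T\<close> does not vanish. Convergence in norm makes
  \<open>T f \<pi>\<close> the sum of the values on the pieces. If all pieces are small at scale
  \<open>r\<close>, these values add up to at most \<open>r * C\<close> times the norm of
  \<open>T\<close>, and \<open>r\<close> was chosen to make this less than
  \<open>\<bar>T f \<pi>\<bar>\<close>.\<close>

lemma integral_no_dust:
  fixes T :: "'a::metric_space functional"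
  assumes T: "T \<in> integral_currents TYPE('n::finite)" "T \<noteq> 0"
  shows "\<exists>e>0. \<forall>S. (\<forall>n. S n \<in> integral_currents TYPE('n) \<and> normal_mass CARD('n) (S n) \<le> e) \<longrightarrow>
      (\<lambda>n. normal_mass CARD('n) (S n)) sums normal_mass CARD('n) T \<longrightarrow>
      \<not> (\<lambda>n. normal_mass CARD('n) (T - (\<Sum>i<n. S i))) \<longlonglongrightarrow> 0"
proof -
  let ?N = "normal_mass CARD('n)"
  obtain f \<pi> where ne: "T f \<pi> \<noteq> 0" using T(2) by (auto simp: fun_eq_iff)
  then have D: "(f, \<pi>) \<in> Dk CARD('n)" using currents_outside[OF integral_currentsD(1)[OF T(1)]] by blast
  obtain C L where C: "0 \<le> C" "1 \<le> L" and dust: "\<And>S r. S \<in> integral_currents TYPE('n) \<Longrightarrow> 0 < r \<Longrightarrow>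
      2 * (L ^ CARD('n) * mass CARD('n) S) \<le> r ^ CARD('n) \<Longrightarrow> \<bar>S f \<pi>\<bar> \<le> r * C * ?N S"
    using dust_estimate[OF D] by metis
  define r where "r = \<bar>T f \<pi>\<bar> / (2 * (C * ?N T + 1))"
  have CN: "0 \<le> C * ?N T" by (intro mult_nonneg_nonneg C(1) normal_mass_nonneg)
  then have r: "r > 0" using ne by (simp add: r_def)
  have "r * (2 * (C * ?N T + 1)) = \<bar>T f \<pi>\<bar>" using CN by (simp add: r_def)
  then have small: "r * (C * ?N T) < \<bar>T f \<pi>\<bar>" using r CN by (simp add: algebra_simps)
  \<comment> \<open>The largest norm for which the smallness condition in \<open>dust\<close> is
    guaranteed at scale \<open>r\<close>.\<close>
  define e where "e = r ^ CARD('n) / (2 * L ^ CARD('n))"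
  have e: "e > 0" using r C(2) by (simp add: e_def)
  have "\<not> (\<lambda>n. ?N (T - (\<Sum>i<n. S i))) \<longlonglongrightarrow> 0"
    if S: "\<And>n. S n \<in> integral_currents TYPE('n)" "\<And>n. ?N (S n) \<le> e" and sums: "(\<lambda>n. ?N (S n)) sums ?N T" for S
  proof
    assume lim: "(\<lambda>n. ?N (T - (\<Sum>i<n. S i))) \<longlonglongrightarrow> 0"
    have Sf: "(\<lambda>n. S n f \<pi>) sums T f \<pi>" by (rule normal_mass_limit_sums[OF T(1) S(1) lim D])
    have le: "\<bar>S n f \<pi>\<bar> \<le> r * C * ?N (S n)" for n
    proof (rule dust[OF S(1) r])
      have "mass CARD('n) (S n) \<le> e"
        using S(2)[of n] mass_nonneg[of "CARD('n) - 1" "boundary CARD('n) (S n)"] unfolding normal_mass_def by linarith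
      then have "2 * (L ^ CARD('n) * mass CARD('n) (S n)) \<le> 2 * (L ^ CARD('n) * e)"
        using C(2) by (intro mult_left_mono) auto
      also have "\<dots> = r ^ CARD('n)" using C(2) by (simp add: e_def)
      finally show "2 * (L ^ CARD('n) * mass CARD('n) (S n)) \<le> r ^ CARD('n)" .
    qed
    have s1: "(\<lambda>n. r * C * ?N (S n)) sums (r * C * ?N T)" by (rule sums_mult[OF sums])
    have s2: "summable (\<lambda>n. \<bar>S n f \<pi>\<bar>)"
      by (rule summable_comparison_test'[OF sums_summable[OF s1]]) (use le in simp)
    have "\<bar>T f \<pi>\<bar> \<le> (\<Sum>n. \<bar>S n f \<pi>\<bar>)" using summable_rabs[OF s2] Sf by (simp add: sums_iff)
    also have "\<dots> \<le> (\<Sum>n. r * C * ?N (S n))" by (rule suminf_le[OF le s2 sums_summable[OF s1]])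
    also have "\<dots> = r * C * ?N T" using s1 by (simp add: sums_iff)
    finally show False using small by (simp add: mult.assoc)
  qed
  then show ?thesis using e by blast
qed

lemma normed_group_integral_currents:
  "normed_group_without_dust (integral_currents TYPE('n::finite) :: 'a::metric_space functional set) (normal_mass CARD('n))"
proof
  fix S :: "nat \<Rightarrow> 'a functional"
  assume "\<And>n. S n \<in> integral_currents TYPE('n)" "summable (\<lambda>n. normal_mass CARD('n) (S n))"
  then show "\<exists>T\<in>integral_currents TYPE('n). (\<lambda>n. normal_mass CARD('n) (T - (\<Sum>i<n. S i))) \<longlonglongrightarrow> 0"
    using integral_series(1) integral_complete by blast
qed (fact integral_zero integral_add integral_uminus normal_mass_nonneg normal_mass_zero integral_eq_0
    normal_mass_uminus integral_no_dust)+

theorem theorem3p2: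
  fixes T :: "'a::complete_space functional"
  assumes "\<And>A :: 'a set. ulam A"
    and "T \<in> integral_currents TYPE('n::finite)"
  shows "\<exists>(I :: nat set) (Ts :: nat \<Rightarrow> 'a functional).
     (\<forall>i\<in>I. Ts i \<in> integral_currents TYPE('n) - {zero_current} \<and> \<not> decomposable TYPE('n) (Ts i)) \<and>
     current_has_sum CARD('n) Ts T I \<and>
     ((\<lambda>i. normal_mass CARD('n) (Ts i)) has_sum normal_mass CARD('n) T) I"
proof -
  let ?G = "integral_currents TYPE('n) :: 'a functional set" and ?N = "normal_mass CARD('n)"
  interpret normed_group_without_dust ?G ?N by (rule normed_group_integral_currents)
  obtain S where S: "\<And>n. S n = 0 \<or> S n \<in> ?G - {0} \<and> indecomposable (S n)"
    and NS: "(\<lambda>n. ?N (S n)) sums ?N T" and lim: "(\<lambda>n. ?N (T - (\<Sum>i<n. S i))) \<longlonglongrightarrow> 0"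
    using indecomposable_decomposition[OF assms(2)] by metis
  \<comment> \<open>The greedy sequence may contain zero terms, for instance after \<open>T\<close>
    is exhausted in finitely many steps. They are dropped, so \<open>I\<close> may be finite or
    empty.\<close>
  define I where "I = {n. S n \<noteq> 0}"
  have SG: "S n \<in> ?G" for n using S[of n] integral_zero by auto
  have "S i \<in> ?G - {zero_current} \<and> \<not> decomposable TYPE('n) (S i)" if "i \<in> I" for i
  proof -
    have "decomposable TYPE('n) (S i) \<longleftrightarrow> \<not> indecomposable (S i)"
      by (simp only: decomposable_def indecomposable_def zero_current_eq plus_fun_def not_not)
    then show ?thesis using S[of i] that by (auto simp: I_def zero_current_eq)
  qed
  moreover have "current_has_sum CARD('n) S T I"
    unfolding current_has_sum_def weakly_converges_def
  proof (intro ballI)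
    fix z :: "('a \<Rightarrow> real) \<times> ('a \<Rightarrow> real) list" assume "z \<in> Dk CARD('n)"
    then obtain f \<pi> where z: "z = (f, \<pi>)" and D: "(f, \<pi>) \<in> Dk CARD('n)" by (cases z) auto
    then have f: "f \<in> LIPb" and \<pi>: "\<pi> \<in> LIPs CARD('n)" by (auto simp: Dk_def)
    obtain F where F: "0 < F" "\<And>x. \<bar>f x\<bar> \<le> F" using LIPb_bound[OF f] by metis
    \<comment> \<open>Absolute summability turns the limit of consecutive partial sums into the
      limit over the net of finite subsets.\<close>
    have "summable (\<lambda>n. norm (S n f \<pi>))"
    proof (rule summable_comparison_test'[OF summable_mult[OF sums_summable[OF NS], of "(\<Prod>p\<leftarrow>\<pi>. Lip p) * F"]])
      fix n
      have "\<bar>S n f \<pi>\<bar> \<le> (\<Prod>p\<leftarrow>\<pi>. Lip p) * (F * mass CARD('n) (S n))"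
        by (rule current_abs_le[OF integral_currentsD(1)[OF SG] f \<pi> F(2)])
      also have "\<dots> \<le> (\<Prod>p\<leftarrow>\<pi>. Lip p) * (F * ?N (S n))"
        using F by (intro mult_left_mono prod_Lip_nonneg[OF \<pi>]) (auto simp: normal_mass_def mass_nonneg)
      finally show "norm (norm (S n f \<pi>)) \<le> (\<Prod>p\<leftarrow>\<pi>. Lip p) * F * ?N (S n)" by (simp add: mult.assoc)
    qed
    then have "((\<lambda>n. S n f \<pi>) has_sum T f \<pi>) UNIV"
      by (rule norm_summable_imp_has_sum[OF _ normal_mass_limit_sums[OF assms(2) SG lim D]])
    then have "((\<lambda>n. S n f \<pi>) has_sum T f \<pi>) I"
      by (subst has_sum_cong_neutral[of UNIV I _ "\<lambda>n. S n f \<pi>"]) (auto simp: I_def)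
    then show "case z of (f, \<pi>) \<Rightarrow> ((\<lambda>J. \<Sum>i\<in>J. S i f \<pi>) \<longlongrightarrow> T f \<pi>) (finite_subsets_at_top I)"
      by (simp add: z has_sum_def)
  qed
  moreover have "((\<lambda>i. ?N (S i)) has_sum ?N T) I"
  proof -
    have "((\<lambda>n. ?N (S n)) has_sum ?N T) UNIV"
      by (rule norm_summable_imp_has_sum[OF _ NS]) (use sums_summable[OF NS] in \<open>simp add: normal_mass_nonneg\<close>)
    then show ?thesis
      by (subst has_sum_cong_neutral[of UNIV I _ "\<lambda>n. ?N (S n)"]) (auto simp: I_def normal_mass_zero)
  qed
  ultimately show ?thesis by blast
qed

end
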